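(* Let $\alpha\ge-\frac12$ and $1<p<q<\infty$. Let $\rho:\mathbb{R}^+\to\mathbb{R}^+$ satisfy the doubling condition and $\int_0^1\frac{\rho(t)}t\,dt<\infty$. Let $\phi:\mathbb{R}^+\to\mathbb{R}^+$ be measurable, with $\phi$ almost decreasing and $r\mapsto r^{d_\alpha/p}\phi(r)$ almost increasing; assume that $\phi$ satisfies the doubling condition, is surjective, and that there is a constant $C_0>0$ such that for all $r>0$, $$\phi(r)\int_0^r\frac{\rho(t)}t\,dt+\int_r^\infty\frac{\rho(t)\phi(t)}t\,dt\le C_0(\phi(r))^{p/q}.$$ Then the generalized Dunkl-type fractional integral operator $T_\rho^\alpha$ is bounded from $L^{p,\phi}(\mathbb{R},d\mu_\alpha)$ to $L^{q,\psi}(\mathbb{R},d\mu_\alpha)$, where $\psi(r)=(\phi(r))^{p/q}$: there is a constant $C>0$ such that for all $f\in L^{p,\phi}(\mathbb{R},d\mu_\alpha)$, $$\|T_\rho^\alpha f\|_{L^{q,\psi}(\mathbb{R},d\mu_\alpha)}\le C\,\|f\|_{L^{p,\phi}(\mathbb{R},d\mu_\alpha)}.$$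
   Context: Notation: $\mathbb{R}^+=(0,\infty)$; $\alpha\ge-\frac12$ is a fixed real number; $d_\alpha=2\alpha+2$; $d\mu_\alpha(x)=A_\alpha|x|^{2\alpha+1}dx$ on $\mathbb{R}$ with $A_\alpha=(2^{\alpha+1}\Gamma(\alpha+1))^{-1}$; $B(0,r)=(-r,r)$. Dunkl translation: for $x,y\in\mathbb{R}$ and $\theta\in[0,\pi]$ put $(x,y)_\theta=\sqrt{x^2+y^2-2xy\cos\theta}$. For a function $g$ on $\mathbb{R}$ (continuous, or locally integrable with respect to $\mu_\alpha$, in which case the formula is understood for almost every $y$), $$\tau_x^\alpha g(y)=\frac{c_\alpha}{2}\int_0^\pi\Big\{g((x,y)_\theta)+g(-(x,y)_\theta)+\frac{x+y}{(x,y)_\theta}\big[g((x,y)_\theta)-g(-(x,y)_\theta)\big]\Big\}(1-\cos\theta)\sin^{2\alpha}\theta\,d\theta,$$ with $c_\alpha=\big(\int_0^\pi\sin^{2\alpha}\theta\,d\theta\big)^{-1}$; for $\alpha=-\frac12$ it is the ordinary translation $\tau_x^\alpha g(y)=g(x+y)$. The notation $\tau_x^\alpha|f|^p(y)$ means $(\tau_x^\alpha(|f|^p))(y)$. Generalized Dunkl-type Morrey space: for $1\le p<\infty$ and $\phi:\mathbb{R}^+\to\mathbb{R}^+$, $L^{p,\phi}(\mathbb{R},d\mu_\alpha)$ is the set of locally $p$-integrable $f$ on $\mathbb{R}$ with $$\|f\|_{L^{p,\phi}(\mathbb{R},d\mu_\alpha)}=\sup_{r>0,\,x\in\mathbb{R}}\frac1{\phi(r)}\Big(\frac1{r^{d_\alpha}}\int_{B(0,r)}\tau_x^\alpha|f|^p(y)\,d\mu_\alpha(y)\Big)^{1/p}<\infty.$$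 Generalized Dunkl-type fractional integral operator: $T_\rho^\alpha f(x)=\int_{\mathbb{R}}f(y)\,\tau_x^\alpha K_\rho^\alpha(y)\,d\mu_\alpha(y)$, where $K_\rho^\alpha(x)=\frac{\rho(|x|)}{|x|^{d_\alpha}}$. A function $\theta:\mathbb{R}^+\to\mathbb{R}^+$ satisfies the doubling condition if there is $C_1>0$ such that $\frac12\le\frac rs\le2$ implies $\frac1{C_1}\le\frac{\theta(r)}{\theta(s)}\le C_1$; it is almost increasing (resp. almost decreasing) if there is $C>0$ with $\theta(r)\le C\theta(s)$ (resp. $\theta(r)\ge C\theta(s)$) for all $r\le s$. *)

theory Defs
  imports "HOL-Analysis.Analysis"
begin

(* Functions on the positive half-line are represented by functions real => real of which only
   the values on {0<..} are ever constrained. *)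

definition doubling :: "(real \<Rightarrow> real) \<Rightarrow> bool" where
  "doubling \<theta> \<longleftrightarrow>
     (\<exists>C>0. \<forall>r>0. \<forall>s>0. 1/2 \<le> r/s \<and> r/s \<le> 2 \<longrightarrow> 1/C \<le> \<theta> r / \<theta> s \<and> \<theta> r / \<theta> s \<le> C)"

definition almost_increasing :: "(real \<Rightarrow> real) \<Rightarrow> bool" where
  "almost_increasing \<theta> \<longleftrightarrow> (\<exists>C>0. \<forall>r s. 0 < r \<and> r \<le> s \<longrightarrow> \<theta> r \<le> C * \<theta> s)"

definition almost_decreasing :: "(real \<Rightarrow> real) \<Rightarrow> bool" where
  "almost_decreasing \<theta> \<longleftrightarrow> (\<exists>C>0. \<forall>r s. 0 < r \<and> r \<le> s \<longrightarrow> \<theta> r \<ge> C * \<theta> s)"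

definition dunkl_dim :: "real \<Rightarrow> real" where
  "dunkl_dim \<alpha> = 2 * \<alpha> + 2"

(* "Measurable" means Lebesgue measurable throughout, so all integrals are taken with respect to
   the completed measure lebesgue. *)

definition dunkl_measure :: "real \<Rightarrow> real measure" where
  "dunkl_measure \<alpha> =
     density lebesgue
       (\<lambda>x. ennreal (inverse (2 powr (\<alpha> + 1) * Gamma (\<alpha> + 1)) * \<bar>x\<bar> powr (2 * \<alpha> + 1)))"

definition dunkl_const :: "real \<Rightarrow> real" where
  "dunkl_const \<alpha> = inverse (LINT \<theta>:{0..pi}|lebesgue. sin \<theta> powr (2 * \<alpha>))"

definition dunkl_arg :: "real \<Rightarrow> real \<Rightarrow> real \<Rightarrow> real" where
  "dunkl_arg x y \<theta> = sqrt (x\<^sup>2 + y\<^sup>2 - 2 * x * y * cos \<theta>)"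

(* The conventions 0 powr a = 0 and division by zero being zero only matter at the endpoints of
   the range of integration and where dunkl_arg vanishes, which for (x, y) other than (0, 0) is at
   most one of the two endpoints. *)

definition dunkl_translation :: "real \<Rightarrow> real \<Rightarrow> (real \<Rightarrow> real) \<Rightarrow> real \<Rightarrow> real" where
  "dunkl_translation \<alpha> x g y =
     (if \<alpha> = -1/2 then g (x + y)
      else dunkl_const \<alpha> / 2 *
        (LINT \<theta>:{0..pi}|lebesgue.
           (g (dunkl_arg x y \<theta>) + g (- dunkl_arg x y \<theta>)
             + (x + y) / dunkl_arg x y \<theta> * (g (dunkl_arg x y \<theta>) - g (- dunkl_arg x y \<theta>)))
           * (1 - cos \<theta>) * sin \<theta> powr (2 * \<alpha>)))"

(* The translation of a nonnegative function can take negative values, so the inner integral is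
   a signed one.  The integral itself is nonnegative, since it equals the integral of |f|^p against
   the translate by -x of the (even) indicator function of the ball, which is nonnegative; hence
   neither powr nor the coercion to ennreal ever sees a negative argument. *)

definition morrey_norm ::
    "real \<Rightarrow> real \<Rightarrow> (real \<Rightarrow> real) \<Rightarrow> (real \<Rightarrow> complex) \<Rightarrow> ennreal" where
  "morrey_norm \<alpha> p \<phi> f =
     (SUP r\<in>{0<..}. SUP x.
        ennreal (1 / \<phi> r *
          (1 / r powr dunkl_dim \<alpha> *
            (LINT y:ball 0 r|dunkl_measure \<alpha>.
               dunkl_translation \<alpha> x (\<lambda>z. norm (f z) powr p) y)) powr (1 / p)))"

definition morrey_space ::
    "real \<Rightarrow> real \<Rightarrow> (real \<Rightarrow> real) \<Rightarrow> (real \<Rightarrow> complex) set" where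
  "morrey_space \<alpha> p \<phi> =
     {f \<in> borel_measurable (dunkl_measure \<alpha>).
        (\<forall>K. compact K \<longrightarrow> set_integrable (dunkl_measure \<alpha>) K (\<lambda>x. norm (f x) powr p)) \<and>
        morrey_norm \<alpha> p \<phi> f < \<infinity>}"

definition dunkl_kernel :: "real \<Rightarrow> (real \<Rightarrow> real) \<Rightarrow> real \<Rightarrow> real" where
  "dunkl_kernel \<alpha> \<rho> x = \<rho> \<bar>x\<bar> / \<bar>x\<bar> powr dunkl_dim \<alpha>"

definition dunkl_frac_integrand ::
    "real \<Rightarrow> (real \<Rightarrow> real) \<Rightarrow> (real \<Rightarrow> complex) \<Rightarrow> real \<Rightarrow> real \<Rightarrow> complex" where
  "dunkl_frac_integrand \<alpha> \<rho> f x y =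
     f y * complex_of_real (dunkl_translation \<alpha> x (dunkl_kernel \<alpha> \<rho>) y)"

definition dunkl_frac_integral ::
    "real \<Rightarrow> (real \<Rightarrow> real) \<Rightarrow> (real \<Rightarrow> complex) \<Rightarrow> real \<Rightarrow> complex" where
  "dunkl_frac_integral \<alpha> \<rho> f x =
     (LINT y|dunkl_measure \<alpha>. dunkl_frac_integrand \<alpha> \<rho> f x y)"

end

theory Submission
  imports Defs
begin

text \<open>Write \<open>\<mu>\<close> for the weighted measure, \<open>d = 2\<alpha> + 2\<close>, \<open>V(x,r) = r (\<bar>x\<bar> + r)\<^bsup>2\<alpha>+1\<^esup>\<close> for the size of the
  ball \<open>B(x,r)\<close>, and \<open>k\<^sub>r(x,y) \<ge> 0\<close> for the translate by \<open>x\<close> of the indicator function of \<open>B(0,r)\<close>. The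
  boundedness is Hedberg's argument for fractional integrals on a doubling measure space; what has to be
  dealt with first is that the Dunkl translation has a signed kernel and that it concentrates a function
  around two points instead of one.

  Duality removes the signs: the integral of \<open>\<tau>\<^sub>x g\<close> over \<open>B(0,r)\<close> is \<open>\<integral> g k\<^sub>r(-x,\<cdot>) d\<mu>\<close>
  (\<open>ball_integral_translation\<close>). By the law of cosines, the substitution of \<open>z = (x,y)\<^sub>\<theta>\<close> for \<open>\<theta>\<close> turns
  \<open>\<bar>y\<bar>\<^bsup>2\<alpha>+1\<^esup> sin\<^bsup>2\<alpha>\<^esup>\<theta> dy d\<theta>\<close> into a density on the pairs \<open>(y,z)\<close> that is symmetric in \<open>y\<close> and \<open>z\<close>, and
  once \<open>y\<close> and \<open>z\<close> are exchanged, the signed weights of the translation at \<open>y\<close> and \<open>-y\<close> have a nonnegative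
  sum. An estimate of the angles shows that \<open>k\<^sub>r(x,\<cdot>)\<close> is at most a constant times \<open>r\<^sup>d / V(x,r)\<close>, vanishes outside
  \<open>B(x,r) \<union> B(-x,r)\<close>, and is at least a constant times \<open>r\<^sup>d / V(x,r)\<close> on \<open>B(-x,r/4)\<close> (\<open>ball_kernel_le\<close>,
  \<open>ball_kernel_ge\<close>). So a Morrey norm at most \<open>N\<close> amounts, up to constants, to the condition
  \<open>\<integral>\<^bsub>B(x,r)\<^esub> \<bar>f\<bar>\<^sup>p d\<mu> \<le> V(x,r) (\<phi>(r) N)\<^sup>p\<close> over ordinary balls, in which no translation occurs
  (\<open>morrey_bound_of_norm\<close>, \<open>morrey_norm_of_bound\<close>).

  The kernel \<open>\<rho>(\<bar>z\<bar>) / \<bar>z\<bar>\<^sup>d\<close> is even and, by doubling, at most a constant times the integral of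
  \<open>\<rho>(t) t\<^bsup>-d-1\<^esup>\<close> over \<open>t > \<bar>z\<bar>\<close>, that is, a superposition of indicator functions of balls. Hence the
  fractional integral of \<open>f\<close> at \<open>x\<close> is at most a constant times \<open>G(x) + G(-x)\<close>, where \<open>G(x)\<close> is the integral over
  \<open>t > 0\<close> of \<open>\<rho>(t) / t\<close> times the mean of \<open>\<bar>f\<bar>\<close> over \<open>B(x,t)\<close> (\<open>potential_le\<close>). Up to constants this mean is bounded by
  the maximal function \<open>M f(x)\<close>, and also by \<open>\<phi>(t) N\<close>. Use the first bound for \<open>t < r\<close> and
  the second for \<open>t > r\<close>, where \<open>\<phi>(r) = M f(x) / N\<close>; such an \<open>r\<close> exists because \<open>\<phi>\<close> is surjective. The
  integral condition on \<open>\<rho>\<close> and \<open>\<phi>\<close> then gives \<open>G(x) \<le> C N (M f(x) / N)\<^bsup>p/q\<^esup>\<close> (\<open>hedberg_estimate\<close>).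

  The maximal function satisfies the same Morrey condition as \<open>f\<close> (\<open>maximal_morrey\<close>): the part of \<open>f\<close> near a
  ball is handled by the \<open>L\<^sup>p\<close> estimate, which follows from Vitali's covering lemma and the layer cake
  formula, and the far part by the monotonicity of \<open>\<phi>\<close>. Integrating the \<open>q\<close>-th power of the pointwise
  estimate over balls gives the theorem.\<close>

section \<open>The weighted measure and almost everywhere equal functions\<close>

abbreviation dunkl_weight :: "real \<Rightarrow> real" where
  "dunkl_weight \<alpha> \<equiv> inverse (2 powr (\<alpha> + 1) * Gamma (\<alpha> + 1))"

text \<open>The measure \<open>dunkl_measure \<alpha>\<close> is the completion of this one. Product measures are formed from the
  Borel version.\<close>

definition dunkl_borel :: "real \<Rightarrow> real measure" where
  "dunkl_borel \<alpha> =
     density lborel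
       (\<lambda>x. ennreal (dunkl_weight \<alpha> * \<bar>x\<bar> powr (2 * \<alpha> + 1)))"

lemma ball_real_borel [measurable]: "ball (x::real) r \<in> sets borel"
  by simp

lemma sets_dunkl_borel [measurable_cong, simp]: "sets (dunkl_borel \<alpha>) = sets borel"
  by (simp add: dunkl_borel_def)

lemma space_dunkl_borel [simp]: "space (dunkl_borel \<alpha>) = UNIV"
  by (simp add: dunkl_borel_def)

lemma sigma_finite_dunkl_borel: "sigma_finite_measure (dunkl_borel \<alpha>)"
  unfolding dunkl_borel_def
  by (subst sigma_finite_measure.sigma_finite_iff_density_finite[OF sigma_finite_lborel]) auto

lemma dunkl_weight_pos:
  assumes "\<alpha> \<ge> -1/2"
  shows "dunkl_weight \<alpha> > (0::real)"
  using assms by (intro positive_imp_inverse_positive mult_pos_pos Gamma_real_pos) auto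

lemma dunkl_measure_eq_completion:
  assumes "\<alpha> \<ge> -1/2"
  shows "dunkl_measure \<alpha> = completion (dunkl_borel \<alpha>)"
proof -
  have "AE x in lborel. x \<noteq> (0::real)" by (rule AE_lborel_singleton)
  then have "AE x in lborel. 0 < ennreal (dunkl_weight \<alpha> * \<bar>x\<bar> powr (2 * \<alpha> + 1))"
    by eventually_elim (intro ennreal_less_zero_iff[THEN iffD2] mult_pos_pos dunkl_weight_pos assms, simp)
  then show ?thesis
    unfolding dunkl_measure_def dunkl_borel_def
    by (subst completion_density_eq) auto
qed

lemma AE_dunkl_borel_iff:
  assumes "\<alpha> \<ge> -1/2"
  shows "(AE x in dunkl_borel \<alpha>. P x) \<longleftrightarrow> (AE x in lborel. P x)"
proof -
  have "AE x in lborel. x \<noteq> (0::real)" by (rule AE_lborel_singleton)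
  then have *: "AE x in lborel. 0 < ennreal (dunkl_weight \<alpha> * \<bar>x\<bar> powr (2 * \<alpha> + 1))"
    by eventually_elim (intro ennreal_less_zero_iff[THEN iffD2] mult_pos_pos dunkl_weight_pos assms, simp)
  show ?thesis
    unfolding dunkl_borel_def
    by (subst AE_density, simp) (rule iffI; use * in \<open>elim eventually_rev_mp\<close>, intro always_eventually, blast)
qed

lemma AE_dunkl_measure_iff:
  assumes "\<alpha> \<ge> -1/2"
  shows "(AE x in dunkl_measure \<alpha>. P x) \<longleftrightarrow> (AE x in lborel. P x)"
  unfolding dunkl_measure_eq_completion[OF assms] AE_completion_iff AE_dunkl_borel_iff[OF assms] ..

lemma (in complete_measure) measurable_AE_cong_complete:
  assumes f: "f \<in> M \<rightarrow>\<^sub>M N" and ae: "AE x in M. f x = g x" and g: "g \<in> space M \<rightarrow> space N"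
  shows "g \<in> M \<rightarrow>\<^sub>M N"
proof (rule measurableI)
  show "g x \<in> space N" if "x \<in> space M" for x using g that by auto
next
  fix A assume A: "A \<in> sets N"
  show "g -` A \<inter> space M \<in> sets M"
  proof (rule in_sets_AE)
    show "f -` A \<inter> space M \<in> sets M" using f A by measurable
    show "AE x in M. x \<in> f -` A \<inter> space M \<longleftrightarrow> x \<in> g -` A \<inter> space M"
      using ae by eventually_elim auto
  qed auto
qed

text \<open>If one of the functions is measurable then so is the other; otherwise both integrals are zero.\<close>

lemma (in complete_measure) integral_cong_AE_complete:
  fixes f g :: "'a \<Rightarrow> 'b::{banach, second_countable_topology}"
  assumes ae: "AE x in M. f x = g x"
  shows "integral\<^sup>L M f = integral\<^sup>L M g"
proof -
  have ae': "AE x in M. g x = f x" using ae by eventually_elim auto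
  have iff: "f \<in> borel_measurable M \<longleftrightarrow> g \<in> borel_measurable M"
  proof
    show "g \<in> borel_measurable M" if "f \<in> borel_measurable M"
      by (rule measurable_AE_cong_complete[OF that ae]) simp
    show "f \<in> borel_measurable M" if "g \<in> borel_measurable M"
      by (rule measurable_AE_cong_complete[OF that ae']) simp
  qed
  show ?thesis
  proof (cases "f \<in> borel_measurable M")
    case True
    then show ?thesis using iff ae by (intro integral_cong_AE) auto
  next
    case False
    then have "\<not> integrable M f" "\<not> integrable M g" using iff by auto
    then show ?thesis by (simp add: not_integrable_integral_eq)
  qed
qed

lemma dunkl_arg_square:
  "(dunkl_arg x y \<theta>)\<^sup>2 = x\<^sup>2 + y\<^sup>2 - 2 * x * y * cos \<theta>"
proof -
  have "x\<^sup>2 + y\<^sup>2 - 2 * x * y * cos \<theta> = (x - y * cos \<theta>)\<^sup>2 + (y * sin \<theta>)\<^sup>2"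
  proof -
    have "y\<^sup>2 = y\<^sup>2 * (cos \<theta>)\<^sup>2 + y\<^sup>2 * (sin \<theta>)\<^sup>2"
      by (metis add.commute distrib_left mult.right_neutral sin_cos_squared_add)
    then show ?thesis by (simp add: power2_diff power_mult_distrib algebra_simps)
  qed
  then show ?thesis unfolding dunkl_arg_def by simp
qed

lemma dunkl_arg_nonneg [simp]: "0 \<le> dunkl_arg x y \<theta>"
  using dunkl_arg_square[of x y \<theta>] unfolding dunkl_arg_def
  by (metis real_sqrt_ge_zero zero_le_power2)

lemma dunkl_arg_measurable [measurable (raw)]:
  assumes [measurable]: "f \<in> borel_measurable M" "g \<in> borel_measurable M" "h \<in> borel_measurable M"
  shows "(\<lambda>w. dunkl_arg (f w) (g w) (h w)) \<in> borel_measurable M"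
  unfolding dunkl_arg_def by measurable

text \<open>For fixed nonzero \<open>x\<close> and \<open>y\<close> the angle is a differentiable function of the argument, by the law of
  cosines, so a null set of arguments is hit on a null set of angles only.\<close>

lemma AE_dunkl_arg:
  assumes xy: "x \<noteq> 0" "y \<noteq> 0" and ae: "AE z in lborel. P (z::real)"
  shows "AE \<theta> in lebesgue. 0 < \<theta> \<and> \<theta> < pi \<longrightarrow> P (dunkl_arg x y \<theta>) \<and> P (- dunkl_arg x y \<theta>)"
proof -
  define q where "q s = (x\<^sup>2 + y\<^sup>2 - s\<^sup>2) / (2 * x * y)" for s
  define S where "S = {s. \<not> P s} \<inter> {s. -1 < q s \<and> q s < 1}"
  have "AE z in lebesgue. P z" using ae by (rule AE_completion)
  then have "{z. \<not> P z} \<in> null_sets lebesgue"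
    using completion.AE_iff_null_sets[where M=lborel and P=P] by auto
  then have "negligible {z. \<not> P z}" by (simp add: negligible_iff_null_sets)
  then have negS: "negligible S" unfolding S_def by (rule negligible_subset) auto
  have q': "(q has_real_derivative - (2 * s) / (2 * x * y)) (at s)" for s
    unfolding q_def using xy by (auto intro!: derivative_eq_intros simp: field_simps)
  have "(\<lambda>s. arccos (q s)) differentiable_on S"
    unfolding differentiable_on_def
  proof
    fix s assume "s \<in> S"
    then have s: "-1 < q s" "q s < 1" unfolding S_def by auto
    have "((\<lambda>s. arccos (q s)) has_real_derivative (inverse (- sqrt (1 - (q s)\<^sup>2)) * (- (2 * s) / (2 * x * y)))) (at s)"
      by (rule DERIV_chain2[OF DERIV_arccos[OF s] q'])
    then show "(\<lambda>s. arccos (q s)) differentiable at s within S"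
      by (meson differentiable_at_withinI real_differentiable_def)
  qed
  then have neg: "negligible ((\<lambda>s. arccos (q s)) ` S)"
    by (intro negligible_differentiable_image_negligible negS) auto
  have "{\<theta>. \<not> (0 < \<theta> \<and> \<theta> < pi \<longrightarrow> P (dunkl_arg x y \<theta>) \<and> P (- dunkl_arg x y \<theta>))} \<subseteq> (\<lambda>s. arccos (q s)) ` S"
  proof safe
    fix \<theta> assume th: "0 < \<theta>" "\<theta> < pi" 
      and "\<theta> \<notin> (\<lambda>s. arccos (q s)) ` S"
    have q: "q (dunkl_arg x y \<theta>) = cos \<theta>" "q (- dunkl_arg x y \<theta>) = cos \<theta>"
      unfolding q_def by (simp_all add: dunkl_arg_square xy)
    have c: "arccos (cos \<theta>) = \<theta>" using th by (simp add: arccos_cos)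
    have "cos \<theta> < 1" "-1 < cos \<theta>"
      using th cos_monotone_0_pi[of 0 \<theta>] cos_monotone_0_pi[of \<theta> pi] by auto
    then have "s \<in> S" if "q s = cos \<theta>" "\<not> P s" for s using that by (simp add: S_def)
    then have *: "P s" if "q s = cos \<theta>" for s using that c \<open>\<theta> \<notin> _\<close> by (metis image_eqI)
    show "P (dunkl_arg x y \<theta>)" "P (- dunkl_arg x y \<theta>)" using * q by auto
  qed
  then have "negligible {\<theta>. \<not> (0 < \<theta> \<and> \<theta> < pi \<longrightarrow> P (dunkl_arg x y \<theta>) \<and> P (- dunkl_arg x y \<theta>))}"
    using neg negligible_subset by blast
  then show ?thesis
    by (subst completion.AE_iff_null_sets) (simp add: negligible_iff_null_sets)
qed

text \<open>Consequently functions may be replaced by Borel representatives under the translation.\<close>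

lemma dunkl_translation_cong_AE:
  assumes ae: "AE z in lborel. g z = g' z"
  shows "AE y in lborel. dunkl_translation \<alpha> x g y = dunkl_translation \<alpha> x g' y"
proof (cases "\<alpha> = -1/2")
  case True
  have "AE y in distr lborel borel ((+) x). g y = g' y"
    using ae by (subst lborel_distr_plus)
  then have "AE y in lborel. g (x + y) = g' (x + y)"
    by (rule AE_distrD[rotated]) simp
  then show ?thesis using True by (simp add: dunkl_translation_def)
next
  case False
  show ?thesis
  proof (cases "x = 0")
    case True
    have "AE y in distr lborel borel uminus. g y = g' y"
      using ae by (subst lborel_distr_uminus)
    then have "AE y in lborel. g (- y) = g' (- y)"
      by (rule AE_distrD[rotated]) simp
    with ae show ?thesis
    proof eventually_elim
      case (elim y)
      have "g \<bar>y\<bar> = g' \<bar>y\<bar>" "g (-\<bar>y\<bar>) = g' (-\<bar>y\<bar>)" using elim by (auto simp: abs_if)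
      then show ?case using True \<open>\<alpha> \<noteq> -1/2\<close> by (simp add: dunkl_translation_def dunkl_arg_def)
    qed
  next
    case x: False
    have "AE y in lborel. y \<noteq> (0::real)" by (rule AE_lborel_singleton)
    then show ?thesis
    proof eventually_elim
      case (elim y)
      have "AE \<theta> in lebesgue. 0 < \<theta> \<and> \<theta> < pi \<longrightarrow> g (dunkl_arg x y \<theta>) = g' (dunkl_arg x y \<theta>) \<and> g (- dunkl_arg x y \<theta>) = g' (- dunkl_arg x y \<theta>)"
        by (rule AE_dunkl_arg[OF x elim ae])
      moreover have "AE \<theta> in lebesgue. \<theta> \<noteq> (0::real)" "AE \<theta> in lebesgue. \<theta> \<noteq> pi"
        by (auto intro!: AE_completion AE_lborel_singleton)
      ultimately have "AE \<theta> in lebesgue. indicator {0..pi} \<theta> *\<^sub>R ((g (dunkl_arg x y \<theta>) + g (- dunkl_arg x y \<theta>)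
             + (x + y) / dunkl_arg x y \<theta> * (g (dunkl_arg x y \<theta>) - g (- dunkl_arg x y \<theta>)))
           * (1 - cos \<theta>) * sin \<theta> powr (2 * \<alpha>)) = indicator {0..pi} \<theta> *\<^sub>R ((g' (dunkl_arg x y \<theta>) + g' (- dunkl_arg x y \<theta>)
             + (x + y) / dunkl_arg x y \<theta> * (g' (dunkl_arg x y \<theta>) - g' (- dunkl_arg x y \<theta>)))
           * (1 - cos \<theta>) * sin \<theta> powr (2 * \<alpha>))"
        by eventually_elim (auto simp: indicator_def)
      from completion.integral_cong_AE_complete[OF this] show ?case
        using \<open>\<alpha> \<noteq> -1/2\<close> unfolding dunkl_translation_def set_lebesgue_integral_def by simp
    qed
  qed
qed

section \<open>The angular measure and translates of balls\<close>

lemma sin_ge_third: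
  fixes t :: real
  assumes "0 \<le> t" "t \<le> pi/2"
  shows "t / 3 \<le> sin t"
proof -
  have "t \<le> 2" using assms(2) pi_half_less_two by linarith
  have "(\<Sum>m<3. sin_coeff m * t ^ m) = t"
    by (simp add: sin_coeff_def eval_nat_numeral)
  then have "\<bar>sin t - t\<bar> \<le> inverse (fact 3) * \<bar>t\<bar> ^ 3"
    using Maclaurin_sin_bound[of t 3] by simp
  then have "sin t \<ge> t - t ^ 3 / 6"
    using assms abs_ge_minus_self[of "sin t - t"] by (simp add: fact_numeral field_simps)
  moreover have "t * (t * t) \<le> t * 4"
    using \<open>t \<le> 2\<close> assms mult_mono[of t 2 t 2] by (intro mult_left_mono) auto
  ultimately show ?thesis by (simp add: power3_eq_cube)
qed

text \<open>The quotient \<open>sin t / t\<close> lies between \<open>1/3\<close> and \<open>1\<close>; the absolute value in the exponent covers both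
  signs of \<open>\<sigma>\<close>.\<close>

lemma sin_powr_comparable:
  fixes t \<sigma> :: real
  assumes "0 < t" "t \<le> pi/2"
  shows "3 powr (-\<bar>\<sigma>\<bar>) * t powr \<sigma> \<le> sin t powr \<sigma>"
    and "sin t powr \<sigma> \<le> 3 powr \<bar>\<sigma>\<bar> * t powr \<sigma>"
proof -
  define u where "u = sin t / t"
  have u: "1/3 \<le> u" "u \<le> 1"
    using sin_ge_third[of t] sin_x_le_x[of t] assms by (auto simp: u_def field_simps)
  have s: "sin t powr \<sigma> = t powr \<sigma> * u powr \<sigma>"
    using assms u by (simp add: u_def flip: powr_mult)
  have third: "(1/3) powr \<sigma> = 3 powr (-\<sigma>)"
    by (simp add: powr_minus_divide powr_divide)
  have "3 powr (-\<bar>\<sigma>\<bar>) \<le> u powr \<sigma> \<and> u powr \<sigma> \<le> 3 powr \<bar>\<sigma>\<bar>"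
  proof (cases "\<sigma> \<ge> 0")
    case True
    have "(1/3) powr \<sigma> \<le> u powr \<sigma>" "u powr \<sigma> \<le> 1 powr \<sigma>"
      using u True powr_mono2[of \<sigma> "1/3" u] powr_mono2[of \<sigma> u 1] by auto
    moreover have "(1::real) \<le> 3 powr \<sigma>" using True by (simp add: ge_one_powr_ge_zero)
    ultimately show ?thesis using True third by simp
  next
    case False
    have "u powr \<sigma> \<le> (1/3) powr \<sigma>" "1 powr \<sigma> \<le> u powr \<sigma>"
      using u False powr_mono2'[of \<sigma> "1/3" u] powr_mono2'[of \<sigma> u 1] by auto
    moreover have "(3::real) powr \<sigma> \<le> 1" using False powr_mono[of \<sigma> 0 3] by simp
    ultimately show ?thesis using False third by simp
  qed
  then show "3 powr (-\<bar>\<sigma>\<bar>) * t powr \<sigma> \<le> sin t powr \<sigma>"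
    "sin t powr \<sigma> \<le> 3 powr \<bar>\<sigma>\<bar> * t powr \<sigma>"
    unfolding s by (simp_all add: mult.commute mult_left_mono)
qed

lemma nn_integral_powr_from_0:
  assumes "\<sigma> > (-1::real)" "b \<ge> 0"
  shows "(\<integral>\<^sup>+t. ennreal (t powr \<sigma>) * indicator {0<..<b} t \<partial>lborel) = ennreal (b powr (\<sigma> + 1) / (\<sigma> + 1))"
proof -
  have "(\<integral>\<^sup>+t. ennreal (t powr \<sigma>) * indicator {0<..<b} t \<partial>lborel)
      = (\<integral>\<^sup>+t. ennreal (t powr \<sigma>) * indicator {0..b} t \<partial>lborel)"
    using AE_lborel_singleton[of b]
    by (intro nn_integral_cong_AE) (auto simp: indicator_def elim!: eventually_mono)
  then show ?thesis
    using nn_integral_has_integral_lebesgue'[OF _ has_integral_powr_from_0[OF assms]] by simp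
qed

abbreviation sin_integral :: "real \<Rightarrow> real set \<Rightarrow> ennreal" where
  "sin_integral \<sigma> I \<equiv> (\<integral>\<^sup>+t. ennreal (sin t powr \<sigma>) * indicator I t \<partial>lborel)"

lemma nn_integral_sin_powr_bounds:
  assumes "\<sigma> > (-1::real)" "b \<ge> 0" "b \<le> pi/2"
  shows "sin_integral \<sigma> {0<..<b}
      \<le> ennreal (3 powr \<bar>\<sigma>\<bar> * (b powr (\<sigma> + 1) / (\<sigma> + 1)))"
    and "ennreal (3 powr (-\<bar>\<sigma>\<bar>) * (b powr (\<sigma> + 1) / (\<sigma> + 1))) \<le> sin_integral \<sigma> {0<..<b}"
proof -
  have *: "ennreal (K * (b powr (\<sigma> + 1) / (\<sigma> + 1)))
      = (\<integral>\<^sup>+t. ennreal (K * t powr \<sigma>) * indicator {0<..<b} t \<partial>lborel)" if "K \<ge> 0" for K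
  proof -
    have "ennreal (K * (b powr (\<sigma> + 1) / (\<sigma> + 1)))
        = ennreal K * (\<integral>\<^sup>+t. ennreal (t powr \<sigma>) * indicator {0<..<b} t \<partial>lborel)"
      unfolding nn_integral_powr_from_0[OF assms(1,2)] using that assms by (intro ennreal_mult) auto
    also have "\<dots> = (\<integral>\<^sup>+t. ennreal K * (ennreal (t powr \<sigma>) * indicator {0<..<b} t) \<partial>lborel)"
      by (intro nn_integral_cmult[symmetric]) auto
    finally show ?thesis using that by (simp add: ennreal_mult mult.assoc)
  qed
  show "sin_integral \<sigma> {0<..<b} \<le> ennreal (3 powr \<bar>\<sigma>\<bar> * (b powr (\<sigma> + 1) / (\<sigma> + 1)))"
    unfolding *[OF powr_ge_zero]
    by (intro nn_integral_mono) (use sin_powr_comparable assms in \<open>auto simp: indicator_def intro!: ennreal_leI\<close>)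
  show "ennreal (3 powr (-\<bar>\<sigma>\<bar>) * (b powr (\<sigma> + 1) / (\<sigma> + 1))) \<le> sin_integral \<sigma> {0<..<b}"
    unfolding *[OF powr_ge_zero]
    by (intro nn_integral_mono) (use sin_powr_comparable assms in \<open>auto simp: indicator_def intro!: ennreal_leI\<close>)
qed

lemma nn_integral_sin_powr_reflect:
  "sin_integral \<sigma> {pi - b<..<pi}
    = sin_integral \<sigma> {0<..<b}"
proof -
  have "sin_integral \<sigma> {pi - b<..<pi}
    = ennreal \<bar>-1\<bar> * (\<integral>\<^sup>+t. ennreal (sin (pi + (-1) * t) powr \<sigma>) * indicator {pi - b<..<pi} (pi + (-1) * t) \<partial>lborel)"
    by (rule nn_integral_real_affine) auto
  also have "\<dots> = sin_integral \<sigma> {0<..<b}"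
    by (auto intro!: nn_integral_cong simp: indicator_def)
  finally show ?thesis .
qed

lemma nn_integral_sin_powr_finite:
  assumes "\<sigma> > (-1::real)"
  shows "sin_integral \<sigma> {0<..<pi} < \<infinity>"
proof -
  let ?S = "\<lambda>I. \<integral>\<^sup>+t. ennreal (sin t powr \<sigma>) * indicator I t \<partial>lborel"
  have fin: "?S {0<..<pi/2} < \<infinity>"
    using nn_integral_sin_powr_bounds(1)[OF assms, of "pi/2"] by (auto simp: order_le_less_trans less_top)
  have "?S {0<..<pi} \<le> (\<integral>\<^sup>+t. ennreal (sin t powr \<sigma>) * indicator {0<..<pi/2} t
          + ennreal (sin t powr \<sigma>) * indicator {pi - pi/2<..<pi} t \<partial>lborel)"
    using AE_lborel_singleton[of "pi/2"]
    by (intro nn_integral_mono_AE) (auto simp: indicator_def elim!: eventually_mono)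
  also have "\<dots> = ?S {0<..<pi/2} + ?S {pi - pi/2<..<pi}"
    by (intro nn_integral_add) auto
  also have "\<dots> < \<infinity>" using fin by (subst nn_integral_sin_powr_reflect) simp
  finally show ?thesis .
qed

lemma dunkl_const_pos:
  assumes "\<alpha> > -1/2"
  shows "dunkl_const \<alpha> > 0"
proof -
  define F where "F t = indicator {0<..<pi} t * sin t powr (2 * \<alpha>)" for t :: real
  have [measurable]: "F \<in> borel_measurable borel" unfolding F_def by measurable
  have F0: "0 \<le> F t" for t by (simp add: F_def)
  have nnF: "(\<integral>\<^sup>+t. ennreal (F t) \<partial>lborel) = sin_integral (2*\<alpha>) {0<..<pi}"
    by (intro nn_integral_cong) (auto simp: F_def indicator_def)
  have fin: "(\<integral>\<^sup>+t. ennreal (F t) \<partial>lborel) < \<infinity>"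
    unfolding nnF by (rule nn_integral_sin_powr_finite) (use assms in auto)
  have int: "integrable lborel F"
    by (rule integrableI_nonneg) (use fin F0 in auto)
  have "(LINT t:{0..pi}|lebesgue. sin t powr (2 * \<alpha>)) = integral\<^sup>L lebesgue F"
    unfolding set_lebesgue_integral_def
    by (intro Bochner_Integration.integral_cong) (auto simp: F_def indicator_def)
  also have "\<dots> = integral\<^sup>L lborel F" by (rule integral_completion) simp
  finally have eq: "(LINT t:{0..pi}|lebesgue. sin t powr (2 * \<alpha>)) = integral\<^sup>L lborel F" .
  have "0 < ennreal (3 powr (-\<bar>2*\<alpha>\<bar>) * ((pi/2) powr (2*\<alpha> + 1) / (2*\<alpha> + 1)))"
    using assms by (simp add: ennreal_less_zero_iff)
  also have "\<dots> \<le> sin_integral (2*\<alpha>) {0<..<pi/2}"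
    by (rule nn_integral_sin_powr_bounds(2)) (use assms in auto)
  also have "\<dots> \<le> (\<integral>\<^sup>+t. ennreal (F t) \<partial>lborel)"
    unfolding nnF by (intro nn_integral_mono) (auto simp: indicator_def)
  also have "\<dots> = ennreal (integral\<^sup>L lborel F)"
    by (rule nn_integral_eq_integral[OF int]) (simp add: F0)
  finally have "0 < integral\<^sup>L lborel F" by (simp add: ennreal_less_zero_iff)
  then show ?thesis unfolding dunkl_const_def eq by simp
qed

text \<open>The translate by \<open>x\<close> of an even function \<open>k\<close> at \<open>y\<close> is the integral of \<open>k((x,y)\<^sub>\<theta>)\<close> with respect to
  this measure. Since \<open>(x,y)\<^sub>\<pi> = \<bar>x + y\<bar>\<close>, the point mass at \<open>\<pi>\<close> makes this true for \<open>\<alpha> = -1/2\<close> as well.\<close>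

definition angle_measure :: "real \<Rightarrow> real measure" where
  "angle_measure \<alpha> =
     (if \<alpha> = -1/2 then distr (count_space {()}) borel (\<lambda>_. pi)
      else density lborel
        (\<lambda>t. ennreal (dunkl_const \<alpha> * (1 - cos t) * sin t powr (2 * \<alpha>)) * indicator {0<..<pi} t))"

lemma sets_angle_measure [measurable_cong, simp]: "sets (angle_measure \<alpha>) = sets borel"
  by (simp add: angle_measure_def)

lemma space_angle_measure [simp]: "space (angle_measure \<alpha>) = UNIV"
  by (simp add: angle_measure_def)

lemma emeasure_angle_measure:
  assumes "\<alpha> > -1/2" "S \<in> sets borel"
  shows "emeasure (angle_measure \<alpha>) S
    = (\<integral>\<^sup>+t. ennreal (dunkl_const \<alpha> * (1 - cos t) * sin t powr (2 * \<alpha>)) * indicator ({0<..<pi} \<inter> S) t \<partial>lborel)"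
  using assms by (auto simp: angle_measure_def emeasure_density indicator_def intro!: nn_integral_cong)

lemma emeasure_angle_measure_le:
  assumes "\<alpha> > -1/2" "S \<in> sets borel" "{0<..<pi} \<inter> S \<subseteq> A" "A \<in> sets borel"
  shows "emeasure (angle_measure \<alpha>) S
    \<le> ennreal (2 * dunkl_const \<alpha>) * sin_integral (2 * \<alpha>) A"
proof -
  have "dunkl_const \<alpha> * (1 - cos t) * sin t powr (2 * \<alpha>) \<le> 2 * dunkl_const \<alpha> * sin t powr (2 * \<alpha>)" for t
    using dunkl_const_pos[OF assms(1)] cos_ge_minus_one[of t]
    by (intro mult_right_mono) (use mult_left_mono[of "-1" "cos t" "dunkl_const \<alpha>"] in \<open>auto simp: algebra_simps\<close>)
  then have "emeasure (angle_measure \<alpha>) S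
    \<le> (\<integral>\<^sup>+t. ennreal (2 * dunkl_const \<alpha>) * (ennreal (sin t powr (2 * \<alpha>)) * indicator A t) \<partial>lborel)"
    unfolding emeasure_angle_measure[OF assms(1,2)]
    using assms(3) dunkl_const_pos[OF assms(1)]
    by (intro nn_integral_mono) (auto simp: indicator_def ennreal_mult'[symmetric] intro!: ennreal_leI)
  also have "\<dots> = ennreal (2 * dunkl_const \<alpha>) * sin_integral (2 * \<alpha>) A"
    using assms(4) by (intro nn_integral_cmult) auto
  finally show ?thesis .
qed

lemma finite_angle_measure:
  assumes "\<alpha> \<ge> -1/2"
  shows "finite_measure (angle_measure \<alpha>)"
proof (cases "\<alpha> = -1/2")
  case True
  then show ?thesis
    by (intro finite_measureI) (simp add: angle_measure_def emeasure_distr)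
next
  case False
  then have a: "\<alpha> > -1/2" using assms by simp
  have "emeasure (angle_measure \<alpha>) UNIV
    \<le> ennreal (2 * dunkl_const \<alpha>) * sin_integral (2 * \<alpha>) {0<..<pi}"
    by (rule emeasure_angle_measure_le[OF a]) auto
  also have "\<dots> < \<infinity>"
    using nn_integral_sin_powr_finite[of "2 * \<alpha>"] a by (simp add: ennreal_mult_less_top)
  finally show ?thesis by (intro finite_measureI) auto
qed

lemma sigma_finite_angle_measure:
  assumes "\<alpha> \<ge> -1/2"
  shows "sigma_finite_measure (angle_measure \<alpha>)"
  using finite_angle_measure[OF assms] by (simp add: finite_measure_def)

text \<open>The translate by \<open>x\<close>, at \<open>y\<close>, of the indicator function of \<open>B(0,r)\<close>; as that function is even, only
  the positive angular measure enters.\<close>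

definition ball_kernel :: "real \<Rightarrow> real \<Rightarrow> real \<Rightarrow> real \<Rightarrow> ennreal" where
  "ball_kernel \<alpha> r x y = emeasure (angle_measure \<alpha>) {t. dunkl_arg x y t < r}"

lemma ball_kernel_eq_nn_integral:
  "ball_kernel \<alpha> r x y = (\<integral>\<^sup>+t. (if dunkl_arg x y t < r then 1 else 0) \<partial>angle_measure \<alpha>)"
proof -
  have "(\<integral>\<^sup>+t. (if dunkl_arg x y t < r then 1 else 0) \<partial>angle_measure \<alpha>)
      = (\<integral>\<^sup>+t. indicator {t. dunkl_arg x y t < r} t \<partial>angle_measure \<alpha>)"
    by (intro nn_integral_cong) auto
  also have "\<dots> = ball_kernel \<alpha> r x y"
    unfolding ball_kernel_def by (intro nn_integral_indicator) simp
  finally show ?thesis ..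
qed

lemma ball_kernel_half:
  "ball_kernel (-1/2) r x y = indicator {..<r} \<bar>x + y\<bar>"
proof -
  have "dunkl_arg x y pi = sqrt ((x + y)\<^sup>2)"
    unfolding dunkl_arg_def by (simp add: power2_sum)
  then have "dunkl_arg x y pi = \<bar>x + y\<bar>" by simp
  then show ?thesis unfolding ball_kernel_def angle_measure_def
    by (simp add: emeasure_distr indicator_def)
qed

lemma dunkl_arg_ge: "\<bar>\<bar>x\<bar> - \<bar>y\<bar>\<bar> \<le> dunkl_arg x y t"
proof (rule power2_le_imp_le)
  have "x * y * cos t \<le> \<bar>x * y * cos t\<bar>" by simp
  also have "\<dots> \<le> \<bar>x\<bar> * \<bar>y\<bar>"
    using mult_left_mono[OF abs_cos_le_one[of t], of "\<bar>x\<bar> * \<bar>y\<bar>"] by (simp add: abs_mult)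
  finally show "\<bar>\<bar>x\<bar> - \<bar>y\<bar>\<bar>\<^sup>2 \<le> (dunkl_arg x y t)\<^sup>2"
    by (simp add: dunkl_arg_square power2_diff algebra_simps)
qed simp

lemma one_minus_cos_le: "1 - cos t \<le> t\<^sup>2 / (2::real)"
proof -
  have "1 - cos t = 2 * (sin (t/2))\<^sup>2"
    using cos_double_sin[of "t/2"] by simp
  also have "(sin (t/2))\<^sup>2 \<le> (t/2)\<^sup>2"
    using abs_sin_x_le_abs_x[of "t/2"] by (simp only: abs_le_square_iff)
  finally show ?thesis by (simp add: power_divide)
qed

lemma one_minus_cos_ge:
  assumes "0 \<le> t" "t \<le> pi"
  shows "t\<^sup>2 / 18 \<le> 1 - cos t"
proof -
  have "(t/2/3)\<^sup>2 \<le> (sin (t/2))\<^sup>2"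
    using sin_ge_third[of "t/2"] assms by (intro power_mono) auto
  moreover have "1 - cos t = 2 * (sin (t/2))\<^sup>2"
    using cos_double_sin[of "t/2"] by simp
  ultimately show ?thesis by (simp add: power_divide)
qed

text \<open>For \<open>\<bar>x\<bar> < 4r\<close> the total mass of the angular measure is a sufficient bound. For \<open>\<bar>x\<bar> \<ge> 4r\<close> the sides
  \<open>\<bar>x\<bar>\<close> and \<open>\<bar>y\<bar>\<close> are comparable and much longer than the third side, which confines the angle to a
  distance \<open>5r/\<bar>x\<bar>\<close> from \<open>0\<close> or \<open>\<pi>\<close>; there \<open>sin\<^bsup>2\<alpha>\<^esup>\<close> has an integral of order \<open>(r/\<bar>x\<bar>)\<^bsup>2\<alpha>+1\<^esup>\<close>.\<close>

lemma ball_kernel_le: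
  assumes "\<alpha> \<ge> -1/2"
  obtains C where "C > 0"
    "\<And>r x y. r > 0 \<Longrightarrow>
       ball_kernel \<alpha> r x y \<le> ennreal (C * (r / (\<bar>x\<bar> + r)) powr (2 * \<alpha> + 1)) * indicator {..<r} \<bar>\<bar>x\<bar> - \<bar>y\<bar>\<bar>"
proof (cases "\<alpha> = -1/2")
  case True
  have "ball_kernel \<alpha> r x y \<le> ennreal (1 * (r / (\<bar>x\<bar> + r)) powr (2 * \<alpha> + 1)) * indicator {..<r} \<bar>\<bar>x\<bar> - \<bar>y\<bar>\<bar>" if "r > 0" for r x y
    unfolding True ball_kernel_half using that by (auto simp: indicator_def powr_def)
  then show ?thesis using that[of 1] by auto
next
  case False
  then have a: "\<alpha> > -1/2" using assms by simp
  define \<sigma> where "\<sigma> = 2 * \<alpha>"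
  have \<sigma>: "\<sigma> > -1" using a by (simp add: \<sigma>_def)
  define c where "c = dunkl_const \<alpha>"
  have c: "c > 0" unfolding c_def by (rule dunkl_const_pos[OF a])
  define M where "M = measure (angle_measure \<alpha>) UNIV"
  interpret finite_measure "angle_measure \<alpha>" by (rule finite_angle_measure[OF assms])
  have M: "emeasure (angle_measure \<alpha>) S \<le> ennreal M" "M \<ge> 0" for S
    unfolding M_def using emeasure_space[of "angle_measure \<alpha>" S] by (auto simp: emeasure_eq_measure)
  define C1 where "C1 = M * 5 powr (\<sigma> + 1)"
  define K where "K = 3 powr \<bar>\<sigma>\<bar> / (\<sigma> + 1)"
  have K: "K > 0" using \<sigma> by (simp add: K_def)
  define C2 where "C2 = 4 * c * K * 10 powr (\<sigma> + 1)"
  have C2: "C2 > 0" using c K by (simp add: C2_def)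
  have main: "ball_kernel \<alpha> r x y \<le> ennreal ((C1 + C2) * (r / (\<bar>x\<bar> + r)) powr (\<sigma> + 1))"
    if r: "r > 0" and supp: "\<bar>\<bar>x\<bar> - \<bar>y\<bar>\<bar> < r" for r x y
  proof (cases "\<bar>x\<bar> < 4 * r")
    case True
    have "1/5 \<le> r / (\<bar>x\<bar> + r)" using True r by (simp add: field_simps)
    then have "(1/5) powr (\<sigma>+1) \<le> (r / (\<bar>x\<bar> + r)) powr (\<sigma>+1)"
      using \<sigma> by (intro powr_mono2) auto
    then have "C1 * (1/5) powr (\<sigma>+1) \<le> C1 * (r / (\<bar>x\<bar> + r)) powr (\<sigma>+1)"
      using M by (intro mult_left_mono) (auto simp: C1_def)
    moreover have "C1 * (1/5) powr (\<sigma>+1) = M" by (simp add: C1_def powr_divide)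
    moreover have "0 \<le> C2 * (r / (\<bar>x\<bar> + r)) powr (\<sigma>+1)" using C2 by simp
    ultimately have "M \<le> (C1 + C2) * (r / (\<bar>x\<bar> + r)) powr (\<sigma>+1)" by (simp add: algebra_simps)
    then show ?thesis
      using M(1) unfolding ball_kernel_def by (meson ennreal_leI order_trans)
  next
    case far: False
    define b where "b = 5 * r / \<bar>x\<bar>"
    have x: "\<bar>x\<bar> > 0" "\<bar>y\<bar> \<ge> 3/4 * \<bar>x\<bar>" using far r supp by linarith+
    have b: "b > 0" "b \<le> 5/4" using far r x by (auto simp: b_def field_simps)
    have b': "b \<le> pi/2" using b pi_gt3 by linarith
    \<comment> \<open>The law of cosines keeps the triangle flat: the angle is close to \<open>0\<close> or to \<open>\<pi>\<close>.\<close>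
    have small: "s < b" if s: "0 < s" "s < pi" and lt: "2 * \<bar>x\<bar> * \<bar>y\<bar> * (1 - cos s) < r\<^sup>2" for s
    proof -
      have "\<bar>x\<bar> * \<bar>x\<bar> * (1 - cos s) \<le> 2 * \<bar>x\<bar> * \<bar>y\<bar> * (1 - cos s)"
        using mult_left_mono[of "\<bar>x\<bar>" "2 * \<bar>y\<bar>" "\<bar>x\<bar>"] x by (intro mult_right_mono) (auto simp: mult_ac)
      also have "\<dots> < r\<^sup>2" by (rule lt)
      finally have "\<bar>x\<bar>\<^sup>2 * (s\<^sup>2/18) < r\<^sup>2"
        using mult_left_mono[OF one_minus_cos_ge[of s], of "\<bar>x\<bar>\<^sup>2"] s
        by (simp add: power2_eq_square)
      then have "(\<bar>x\<bar> * s)\<^sup>2 < 18 * r\<^sup>2" by (simp add: power_mult_distrib)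
      also have "\<dots> \<le> (5 * r)\<^sup>2" by (simp add: power_mult_distrib)
      finally have "\<bar>x\<bar> * s < 5 * r" by (rule power2_less_imp_less) (use r in simp)
      then show ?thesis using x by (simp add: b_def field_simps)
    qed
    have sub: "{0<..<pi} \<inter> {t. dunkl_arg x y t < r} \<subseteq> {0<..<b} \<union> {pi - b<..<pi}"
    proof safe
      fix t assume t: "t \<in> {0<..<pi}" "dunkl_arg x y t < r" "t \<notin> {pi - b<..<pi}"
      have "(dunkl_arg x y t)\<^sup>2 < r\<^sup>2" using t(2) by (intro power_strict_mono) auto
      then have sq: "x\<^sup>2 + y\<^sup>2 - 2 * x * y * cos t < r\<^sup>2" by (simp add: dunkl_arg_square)
      show "t \<in> {0<..<b}"
      proof (cases "x * y \<ge> 0")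
        case True
        then have "\<bar>x\<bar> * \<bar>y\<bar> = x * y" by (simp flip: abs_mult)
        then have "2 * \<bar>x\<bar> * \<bar>y\<bar> * (1 - cos t) = 2 * x * y - 2 * x * y * cos t"
          by (simp only: mult.assoc[of 2]) (simp add: algebra_simps)
        then have "2 * \<bar>x\<bar> * \<bar>y\<bar> * (1 - cos t) < r\<^sup>2"
          using sq zero_le_power2[of "x - y"] by (simp add: power2_diff)
        then show ?thesis using small[of t] t by auto
      next
        case False
        then have "\<bar>x\<bar> * \<bar>y\<bar> = - (x * y)" by (simp flip: abs_mult)
        then have "2 * \<bar>x\<bar> * \<bar>y\<bar> * (1 - cos (pi - t)) = - 2 * x * y - 2 * x * y * cos t"
          by (simp only: mult.assoc[of 2]) (simp add: algebra_simps)
        then have "2 * \<bar>x\<bar> * \<bar>y\<bar> * (1 - cos (pi - t)) < r\<^sup>2"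
          using sq zero_le_power2[of "x + y"] by (simp add: power2_sum)
        then show ?thesis using small[of "pi - t"] t by auto
      qed
    qed
    have S: "sin_integral \<sigma> {0<..<b} \<le> ennreal (K * b powr (\<sigma>+1))"
      using nn_integral_sin_powr_bounds(1)[OF \<sigma>, of b] b b' by (simp add: K_def)
    have "ball_kernel \<alpha> r x y
        \<le> ennreal (2 * c) * sin_integral \<sigma> ({0<..<b} \<union> {pi - b<..<pi})"
      unfolding ball_kernel_def c_def \<sigma>_def by (rule emeasure_angle_measure_le[OF a _ sub]) auto
    also have "sin_integral \<sigma> ({0<..<b} \<union> {pi - b<..<pi})
      \<le> (\<integral>\<^sup>+t. ennreal (sin t powr \<sigma>) * indicator {0<..<b} t
             + ennreal (sin t powr \<sigma>) * indicator {pi - b<..<pi} t \<partial>lborel)"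
      by (intro nn_integral_mono) (auto simp: indicator_def)
    also have "\<dots> = sin_integral \<sigma> {0<..<b}
         + sin_integral \<sigma> {pi - b<..<pi}"
      by (intro nn_integral_add) auto
    also have "\<dots> \<le> ennreal (K * b powr (\<sigma>+1)) + ennreal (K * b powr (\<sigma>+1))"
      unfolding nn_integral_sin_powr_reflect by (intro add_mono S)
    finally have "ball_kernel \<alpha> r x y \<le> ennreal (2 * c) * (ennreal (K * b powr (\<sigma>+1)) + ennreal (K * b powr (\<sigma>+1)))"
      by (auto simp: mult_left_mono)
    also have "\<dots> = ennreal (4 * c * K * b powr (\<sigma>+1))"
      using c K by (simp flip: ennreal_plus ennreal_mult add: algebra_simps)
    also have "\<dots> \<le> ennreal ((C1 + C2) * (r / (\<bar>x\<bar> + r)) powr (\<sigma>+1))"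
    proof (intro ennreal_leI)
      have "b \<le> 10 * (r / (\<bar>x\<bar> + r))"
        using far r x unfolding b_def by (simp add: field_simps)
      then have "b powr (\<sigma>+1) \<le> (10 * (r / (\<bar>x\<bar> + r))) powr (\<sigma>+1)"
        using b \<sigma> by (intro powr_mono2) auto
      also have "\<dots> = 10 powr (\<sigma>+1) * (r / (\<bar>x\<bar> + r)) powr (\<sigma>+1)"
        by (simp only: powr_mult)
      finally have "4 * c * K * b powr (\<sigma>+1) \<le> C2 * (r / (\<bar>x\<bar> + r)) powr (\<sigma>+1)"
        using c K unfolding C2_def by (simp add: mult.assoc)
      also have "\<dots> \<le> (C1 + C2) * (r / (\<bar>x\<bar> + r)) powr (\<sigma>+1)"
        using M by (intro mult_right_mono) (auto simp: C1_def)
      finally show "4 * c * K * b powr (\<sigma>+1) \<le> (C1 + C2) * (r / (\<bar>x\<bar> + r)) powr (\<sigma>+1)" .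
    qed
    finally show ?thesis .
  qed
  have "C1 + C2 > 0" using C2 M by (simp add: C1_def add_nonneg_pos)
  moreover have "ball_kernel \<alpha> r x y \<le> ennreal ((C1 + C2) * (r / (\<bar>x\<bar> + r)) powr (2 * \<alpha> + 1)) * indicator {..<r} \<bar>\<bar>x\<bar> - \<bar>y\<bar>\<bar>"
    if "r > 0" for r x y
  proof (cases "\<bar>\<bar>x\<bar> - \<bar>y\<bar>\<bar> < r")
    case True
    then show ?thesis using main[OF that True] by (simp add: \<sigma>_def)
  next
    case False
    then have "{t. dunkl_arg x y t < r} = {}"
      using dunkl_arg_ge[of x y] by (auto simp: not_less intro: order_trans)
    then show ?thesis by (simp add: ball_kernel_def)
  qed
  ultimately show ?thesis using that by blast
qed

text \<open>All angles within \<open>r / (4(\<bar>x\<bar> + r))\<close> of \<open>\<pi>\<close> lead to arguments below \<open>r\<close>, and on them \<open>1 - cos \<theta> \<ge> 1\<close>.\<close>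

lemma ball_kernel_ge:
  assumes "\<alpha> \<ge> -1/2"
  obtains c where "c > 0"
    "\<And>r x z. r > 0 \<Longrightarrow> \<bar>z - x\<bar> < r / 4 \<Longrightarrow>
       ennreal (c * (r / (\<bar>x\<bar> + r)) powr (2 * \<alpha> + 1)) \<le> ball_kernel \<alpha> r (-x) z"
proof (cases "\<alpha> = -1/2")
  case True
  have "ennreal (1 * (r / (\<bar>x\<bar> + r)) powr (2 * \<alpha> + 1)) \<le> ball_kernel \<alpha> r (-x) z" if "r > 0" "\<bar>z - x\<bar> < r / 4" for r x z
    unfolding True ball_kernel_half using that by (auto simp: indicator_def powr_def)
  then show ?thesis using that[of 1] by auto
next
  case False
  then have a: "\<alpha> > -1/2" using assms by simp
  define \<sigma> where "\<sigma> = 2 * \<alpha>"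
  have \<sigma>: "\<sigma> > -1" using a by (simp add: \<sigma>_def)
  define c where "c = dunkl_const \<alpha>"
  have c: "c > 0" unfolding c_def by (rule dunkl_const_pos[OF a])
  define K where "K = 3 powr (-\<bar>\<sigma>\<bar>) / (\<sigma> + 1)"
  have K: "K > 0" using \<sigma> by (simp add: K_def)
  have "ennreal (c * K * (1/4) powr (\<sigma>+1) * (r / (\<bar>x\<bar> + r)) powr (\<sigma> + 1)) \<le> ball_kernel \<alpha> r (-x) z"
    if r: "r > 0" and z: "\<bar>z - x\<bar> < r / 4" for r x z
  proof -
    define b where "b = (1/4) * (r / (\<bar>x\<bar> + r))"
    have b: "0 < b" "b \<le> 1/4" using r by (auto simp: b_def field_simps)
    have b': "b \<le> pi/2" using b pi_gt3 by linarith
    have arg: "dunkl_arg (-x) z t < r" if t: "pi - b < t" "t < pi" for t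
    proof (rule power2_less_imp_less)
      have cos: "0 \<le> 1 + cos t" using cos_ge_minus_one[of t] by linarith
      have "1 + cos t \<le> b\<^sup>2 / 2"
      proof -
        have "1 + cos t = 1 - cos (pi - t)" by simp
        also have "\<dots> \<le> (pi - t)\<^sup>2 / 2" by (rule one_minus_cos_le)
        also have "\<dots> \<le> b\<^sup>2 / 2" using t by (intro divide_right_mono power_mono) auto
        finally show ?thesis .
      qed
      have "x * z \<le> \<bar>x\<bar> * \<bar>z\<bar>" by (metis abs_ge_self abs_mult)
      also have "\<dots> \<le> (\<bar>x\<bar> + r) * (\<bar>x\<bar> + r)" using z r by (intro mult_mono) linarith+
      finally have "x * z * (1 + cos t) \<le> (\<bar>x\<bar> + r) * (\<bar>x\<bar> + r) * (1 + cos t)"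
        using cos by (intro mult_right_mono) auto
      also have "\<dots> \<le> (\<bar>x\<bar> + r) * (\<bar>x\<bar> + r) * (b\<^sup>2 / 2)"
        using \<open>1 + cos t \<le> b\<^sup>2 / 2\<close> r by (intro mult_left_mono) auto
      also have "\<dots> = ((\<bar>x\<bar> + r) * b)\<^sup>2 / 2" by (simp add: power2_eq_square)
      also have "(\<bar>x\<bar> + r) * b = r/4" using r by (simp add: b_def field_simps)
      finally have 1: "x * z * (1 + cos t) \<le> r\<^sup>2 / 32" by (simp add: power_divide)
      have 2: "(x - z)\<^sup>2 \<le> r\<^sup>2 / 16"
        using z power_mono[of "\<bar>x - z\<bar>" "r/4" 2] by (simp add: power_divide abs_minus_commute)
      have "(dunkl_arg (-x) z t)\<^sup>2 = (x - z)\<^sup>2 + 2 * (x * z * (1 + cos t))"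
        by (simp add: dunkl_arg_square power2_diff algebra_simps)
      also have "\<dots> < r\<^sup>2" using 1 2 r zero_less_power[of r 2] by linarith
      finally show "(dunkl_arg (-x) z t)\<^sup>2 < r\<^sup>2" .
    qed (use r in simp)
    have "ennreal (c * K * (1/4) powr (\<sigma>+1) * (r / (\<bar>x\<bar> + r)) powr (\<sigma> + 1)) = ennreal (c * (K * b powr (\<sigma>+1)))"
      unfolding b_def using r by (subst powr_mult) (auto simp: algebra_simps)
    also have "\<dots> = ennreal c * ennreal (K * b powr (\<sigma>+1))"
      using c K by (simp add: ennreal_mult)
    also have "\<dots> \<le> ennreal c * sin_integral \<sigma> {0<..<b}"
      using nn_integral_sin_powr_bounds(2)[OF \<sigma>, of b] b b' by (intro mult_left_mono) (auto simp: K_def)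
    also have "\<dots> = (\<integral>\<^sup>+t. ennreal c * (ennreal (sin t powr \<sigma>) * indicator {pi - b<..<pi} t) \<partial>lborel)"
      unfolding nn_integral_sin_powr_reflect[symmetric] by (intro nn_integral_cmult[symmetric]) auto
    also have "\<dots> \<le> ball_kernel \<alpha> r (-x) z"
      unfolding ball_kernel_def
    proof (subst emeasure_angle_measure[OF a], simp, intro nn_integral_mono)
      fix t
      show "ennreal c * (ennreal (sin t powr \<sigma>) * indicator {pi - b<..<pi} t)
        \<le> ennreal (dunkl_const \<alpha> * (1 - cos t) * sin t powr (2 * \<alpha>)) * indicator ({0<..<pi} \<inter> {t. dunkl_arg (- x) z t < r}) t"
      proof (cases "pi - b < t \<and> t < pi")
        case True
        have "cos t \<le> 0" using cos_ge_zero[of "pi - t"] True b' by (auto simp: cos_diff)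
        then have "c * sin t powr \<sigma> \<le> dunkl_const \<alpha> * (1 - cos t) * sin t powr (2 * \<alpha>)"
          unfolding c_def[symmetric] \<sigma>_def[symmetric] using c
          by (intro mult_right_mono) (auto simp: algebra_simps mult_nonneg_nonpos)
        moreover have "t \<in> {0<..<pi} \<inter> {t. dunkl_arg (- x) z t < r}" using True arg b' by auto
        ultimately show ?thesis using True c by (simp add: ennreal_leI flip: ennreal_mult')
      qed auto
    qed
    finally show ?thesis .
  qed
  moreover have "c * K * (1/4) powr (\<sigma>+1) > 0" using c K by simp
  ultimately show ?thesis using that by (auto simp: \<sigma>_def)
qed

section \<open>Duality between the translation and the measure\<close>

text \<open>The factor \<open>1 - cos \<theta>\<close> of the translation is left to the integrand, because it changes when \<open>y\<close> and
  \<open>z = (x,y)\<^sub>\<theta>\<close> exchange roles.\<close>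

definition sin_measure :: "real \<Rightarrow> real measure" where
  "sin_measure \<alpha> = density lborel (\<lambda>t. ennreal (indicator {0<..<pi} t * sin t powr (2 * \<alpha>)))"

lemma sets_sin_measure [measurable_cong, simp]: "sets (sin_measure \<alpha>) = sets borel"
  by (simp add: sin_measure_def)

lemma space_sin_measure [simp]: "space (sin_measure \<alpha>) = UNIV"
  by (simp add: sin_measure_def)

lemma nn_integral_sin_measure:
  assumes [measurable]: "u \<in> borel_measurable borel"
  shows "(\<integral>\<^sup>+t. u t \<partial>sin_measure \<alpha>)
    = (\<integral>\<^sup>+t. u t * (ennreal (sin t powr (2 * \<alpha>)) * indicator {0<..<pi} t) \<partial>lborel)"
  unfolding sin_measure_def
  by (subst nn_integral_density) (auto simp: indicator_def mult.commute intro!: nn_integral_cong)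

lemma finite_sin_measure:
  assumes "\<alpha> > -1/2"
  shows "finite_measure (sin_measure \<alpha>)"
proof (rule finite_measureI)
  have "emeasure (sin_measure \<alpha>) (space (sin_measure \<alpha>)) = (\<integral>\<^sup>+t. 1 \<partial>sin_measure \<alpha>)" by simp
  also have "\<dots> = sin_integral (2 * \<alpha>) {0<..<pi}"
    by (subst nn_integral_sin_measure) auto
  also have "\<dots> < \<infinity>" by (rule nn_integral_sin_powr_finite) (use assms in auto)
  finally show "emeasure (sin_measure \<alpha>) (space (sin_measure \<alpha>)) \<noteq> \<infinity>" by simp
qed

text \<open>The density of \<open>z = (x,y)\<^sub>\<theta>\<close> when \<open>\<theta>\<close> is distributed according to \<open>sin_measure \<alpha>\<close>, extended
  evenly to negative \<open>z\<close>. By the law of cosines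
  \<open>sin\<^sup>2\<theta>\<close> is the quotient under the power, and \<open>z dz = \<bar>x y\<bar> sin \<theta> d\<theta>\<close>.\<close>

definition triangle_density :: "real \<Rightarrow> real \<Rightarrow> real \<Rightarrow> real \<Rightarrow> real" where
  "triangle_density \<alpha> x y z =
     (if 4 * x\<^sup>2 * y\<^sup>2 - (x\<^sup>2 + y\<^sup>2 - z\<^sup>2)\<^sup>2 > 0
      then ((4 * x\<^sup>2 * y\<^sup>2 - (x\<^sup>2 + y\<^sup>2 - z\<^sup>2)\<^sup>2) / (4 * x\<^sup>2 * y\<^sup>2)) powr (\<alpha> - 1/2) * (\<bar>z\<bar> / \<bar>x * y\<bar>)
      else 0)"

lemma triangle_density_measurable [measurable (raw)]:
  assumes [measurable]: "f \<in> borel_measurable M" "g \<in> borel_measurable M"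
  shows "(\<lambda>w. triangle_density \<alpha> x (f w) (g w)) \<in> borel_measurable M"
  unfolding triangle_density_def by measurable

lemma triangle_density_nonneg [simp]: "triangle_density \<alpha> x y z \<ge> 0"
  by (simp add: triangle_density_def)

lemma triangle_density_minus [simp]:
  "triangle_density \<alpha> x y (- z) = triangle_density \<alpha> x y z"
  "triangle_density \<alpha> x (- y) z = triangle_density \<alpha> x y z"
  by (simp_all add: triangle_density_def)

text \<open>The expression \<open>4x\<^sup>2y\<^sup>2 - (x\<^sup>2 + y\<^sup>2 - z\<^sup>2)\<^sup>2\<close> is \<open>16\<close> times the squared area of the triangle with sides
  \<open>\<bar>x\<bar>\<close>, \<open>\<bar>y\<bar>\<close>, \<open>\<bar>z\<bar>\<close> (Heron's formula), hence symmetric; both sides equal its power \<open>\<alpha> - 1/2\<close> times \<open>\<bar>y z\<bar>\<close>,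
  up to a factor that depends on \<open>x\<close> only.\<close>

lemma triangle_density_symmetric:
  assumes "x \<noteq> 0" "y \<noteq> 0" "z \<noteq> 0"
  shows "\<bar>y\<bar> powr (2 * \<alpha> + 1) * triangle_density \<alpha> x y z
    = \<bar>z\<bar> powr (2 * \<alpha> + 1) * triangle_density \<alpha> x z y"
proof -
  define D where "D = 4 * x\<^sup>2 * y\<^sup>2 - (x\<^sup>2 + y\<^sup>2 - z\<^sup>2)\<^sup>2"
  have D': "4 * x\<^sup>2 * z\<^sup>2 - (x\<^sup>2 + z\<^sup>2 - y\<^sup>2)\<^sup>2 = D"
    unfolding D_def by (simp add: power2_eq_square algebra_simps)
  have *: "\<bar>u\<bar> powr (2 * \<alpha> + 1) * ((D / (4 * x\<^sup>2 * u\<^sup>2)) powr (\<alpha> - 1/2) * (\<bar>v\<bar> / \<bar>x * u\<bar>))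
     = (D / (4 * x\<^sup>2)) powr (\<alpha> - 1/2) / \<bar>x\<bar> * (\<bar>u\<bar> * \<bar>v\<bar>)" if "u \<noteq> 0" "D > 0" for u v
  proof -
    have "(D / (4 * x\<^sup>2 * u\<^sup>2)) powr (\<alpha> - 1/2) = (D / (4 * x\<^sup>2)) powr (\<alpha> - 1/2) / (u\<^sup>2) powr (\<alpha> - 1/2)"
      using powr_divide[of "D / (4 * x\<^sup>2)" "u\<^sup>2" "\<alpha> - 1/2"] that by simp
    also have "(u\<^sup>2) powr (\<alpha> - 1/2) = \<bar>u\<bar> powr (2 * \<alpha> - 1)"
    proof -
      have "(u\<^sup>2) powr (\<alpha> - 1/2) = (\<bar>u\<bar> powr 2) powr (\<alpha> - 1/2)" using that by (simp add: powr_numeral)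
      also have "\<dots> = \<bar>u\<bar> powr (2 * (\<alpha> - 1/2))" by (rule powr_powr)
      finally show ?thesis by (simp add: right_diff_distrib)
    qed
    finally have "(D / (4 * x\<^sup>2 * u\<^sup>2)) powr (\<alpha> - 1/2) = (D / (4 * x\<^sup>2)) powr (\<alpha> - 1/2) / \<bar>u\<bar> powr (2 * \<alpha> - 1)" .
    moreover have "\<bar>u\<bar> powr (2 * \<alpha> + 1) = \<bar>u\<bar> powr (2 * \<alpha> - 1) * \<bar>u\<bar>\<^sup>2"
    proof -
      have exponent: "2 * \<alpha> + 1 = (2 * \<alpha> - 1) + 2" by simp
      have "\<bar>u\<bar> powr (2 * \<alpha> + 1) = \<bar>u\<bar> powr (2 * \<alpha> - 1) * \<bar>u\<bar> powr 2"
        unfolding exponent by (rule powr_add)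
      then show ?thesis using that by (simp add: powr_numeral)
    qed
    ultimately show ?thesis
      using that assms by (simp add: abs_mult power2_eq_square field_simps)
  qed
  show ?thesis
    using *[OF assms(2), of z] *[OF assms(3), of y] D'
    unfolding triangle_density_def D_def[symmetric] D' by (auto simp: mult.commute)
qed

lemma dunkl_arg_pos:
  assumes "\<bar>x\<bar> \<noteq> \<bar>y\<bar>"
  shows "dunkl_arg x y t > 0"
  using dunkl_arg_ge[of x y t] assms by linarith

lemma dunkl_arg_reflect: "dunkl_arg x (- y) (pi - t) = dunkl_arg x y t"
  by (simp add: dunkl_arg_def)

text \<open>For \<open>x y > 0\<close> the argument increases with the angle from \<open>\<bar>x - y\<bar>\<close> to \<open>\<bar>x + y\<bar>\<close>, so this is a substitution.\<close>

lemma nn_integral_dunkl_arg_pos: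
  assumes xy: "x * y > 0" "\<bar>x\<bar> \<noteq> \<bar>y\<bar>" and [measurable]: "h \<in> borel_measurable borel"
  shows "(\<integral>\<^sup>+t. h (dunkl_arg x y t) \<partial>sin_measure \<alpha>)
    = (\<integral>\<^sup>+z. h z * ennreal (triangle_density \<alpha> x y z) * indicator {0<..} z \<partial>lborel)"
proof -
  let ?A = "dunkl_arg x y"
  let ?f = "\<lambda>z. h z * ennreal (triangle_density \<alpha> x y z)"
  let ?A' = "\<lambda>t. x * y * sin t / ?A t"
  have pos: "?A t > 0" for t by (rule dunkl_arg_pos[OF xy(2)])
  have rad: "x\<^sup>2 + y\<^sup>2 - 2 * x * y * cos t > 0" for t
    using pos[of t] by (simp add: dunkl_arg_def)
  have deriv: "(?A has_real_derivative ?A' t) (at t)" for t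
  proof -
    have alg: "inverse s / 2 * (2 * x * y * v) = x * y * v / s" for s v :: real
      by (cases "s = 0") (simp_all add: field_simps)
    have "((\<lambda>t. x\<^sup>2 + y\<^sup>2 - 2 * x * y * cos t) has_real_derivative 2 * x * y * sin t) (at t)"
      by (auto intro!: derivative_eq_intros)
    from DERIV_chain2[OF DERIV_real_sqrt[OF rad] this] show ?thesis
      unfolding dunkl_arg_def alg .
  qed
  have cont: "continuous_on {0..pi} ?A'"
  proof (rule continuous_on_divide)
    show "continuous_on {0..pi} (\<lambda>t. x * y * sin t)" by (intro continuous_intros)
    show "continuous_on {0..pi} ?A"
      by (rule continuous_at_imp_continuous_on) (use deriv DERIV_isCont in blast)
    show "\<forall>t\<in>{0..pi}. ?A t \<noteq> 0"
    proof
      fix t show "?A t \<noteq> 0" using pos[of t] by simp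
    qed
  qed
  have A0: "?A 0 = \<bar>x - y\<bar>"
  proof -
    have "(?A 0)\<^sup>2 = \<bar>x - y\<bar>\<^sup>2" by (simp add: dunkl_arg_square power2_diff)
    then show ?thesis by (metis abs_ge_zero dunkl_arg_nonneg power2_eq_iff_nonneg)
  qed
  have Api: "?A pi = \<bar>x + y\<bar>"
  proof -
    have "(?A pi)\<^sup>2 = \<bar>x + y\<bar>\<^sup>2" by (simp add: dunkl_arg_square power2_sum)
    then show ?thesis by (metis abs_ge_zero dunkl_arg_nonneg power2_eq_iff_nonneg)
  qed
  have "(\<integral>\<^sup>+z. ?f z * indicator {0<..} z \<partial>lborel) = (\<integral>\<^sup>+z. ?f z * indicator {?A 0..?A pi} z \<partial>lborel)"
  proof (intro nn_integral_cong)
    fix z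
    show "?f z * indicator {0<..} z = ?f z * indicator {?A 0..?A pi} z"
    proof (cases "triangle_density \<alpha> x y z = 0")
      case False
      then have D: "4 * x\<^sup>2 * y\<^sup>2 - (x\<^sup>2 + y\<^sup>2 - z\<^sup>2)\<^sup>2 > 0" by (auto simp: triangle_density_def split: if_splits)
      have "4 * x\<^sup>2 * y\<^sup>2 - (x\<^sup>2 + y\<^sup>2 - z\<^sup>2)\<^sup>2 = ((x + y)\<^sup>2 - z\<^sup>2) * (z\<^sup>2 - (x - y)\<^sup>2)"
        by (simp add: power2_eq_square algebra_simps)
      then have prod: "((x + y)\<^sup>2 - z\<^sup>2) * (z\<^sup>2 - (x - y)\<^sup>2) > 0" using D by simp
      have "(x - y)\<^sup>2 < (x + y)\<^sup>2" using xy by (simp add: power2_sum power2_diff)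
      with prod have "(x - y)\<^sup>2 < z\<^sup>2" "z\<^sup>2 < (x + y)\<^sup>2" by (auto simp: zero_less_mult_iff)
      then have "\<bar>x - y\<bar> < \<bar>z\<bar>" "\<bar>z\<bar> < \<bar>x + y\<bar>" 
        using abs_le_square_iff[of z "x - y"] abs_le_square_iff[of "x + y" z] by linarith+
      then have "z > 0 \<longleftrightarrow> z \<in> {?A 0..?A pi}" unfolding A0 Api by auto
      then show ?thesis by (simp add: indicator_def)
    qed simp
  qed
  also have "\<dots> = (\<integral>\<^sup>+t. ?f (?A t) * ennreal (?A' t) * indicator {0..pi} t \<partial>lborel)"
  proof (rule nn_integral_substitution_aux)
    show "0 \<le> ?A' t" if "t \<in> {0..pi}" for t
      using that xy sin_ge_zero[of t] by (auto intro!: divide_nonneg_nonneg mult_nonneg_nonneg)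
  qed (use deriv cont in auto)
  also have "\<dots> = (\<integral>\<^sup>+t. h (?A t) * (ennreal (sin t powr (2 * \<alpha>)) * indicator {0<..<pi} t) \<partial>lborel)"
  proof (intro nn_integral_cong)
    fix t
    show "?f (?A t) * ennreal (?A' t) * indicator {0..pi} t
        = h (?A t) * (ennreal (sin t powr (2 * \<alpha>)) * indicator {0<..<pi} t)"
    proof (cases "t \<in> {0<..<pi}")
      case True
      then have sin: "sin t > 0" by (auto intro: sin_gt_zero)
      have xy0: "x \<noteq> 0" "y \<noteq> 0" using xy by auto
      have "4 * x\<^sup>2 * y\<^sup>2 - (x\<^sup>2 + y\<^sup>2 - (?A t)\<^sup>2)\<^sup>2 = 4 * x\<^sup>2 * y\<^sup>2 * (1 - (cos t)\<^sup>2)"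
        by (simp add: dunkl_arg_square power_mult_distrib right_diff_distrib)
      also have "\<dots> = 4 * x\<^sup>2 * y\<^sup>2 * (sin t)\<^sup>2" by (simp add: sin_squared_eq)
      finally have D: "4 * x\<^sup>2 * y\<^sup>2 - (x\<^sup>2 + y\<^sup>2 - (?A t)\<^sup>2)\<^sup>2 = 4 * x\<^sup>2 * y\<^sup>2 * (sin t)\<^sup>2" .
      have "(sin t)\<^sup>2 powr (\<alpha> - 1/2) = sin t powr (2 * \<alpha> - 1)"
      proof -
        have "(sin t)\<^sup>2 powr (\<alpha> - 1/2) = (sin t powr 2) powr (\<alpha> - 1/2)" using sin by (simp add: powr_numeral)
        also have "\<dots> = sin t powr (2 * (\<alpha> - 1/2))" by (rule powr_powr)
        finally show ?thesis by (simp add: right_diff_distrib)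
      qed
      then have "triangle_density \<alpha> x y (?A t) = sin t powr (2 * \<alpha> - 1) * (?A t / (x * y))"
        unfolding triangle_density_def D using xy0 xy sin by simp
      then have "triangle_density \<alpha> x y (?A t) * ?A' t = sin t powr (2 * \<alpha> - 1) * sin t powr 1"
        using pos[of t] xy0 sin by simp
      also have "\<dots> = sin t powr (2 * \<alpha>)" by (subst powr_add[symmetric]) simp
      finally have "triangle_density \<alpha> x y (?A t) * ?A' t = sin t powr (2 * \<alpha>)" .
      moreover have "0 \<le> ?A' t" using sin xy pos[of t] by simp
      ultimately show ?thesis using True
        by (simp add: mult.assoc flip: ennreal_mult)
    next
      case False
      then have "t \<in> {0..pi} \<Longrightarrow> sin t = 0" by (cases "t = 0 \<or> t = pi") auto
      then show ?thesis using False by (auto simp: indicator_def)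
    qed
  qed
  also have "\<dots> = (\<integral>\<^sup>+t. h (?A t) \<partial>sin_measure \<alpha>)"
    by (subst nn_integral_sin_measure) auto
  finally show ?thesis ..
qed

lemma nn_integral_sin_measure_reflect:
  assumes [measurable]: "u \<in> borel_measurable borel"
  shows "(\<integral>\<^sup>+t. u (pi - t) \<partial>sin_measure \<alpha>) = (\<integral>\<^sup>+t. u t \<partial>sin_measure \<alpha>)"
proof -
  have "(\<integral>\<^sup>+t. u t \<partial>sin_measure \<alpha>)
     = (\<integral>\<^sup>+t. u t * (ennreal (sin t powr (2 * \<alpha>)) * indicator {0<..<pi} t) \<partial>lborel)"
    by (rule nn_integral_sin_measure) simp
  also have "\<dots> = ennreal \<bar>-1\<bar> * (\<integral>\<^sup>+t. u (pi + -1 * t) * (ennreal (sin (pi + -1 * t) powr (2 * \<alpha>)) * indicator {0<..<pi} (pi + -1 * t)) \<partial>lborel)"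
    by (rule nn_integral_real_affine) auto
  also have "\<dots> = (\<integral>\<^sup>+t. u (pi - t) * (ennreal (sin t powr (2 * \<alpha>)) * indicator {0<..<pi} t) \<partial>lborel)"
    by (simp add: indicator_def) (intro nn_integral_cong, auto)
  also have "\<dots> = (\<integral>\<^sup>+t. u (pi - t) \<partial>sin_measure \<alpha>)"
    by (subst nn_integral_sin_measure) auto
  finally show ?thesis ..
qed

lemma nn_integral_dunkl_arg:
  assumes xy: "x \<noteq> 0" "y \<noteq> 0" "\<bar>x\<bar> \<noteq> \<bar>y\<bar>" and [measurable]: "h \<in> borel_measurable borel"
  shows "(\<integral>\<^sup>+t. h (dunkl_arg x y t) + h (- dunkl_arg x y t) \<partial>sin_measure \<alpha>)
    = (\<integral>\<^sup>+z. h z * ennreal (triangle_density \<alpha> x y z) \<partial>lborel)"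
proof -
  have half: "(\<integral>\<^sup>+t. k (dunkl_arg x y t) \<partial>sin_measure \<alpha>)
    = (\<integral>\<^sup>+z. k z * ennreal (triangle_density \<alpha> x y z) * indicator {0<..} z \<partial>lborel)"
    if [measurable]: "k \<in> borel_measurable borel" for k
  proof (cases "x * y > 0")
    case True
    then show ?thesis by (rule nn_integral_dunkl_arg_pos) (use xy in auto)
  next
    case False
    then have "x * y < 0" using xy by (metis linorder_neqE_linordered_idom mult_eq_0_iff)
    have "(\<integral>\<^sup>+t. k (dunkl_arg x y t) \<partial>sin_measure \<alpha>) = (\<integral>\<^sup>+t. k (dunkl_arg x (- y) (pi - t)) \<partial>sin_measure \<alpha>)"
      by (simp add: dunkl_arg_reflect)
    also have "\<dots> = (\<integral>\<^sup>+t. k (dunkl_arg x (- y) t) \<partial>sin_measure \<alpha>)"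
      by (rule nn_integral_sin_measure_reflect) simp
    also have "\<dots> = (\<integral>\<^sup>+z. k z * ennreal (triangle_density \<alpha> x (- y) z) * indicator {0<..} z \<partial>lborel)"
      by (rule nn_integral_dunkl_arg_pos) (use xy \<open>x * y < 0\<close> in auto)
    finally show ?thesis by simp
  qed
  have neg: "(\<integral>\<^sup>+z. h (- z) * ennreal (triangle_density \<alpha> x y z) * indicator {0<..} z \<partial>lborel)
      = (\<integral>\<^sup>+z. h z * ennreal (triangle_density \<alpha> x y z) * indicator {..<0} z \<partial>lborel)"
  proof -
    have "(\<integral>\<^sup>+z. h z * ennreal (triangle_density \<alpha> x y z) * indicator {..<0} z \<partial>lborel)
      = ennreal \<bar>-1\<bar> * (\<integral>\<^sup>+z. h (0 + -1 * z) * ennreal (triangle_density \<alpha> x y (0 + -1 * z)) * indicator {..<0} (0 + -1 * z) \<partial>lborel)"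
      by (rule nn_integral_real_affine) auto
    then show ?thesis by (auto simp: indicator_def intro!: nn_integral_cong)
  qed
  have "(\<integral>\<^sup>+t. h (dunkl_arg x y t) + h (- dunkl_arg x y t) \<partial>sin_measure \<alpha>)
     = (\<integral>\<^sup>+t. h (dunkl_arg x y t) \<partial>sin_measure \<alpha>) + (\<integral>\<^sup>+t. h (- dunkl_arg x y t) \<partial>sin_measure \<alpha>)"
    by (intro nn_integral_add) auto
  also have "\<dots> = (\<integral>\<^sup>+z. h z * ennreal (triangle_density \<alpha> x y z) * indicator {0<..} z \<partial>lborel)
     + (\<integral>\<^sup>+z. h z * ennreal (triangle_density \<alpha> x y z) * indicator {..<0} z \<partial>lborel)"
    by (simp add: half[of h] half[of "\<lambda>z. h (- z)"] neg)
  also have "\<dots> = (\<integral>\<^sup>+z. h z * ennreal (triangle_density \<alpha> x y z) * indicator {0<..} z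
     + h z * ennreal (triangle_density \<alpha> x y z) * indicator {..<0} z \<partial>lborel)"
    by (intro nn_integral_add[symmetric]) auto
  also have "\<dots> = (\<integral>\<^sup>+z. h z * ennreal (triangle_density \<alpha> x y z) \<partial>lborel)"
    by (intro nn_integral_cong) (auto simp: indicator_def triangle_density_def)
  finally show ?thesis .
qed

text \<open>The integral of \<open>H\<close> over the pairs \<open>(y, z)\<close> for which \<open>\<bar>z\<bar>\<close> is the third side of a triangle with sides
  \<open>\<bar>x\<bar>\<close> and \<open>\<bar>y\<bar>\<close>. Both signs of \<open>z\<close> are counted, since the translation involves \<open>g\<close> at both points.\<close>

definition arg_pairing :: "real \<Rightarrow> real \<Rightarrow> (real \<Rightarrow> real \<Rightarrow> ennreal) \<Rightarrow> ennreal" where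
  "arg_pairing \<alpha> x H =
     (\<integral>\<^sup>+y. \<integral>\<^sup>+t. H y (dunkl_arg x y t) + H y (- dunkl_arg x y t) \<partial>sin_measure \<alpha> \<partial>dunkl_borel \<alpha>)"

lemma nn_integral_dunkl_borel:
  assumes [measurable]: "u \<in> borel_measurable borel"
  shows "(\<integral>\<^sup>+y. u y \<partial>dunkl_borel \<alpha>)
    = (\<integral>\<^sup>+y. ennreal (dunkl_weight \<alpha> * \<bar>y\<bar> powr (2 * \<alpha> + 1)) * u y \<partial>lborel)"
  unfolding dunkl_borel_def by (rule nn_integral_density) measurable

lemma sigma_finite_sin_measure:
  assumes "\<alpha> > -1/2"
  shows "sigma_finite_measure (sin_measure \<alpha>)"
  using finite_sin_measure[OF assms] by (simp add: finite_measure_def)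

lemma arg_pairing_eq:
  assumes \<alpha>: "\<alpha> > -1/2" and x: "x \<noteq> 0"
    and [measurable]: "(\<lambda>(y, z). H y z) \<in> borel_measurable (borel \<Otimes>\<^sub>M borel)"
  shows "arg_pairing \<alpha> x H =
    (\<integral>\<^sup>+y. \<integral>\<^sup>+z. H y z * ennreal (dunkl_weight \<alpha> *
        (\<bar>y\<bar> powr (2 * \<alpha> + 1) * triangle_density \<alpha> x y z)) \<partial>lborel \<partial>lborel)"
proof -
  interpret S: sigma_finite_measure "sin_measure \<alpha>" by (rule sigma_finite_sin_measure[OF \<alpha>])
  define a where "a = dunkl_weight \<alpha>"
  have a: "a > 0" unfolding a_def using \<alpha> by (intro dunkl_weight_pos) auto
  have "AE y in lborel. y \<noteq> 0 \<and> y \<noteq> x \<and> y \<noteq> - x"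
    by (intro AE_conjI AE_lborel_singleton)
  then have "AE y in lborel. ennreal (a * \<bar>y\<bar> powr (2 * \<alpha> + 1)) *
      (\<integral>\<^sup>+t. H y (dunkl_arg x y t) + H y (- dunkl_arg x y t) \<partial>sin_measure \<alpha>)
      = (\<integral>\<^sup>+z. H y z * ennreal (a * (\<bar>y\<bar> powr (2 * \<alpha> + 1) * triangle_density \<alpha> x y z)) \<partial>lborel)"
  proof eventually_elim
    case (elim y)
    have "ennreal (a * \<bar>y\<bar> powr (2 * \<alpha> + 1)) *
      (\<integral>\<^sup>+t. H y (dunkl_arg x y t) + H y (- dunkl_arg x y t) \<partial>sin_measure \<alpha>)
      = ennreal (a * \<bar>y\<bar> powr (2 * \<alpha> + 1)) * (\<integral>\<^sup>+z. H y z * ennreal (triangle_density \<alpha> x y z) \<partial>lborel)"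
      by (subst nn_integral_dunkl_arg) (use x elim in \<open>auto simp: abs_eq_iff\<close>)
    also have "\<dots> = (\<integral>\<^sup>+z. ennreal (a * \<bar>y\<bar> powr (2 * \<alpha> + 1)) * (H y z * ennreal (triangle_density \<alpha> x y z)) \<partial>lborel)"
      by (intro nn_integral_cmult[symmetric]) auto
    also have "\<dots> = (\<integral>\<^sup>+z. H y z * ennreal (a * (\<bar>y\<bar> powr (2 * \<alpha> + 1) * triangle_density \<alpha> x y z)) \<partial>lborel)"
      using a by (intro nn_integral_cong) (simp add: ennreal_mult mult_ac)
    finally show ?case .
  qed
  then show ?thesis
    unfolding arg_pairing_def a_def
    by (subst nn_integral_dunkl_borel, measurable) (intro nn_integral_cong_AE)
qed

text \<open>This symmetry is the reason why the translation has an adjoint of the same form.\<close>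

lemma arg_pairing_swap:
  assumes \<alpha>: "\<alpha> > -1/2" and x: "x \<noteq> 0"
    and [measurable]: "(\<lambda>(y, z). H y z) \<in> borel_measurable (borel \<Otimes>\<^sub>M borel)"
  shows "arg_pairing \<alpha> x (\<lambda>y z. H z y) = arg_pairing \<alpha> x H"
proof -
  define a where "a = dunkl_weight \<alpha>"
  have meas: "(\<lambda>(y, z). H z y) \<in> borel_measurable (borel \<Otimes>\<^sub>M borel)"
    by measurable
  let ?D = "\<lambda>y z. ennreal (a * (\<bar>y\<bar> powr (2 * \<alpha> + 1) * triangle_density \<alpha> x y z))"
  have ae: "AE y in lborel. y \<noteq> (0::real)" by (rule AE_lborel_singleton)
  have "arg_pairing \<alpha> x (\<lambda>y z. H z y) = (\<integral>\<^sup>+y. \<integral>\<^sup>+z. H z y * ?D y z \<partial>lborel \<partial>lborel)"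
    unfolding a_def by (rule arg_pairing_eq[OF \<alpha> x meas])
  also have "\<dots> = (\<integral>\<^sup>+z. \<integral>\<^sup>+y. H z y * ?D y z \<partial>lborel \<partial>lborel)"
    by (rule lborel_pair.Fubini') measurable
  also have "\<dots> = (\<integral>\<^sup>+z. \<integral>\<^sup>+y. H z y * ?D z y \<partial>lborel \<partial>lborel)"
  proof (rule nn_integral_cong_AE)
    show "AE z in lborel. (\<integral>\<^sup>+y. H z y * ?D y z \<partial>lborel) = (\<integral>\<^sup>+y. H z y * ?D z y \<partial>lborel)"
      using ae
    proof eventually_elim
      case (elim z)
      show ?case
        by (rule nn_integral_cong_AE) (use ae in eventually_elim, use x elim triangle_density_symmetric in simp)
    qed
  qed
  also have "\<dots> = arg_pairing \<alpha> x H"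
    unfolding a_def by (rule arg_pairing_eq[OF \<alpha> x, symmetric]) measurable
  finally show ?thesis .
qed

text \<open>Positive and negative parts of \<open>H\<close> are paired separately, so that the symmetry under exchange of \<open>y\<close> and
  \<open>z\<close> extends to signed functions.\<close>

lemma
  fixes H :: "real \<Rightarrow> real \<Rightarrow> real"
  assumes \<alpha>: "\<alpha> > -1/2"
    and [measurable]: "(\<lambda>(y, z). H y z) \<in> borel_measurable (borel \<Otimes>\<^sub>M borel)"
    and fin: "arg_pairing \<alpha> x (\<lambda>y z. ennreal \<bar>H y z\<bar>) < \<infinity>"
  shows integrable_arg_pairing:
      "integrable (dunkl_borel \<alpha> \<Otimes>\<^sub>M sin_measure \<alpha>) (\<lambda>(y, t). H y (dunkl_arg x y t) + H y (- dunkl_arg x y t))"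
    and integral_arg_pairing:
      "(LINT (y, t)|(dunkl_borel \<alpha> \<Otimes>\<^sub>M sin_measure \<alpha>). H y (dunkl_arg x y t) + H y (- dunkl_arg x y t))
        = enn2real (arg_pairing \<alpha> x (\<lambda>y z. ennreal (H y z))) - enn2real (arg_pairing \<alpha> x (\<lambda>y z. ennreal (- H y z)))"
proof -
  interpret S: sigma_finite_measure "sin_measure \<alpha>" by (rule sigma_finite_sin_measure[OF \<alpha>])
  let ?M = "dunkl_borel \<alpha> \<Otimes>\<^sub>M sin_measure \<alpha>"
  define F where "F s w = (case w of (y, t) \<Rightarrow> H y (s * dunkl_arg x y t))" for s :: real and w
  have [measurable]: "F s \<in> borel_measurable ?M" for s
    unfolding F_def by measurable
  have pair: "arg_pairing \<alpha> x (\<lambda>y z. k (H y z)) = (\<integral>\<^sup>+w. k (F 1 w) \<partial>?M) + (\<integral>\<^sup>+w. k (F (-1) w) \<partial>?M)"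
    if [measurable]: "k \<in> borel_measurable borel" for k :: "real \<Rightarrow> ennreal"
  proof -
    have "arg_pairing \<alpha> x (\<lambda>y z. k (H y z)) = (\<integral>\<^sup>+y. \<integral>\<^sup>+t. k (F 1 (y, t)) + k (F (-1) (y, t)) \<partial>sin_measure \<alpha> \<partial>dunkl_borel \<alpha>)"
      unfolding arg_pairing_def F_def by simp
    also have "\<dots> = (\<integral>\<^sup>+w. k (F 1 w) + k (F (-1) w) \<partial>?M)"
      by (rule S.nn_integral_fst) measurable
    also have "\<dots> = (\<integral>\<^sup>+w. k (F 1 w) \<partial>?M) + (\<integral>\<^sup>+w. k (F (-1) w) \<partial>?M)"
      by (rule nn_integral_add) measurable
    finally show ?thesis .
  qed
  have "(\<integral>\<^sup>+w. ennreal \<bar>F 1 w\<bar> \<partial>?M) + (\<integral>\<^sup>+w. ennreal \<bar>F (-1) w\<bar> \<partial>?M) < \<infinity>"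
    using fin by (subst (asm) pair) auto
  then have int: "integrable ?M (F s)" if "s = 1 \<or> s = -1" for s
    using that by (intro integrableI_bounded) (auto simp: less_top)
  have eq: "(\<lambda>(y, t). H y (dunkl_arg x y t) + H y (- dunkl_arg x y t)) = (\<lambda>w. F 1 w + F (-1) w)"
    by (auto simp: F_def)
  show "integrable ?M (\<lambda>(y, t). H y (dunkl_arg x y t) + H y (- dunkl_arg x y t))"
    unfolding eq by (intro Bochner_Integration.integrable_add int) auto
  have fin': "(\<integral>\<^sup>+w. ennreal (F s w) \<partial>?M) < \<infinity>" "(\<integral>\<^sup>+w. ennreal (- F s w) \<partial>?M) < \<infinity>" if "s = 1 \<or> s = -1" for s
    using real_integrable_def[THEN iffD1, OF int[OF that]] by (auto simp: less_top)
  have "(LINT w|?M. F 1 w + F (-1) w) = (LINT w|?M. F 1 w) + (LINT w|?M. F (-1) w)"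
    by (intro Bochner_Integration.integral_add int) auto
  also have "\<dots> = enn2real (arg_pairing \<alpha> x (\<lambda>y z. ennreal (H y z))) - enn2real (arg_pairing \<alpha> x (\<lambda>y z. ennreal (- H y z)))"
    using pair[of ennreal] pair[of "\<lambda>v. ennreal (- v)"] fin'
    by (simp add: real_lebesgue_integral_def int enn2real_plus less_top)
  finally show "(LINT (y, t)|?M. H y (dunkl_arg x y t) + H y (- dunkl_arg x y t))
        = enn2real (arg_pairing \<alpha> x (\<lambda>y z. ennreal (H y z))) - enn2real (arg_pairing \<alpha> x (\<lambda>y z. ennreal (- H y z)))"
    unfolding eq .
qed

lemma integral_sin_measure:
  fixes u :: "real \<Rightarrow> real"
  assumes [measurable]: "u \<in> borel_measurable borel"
  shows "(LINT t|sin_measure \<alpha>. u t) = (LINT t:{0..pi}|lebesgue. u t * sin t powr (2 * \<alpha>))"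
proof -
  have "(LINT t|sin_measure \<alpha>. u t) = (LINT t|lborel. (indicator {0<..<pi} t * sin t powr (2 * \<alpha>)) *\<^sub>R u t)"
    unfolding sin_measure_def by (rule integral_density) auto
  also have "\<dots> = (LINT t|lebesgue. (indicator {0<..<pi} t * sin t powr (2 * \<alpha>)) *\<^sub>R u t)"
    by (rule integral_completion[symmetric]) simp
  also have "\<dots> = (LINT t:{0..pi}|lebesgue. u t * sin t powr (2 * \<alpha>))"
    unfolding set_lebesgue_integral_def
  proof (intro Bochner_Integration.integral_cong refl)
    fix t
    show "(indicator {0<..<pi} t * sin t powr (2 * \<alpha>)) *\<^sub>R u t = indicator {0..pi} t *\<^sub>R (u t * sin t powr (2 * \<alpha>))"
      by (cases "t = 0 \<or> t = pi") (auto simp: indicator_def)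
  qed
  finally show ?thesis .
qed

lemma dunkl_translation_eq:
  assumes \<alpha>: "\<alpha> > -1/2" and [measurable]: "g \<in> borel_measurable borel"
  shows "dunkl_translation \<alpha> x g y = dunkl_const \<alpha> / 2 *
    (LINT t|sin_measure \<alpha>. (g (dunkl_arg x y t) + g (- dunkl_arg x y t)
       + (x + y) / dunkl_arg x y t * (g (dunkl_arg x y t) - g (- dunkl_arg x y t))) * (1 - cos t))"
  using \<alpha> unfolding dunkl_translation_def by (subst integral_sin_measure) auto

lemma dunkl_translation_measurable:
  assumes \<alpha>: "\<alpha> \<ge> -1/2" and [measurable]: "g \<in> borel_measurable borel"
  shows "(\<lambda>(x, y). dunkl_translation \<alpha> x g y) \<in> borel_measurable (borel \<Otimes>\<^sub>M borel)"
proof (cases "\<alpha> = -1/2")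
  case True
  then show ?thesis by (simp add: dunkl_translation_def)
next
  case False
  then have a: "\<alpha> > -1/2" using \<alpha> by simp
  interpret S: sigma_finite_measure "sin_measure \<alpha>" by (rule sigma_finite_sin_measure[OF a])
  show ?thesis
    unfolding dunkl_translation_eq[OF a assms(2)] by measurable
qed

lemma nn_integral_angle_measure:
  assumes \<alpha>: "\<alpha> > -1/2" and [measurable]: "u \<in> borel_measurable borel"
  shows "(\<integral>\<^sup>+t. u t \<partial>angle_measure \<alpha>) = (\<integral>\<^sup>+t. ennreal (dunkl_const \<alpha> * (1 - cos t)) * u t \<partial>sin_measure \<alpha>)"
proof -
  have c: "dunkl_const \<alpha> > 0" by (rule dunkl_const_pos[OF \<alpha>])
  have "(\<integral>\<^sup>+t. u t \<partial>angle_measure \<alpha>)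
    = (\<integral>\<^sup>+t. ennreal (dunkl_const \<alpha> * (1 - cos t) * sin t powr (2 * \<alpha>)) * indicator {0<..<pi} t * u t \<partial>lborel)"
    using \<alpha> unfolding angle_measure_def by (simp add: nn_integral_density)
  also have "\<dots> = (\<integral>\<^sup>+t. ennreal (dunkl_const \<alpha> * (1 - cos t)) * u t * (ennreal (sin t powr (2 * \<alpha>)) * indicator {0<..<pi} t) \<partial>lborel)"
  proof (intro nn_integral_cong)
    fix t
    have "ennreal (dunkl_const \<alpha> * (1 - cos t) * sin t powr (2 * \<alpha>))
        = ennreal (dunkl_const \<alpha> * (1 - cos t)) * ennreal (sin t powr (2 * \<alpha>))"
      using c by (intro ennreal_mult) auto
    then show "ennreal (dunkl_const \<alpha> * (1 - cos t) * sin t powr (2 * \<alpha>)) * indicator {0<..<pi} t * u t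
      = ennreal (dunkl_const \<alpha> * (1 - cos t)) * u t * (ennreal (sin t powr (2 * \<alpha>)) * indicator {0<..<pi} t)"
      by (simp add: mult_ac)
  qed
  also have "\<dots> = (\<integral>\<^sup>+t. ennreal (dunkl_const \<alpha> * (1 - cos t)) * u t \<partial>sin_measure \<alpha>)"
    by (rule nn_integral_sin_measure[symmetric]) simp
  finally show ?thesis .
qed

lemma integral_bounded_sin_measure:
  assumes \<alpha>: "\<alpha> > -1/2" and [measurable]: "u \<in> borel_measurable borel"
    and u: "\<And>t. 0 \<le> u t" "\<And>t. u t \<le> (2::real)"
  shows "(\<integral>\<^sup>+t. ennreal (dunkl_const \<alpha> * u t) \<partial>sin_measure \<alpha>) = ennreal (dunkl_const \<alpha> * (LINT t|sin_measure \<alpha>. u t))"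
proof -
  interpret S: finite_measure "sin_measure \<alpha>" by (rule finite_sin_measure[OF \<alpha>])
  have "integrable (sin_measure \<alpha>) u"
    by (rule S.integrable_const_bound[of _ 2]) (use u in auto)
  then have "integrable (sin_measure \<alpha>) (\<lambda>t. dunkl_const \<alpha> * u t)" by simp
  then have "(\<integral>\<^sup>+t. ennreal (dunkl_const \<alpha> * u t) \<partial>sin_measure \<alpha>) = ennreal (LINT t|sin_measure \<alpha>. dunkl_const \<alpha> * u t)"
    by (rule nn_integral_eq_integral) (use u dunkl_const_pos[OF \<alpha>] in auto)
  then show ?thesis by simp
qed

lemma one_pm_cos: "0 \<le> 1 - cos t" "1 - cos t \<le> 2" "0 \<le> 1 + cos t" "1 + cos t \<le> (2::real)"
  using cos_le_one[of t] cos_ge_minus_one[of t] by linarith+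

lemma ball_kernel_eq_integral:
  assumes \<alpha>: "\<alpha> > -1/2"
  shows "ball_kernel \<alpha> r x y
     = ennreal (dunkl_const \<alpha> * (LINT t|sin_measure \<alpha>. (if dunkl_arg x y t < r then 1 - cos t else 0)))"
proof -
  have "ball_kernel \<alpha> r x y = (\<integral>\<^sup>+t. ennreal (dunkl_const \<alpha> * (1 - cos t)) * (if dunkl_arg x y t < r then 1 else 0) \<partial>sin_measure \<alpha>)"
    unfolding ball_kernel_eq_nn_integral by (rule nn_integral_angle_measure[OF \<alpha>]) simp
  also have "\<dots> = (\<integral>\<^sup>+t. ennreal (dunkl_const \<alpha> * (if dunkl_arg x y t < r then 1 - cos t else 0)) \<partial>sin_measure \<alpha>)"
    by (intro nn_integral_cong) auto
  also have "\<dots> = ennreal (dunkl_const \<alpha> * (LINT t|sin_measure \<alpha>. (if dunkl_arg x y t < r then 1 - cos t else 0)))"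
    by (rule integral_bounded_sin_measure[OF \<alpha>]) (auto simp: one_pm_cos)
  finally show ?thesis .
qed

text \<open>Replacing \<open>\<theta>\<close> by \<open>\<pi> - \<theta>\<close> changes the sign of \<open>x\<close> in the argument and of the cosine.\<close>

lemma ball_kernel_uminus_eq_integral:
  assumes \<alpha>: "\<alpha> > -1/2"
  shows "ball_kernel \<alpha> r (- x) y
     = ennreal (dunkl_const \<alpha> * (LINT t|sin_measure \<alpha>. (if dunkl_arg x y t < r then 1 + cos t else 0)))"
proof -
  define u where "u t = ennreal (dunkl_const \<alpha> * (1 - cos t)) * (if dunkl_arg (- x) y t < r then 1 else 0)" for t
  have [measurable]: "u \<in> borel_measurable borel" unfolding u_def by measurable
  have "dunkl_arg (- x) y (pi - t) = dunkl_arg x y t" for t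
    by (simp add: dunkl_arg_def)
  then have u: "u (pi - t) = ennreal (dunkl_const \<alpha> * (if dunkl_arg x y t < r then 1 + cos t else 0))" for t
    by (simp add: u_def)
  have "ball_kernel \<alpha> r (- x) y = (\<integral>\<^sup>+t. u t \<partial>sin_measure \<alpha>)"
    unfolding ball_kernel_eq_nn_integral u_def by (rule nn_integral_angle_measure[OF \<alpha>]) simp
  also have "\<dots> = (\<integral>\<^sup>+t. u (pi - t) \<partial>sin_measure \<alpha>)"
    by (rule nn_integral_sin_measure_reflect[symmetric]) simp
  also have "\<dots> = ennreal (dunkl_const \<alpha> * (LINT t|sin_measure \<alpha>. (if dunkl_arg x y t < r then 1 + cos t else 0)))"
    unfolding u by (rule integral_bounded_sin_measure[OF \<alpha>]) (auto simp: one_pm_cos)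
  finally show ?thesis .
qed

lemma ball_kernel_measurable:
  assumes \<alpha>: "\<alpha> \<ge> -1/2" and [measurable]: "f \<in> borel_measurable M" "g \<in> borel_measurable M" "h \<in> borel_measurable M"
  shows "(\<lambda>w. ball_kernel \<alpha> (f w) (g w) (h w)) \<in> borel_measurable M"
proof -
  interpret sigma_finite_measure "angle_measure \<alpha>" by (rule sigma_finite_angle_measure[OF \<alpha>])
  show ?thesis unfolding ball_kernel_eq_nn_integral by measurable
qed

text \<open>If \<open>1 - cos \<theta>\<close> is denoted by \<open>a\<close>, then \<open>(x,y)\<^sub>\<theta>\<^sup>2 = (x - y)\<^sup>2 + 2xya\<close>, which dominates \<open>(x + y)\<^sup>2 a\<^sup>2 / 4\<close>: the
  factor \<open>a\<close> compensates the singularity of the signed weight.\<close>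

lemma translation_weight_le:
  fixes x y :: real
  defines "A \<equiv> dunkl_arg x y"
  shows "\<bar>1 + (x + y) / A t\<bar> * (1 - cos t) \<le> 4" "\<bar>1 - (x + y) / A t\<bar> * (1 - cos t) \<le> 4"
proof -
  define a where "a = 1 - cos t"
  have a: "0 \<le> a" "a \<le> 2" unfolding a_def by (rule one_pm_cos)+
  have A2: "(A t)\<^sup>2 = (x - y)\<^sup>2 + 2 * (x * y * a)"
    unfolding A_def a_def by (simp add: dunkl_arg_square power2_diff algebra_simps)
  have asq: "a\<^sup>2 \<le> 4" using power_mono[of a 2 2] a by simp
  have "(x + y)\<^sup>2 * a\<^sup>2 \<le> 4 * (A t)\<^sup>2"
  proof (cases "x * y \<ge> 0")
    case True
    have "(x * y * a) * a \<le> (x * y * a) * 2" using True a by (intro mult_left_mono) auto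
    then have "4 * (x * y) * a\<^sup>2 \<le> 4 * (2 * (x * y * a))" by (simp add: power2_eq_square mult_ac)
    moreover have "(x - y)\<^sup>2 * a\<^sup>2 \<le> (x - y)\<^sup>2 * 4" using asq by (intro mult_left_mono) auto
    ultimately have "(x - y)\<^sup>2 * a\<^sup>2 + 4 * (x * y) * a\<^sup>2 \<le> (x - y)\<^sup>2 * 4 + 4 * (2 * (x * y * a))"
      by (rule add_mono[rotated])
    moreover have "(x + y)\<^sup>2 * a\<^sup>2 = (x - y)\<^sup>2 * a\<^sup>2 + 4 * (x * y) * a\<^sup>2"
      by (simp add: power2_sum power2_diff algebra_simps)
    ultimately show ?thesis unfolding A2 by (simp add: mult.commute)
  next
    case False
    have "(A t)\<^sup>2 = (x + y)\<^sup>2 + 2 * (- (x * y)) * (1 + cos t)"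
      unfolding A_def by (simp add: dunkl_arg_square power2_sum algebra_simps)
    moreover have "0 \<le> 2 * (- (x * y)) * (1 + cos t)"
      using False one_pm_cos[of t] by (intro mult_nonneg_nonneg) auto
    ultimately have "(x + y)\<^sup>2 \<le> (A t)\<^sup>2" by linarith
    then have "(x + y)\<^sup>2 * a\<^sup>2 \<le> (A t)\<^sup>2 * 4" using asq by (intro mult_mono) auto
    then show ?thesis by simp
  qed
  then have "(\<bar>x + y\<bar> * a)\<^sup>2 \<le> (2 * A t)\<^sup>2" by (simp add: power_mult_distrib)
  then have "\<bar>x + y\<bar> * a \<le> 2 * A t" by (rule power2_le_imp_le) (simp add: A_def)
  then have "\<bar>(x + y) / A t\<bar> * a \<le> 2"
    using dunkl_arg_nonneg[of x y t] unfolding A_def[symmetric]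
    by (cases "A t = 0") (auto simp: field_simps abs_divide)
  moreover have "\<bar>1 + (x + y) / A t\<bar> * a \<le> (1 + \<bar>(x + y) / A t\<bar>) * a"
      "\<bar>1 - (x + y) / A t\<bar> * a \<le> (1 + \<bar>(x + y) / A t\<bar>) * a"
    using a by (intro mult_right_mono; linarith)+
  ultimately show "\<bar>1 + (x + y) / A t\<bar> * (1 - cos t) \<le> 4" "\<bar>1 - (x + y) / A t\<bar> * (1 - cos t) \<le> 4"
    unfolding a_def[symmetric] using a by (auto simp: distrib_right)
qed

lemma pair_sigma_finite_dunkl_sin:
  "\<alpha> > -1/2 \<Longrightarrow> pair_sigma_finite (dunkl_borel \<alpha>) (sin_measure \<alpha>)"
  by (intro pair_sigma_finite.intro sigma_finite_dunkl_borel sigma_finite_sin_measure)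

text \<open>On \<open>B(0,r)\<close> the translation pairs \<open>g(z)\<close> with a signed weight \<open>q y z\<close>. The weights are bounded, so the
  pairing is absolutely convergent and \<open>y\<close> and \<open>z\<close> may be exchanged. For fixed \<open>z\<close> the sum of the weights
  at \<open>y = \<plusminus>(x,z)\<^sub>\<theta>\<close> is \<open>2 (1 + cos \<theta>)\<close>, which is the weight of the translation by \<open>-x\<close> on even functions.\<close>

lemma translation_duality_nonzero:
  assumes \<alpha>: "\<alpha> > -1/2" and x: "x \<noteq> 0"
    and g[measurable]: "g \<in> borel_measurable borel" and g0: "\<And>z. 0 \<le> g z"
    and fin: "(\<integral>\<^sup>+z. ennreal (g z) * indicator (ball 0 (\<bar>x\<bar> + r)) z \<partial>dunkl_borel \<alpha>) < \<infinity>"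
  shows "(LINT y:ball 0 r|dunkl_borel \<alpha>. dunkl_translation \<alpha> x g y)
    = (LINT z|dunkl_borel \<alpha>. g z * enn2real (ball_kernel \<alpha> r (- x) z))"
proof -
  let ?\<nu> = "dunkl_borel \<alpha>" and ?S = "sin_measure \<alpha>"
  interpret P: pair_sigma_finite ?\<nu> ?S by (rule pair_sigma_finite_dunkl_sin[OF \<alpha>])
  interpret S: finite_measure ?S by (rule finite_sin_measure[OF \<alpha>])
  have [measurable]: "(\<lambda>y. dunkl_translation \<alpha> x g y) \<in> borel_measurable borel"
    using measurable_compose[OF _ dunkl_translation_measurable[of \<alpha> g], of "\<lambda>y. (x, y)" borel] \<alpha> by simp
  have [measurable]: "(\<lambda>z. ball_kernel \<alpha> r (- x) z) \<in> borel_measurable borel"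
    using \<alpha> by (intro ball_kernel_measurable) auto
  define c where "c = dunkl_const \<alpha>"
  have c: "c > 0" unfolding c_def by (rule dunkl_const_pos[OF \<alpha>])
  let ?A = "dunkl_arg x"
  define q where "q y z = (1 + (x + y) / z) * ((z\<^sup>2 - (x - y)\<^sup>2) / (2 * x * y))" for y z
  define H where "H y z = (if \<bar>y\<bar> < r then g z * q y z else 0)" for y z
  have [measurable]: "(\<lambda>(y, z). H y z) \<in> borel_measurable (borel \<Otimes>\<^sub>M borel)"
    unfolding H_def q_def by measurable
  have [measurable]: "(\<lambda>(y, z). H z y) \<in> borel_measurable (borel \<Otimes>\<^sub>M borel)"
    by measurable
  have cosine: "((?A y t)\<^sup>2 - (x - y)\<^sup>2) / (2 * x * y) = (if y = 0 then 0 else 1 - cos t)" for y t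
    using x by (simp add: dunkl_arg_square power2_diff field_simps)
  define K where "K y z = ennreal (if \<bar>y\<bar> < r then 4 * g z else 0)" for y z
  have [measurable]: "(\<lambda>(y, z). K y z) \<in> borel_measurable (borel \<Otimes>\<^sub>M borel)"
    unfolding K_def by measurable
  have HK: "ennreal \<bar>H y (?A y t)\<bar> \<le> K y (?A y t)" "ennreal \<bar>H y (- ?A y t)\<bar> \<le> K y (- ?A y t)" for y t
  proof -
    have q: "\<bar>q y (?A y t)\<bar> \<le> 4" "\<bar>q y (- ?A y t)\<bar> \<le> 4"
      using translation_weight_le[of x y t] one_pm_cos(1)[of t]
      by (auto simp: q_def cosine abs_mult)
    show "ennreal \<bar>H y (?A y t)\<bar> \<le> K y (?A y t)" "ennreal \<bar>H y (- ?A y t)\<bar> \<le> K y (- ?A y t)"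
      using mult_left_mono[OF q(1) g0[of "?A y t"]] mult_left_mono[OF q(2) g0[of "- ?A y t"]] g0
      by (auto simp: H_def K_def abs_mult mult.commute intro!: ennreal_leI)
  qed
  have finK: "arg_pairing \<alpha> x K < \<infinity>"
  proof -
    have "arg_pairing \<alpha> x K = arg_pairing \<alpha> x (\<lambda>y z. K z y)"
      by (rule arg_pairing_swap[OF \<alpha> x, symmetric]) measurable
    also have "\<dots> \<le> (\<integral>\<^sup>+z. \<integral>\<^sup>+t. 8 * (ennreal (g z) * indicator (ball 0 (\<bar>x\<bar> + r)) z) \<partial>?S \<partial>?\<nu>)"
      unfolding arg_pairing_def
    proof (intro nn_integral_mono)
      fix z t
      show "K (?A z t) z + K (- ?A z t) z \<le> 8 * (ennreal (g z) * indicator (ball 0 (\<bar>x\<bar> + r)) z)"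
      proof (cases "?A z t < r")
        case True
        then have "z \<in> ball 0 (\<bar>x\<bar> + r)" using dunkl_arg_ge[of x z t] by (auto simp: dist_real_def)
        then show ?thesis using True g0[of z]
          by (simp add: K_def ennreal_mult flip: distrib_right)
      qed (simp add: K_def)
    qed
    also have "\<dots> = (\<integral>\<^sup>+z. (8 * emeasure ?S (space ?S)) * (ennreal (g z) * indicator (ball 0 (\<bar>x\<bar> + r)) z) \<partial>?\<nu>)"
      by (simp add: mult_ac)
    also have "\<dots> = (8 * emeasure ?S (space ?S)) * (\<integral>\<^sup>+z. ennreal (g z) * indicator (ball 0 (\<bar>x\<bar> + r)) z \<partial>?\<nu>)"
      by (rule nn_integral_cmult) measurable
    also have "\<dots> < \<infinity>"
    proof -
      have "emeasure ?S UNIV < top" by (simp add: less_top[symmetric])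
      then show ?thesis using fin by (simp add: ennreal_mult_less_top)
    qed
    finally show ?thesis .
  qed
  have finH: "arg_pairing \<alpha> x (\<lambda>y z. ennreal \<bar>H y z\<bar>) < \<infinity>"
  proof -
    have "arg_pairing \<alpha> x (\<lambda>y z. ennreal \<bar>H y z\<bar>) \<le> arg_pairing \<alpha> x K"
      unfolding arg_pairing_def by (intro nn_integral_mono add_mono HK)
    then show ?thesis using finK by (rule order_le_less_trans)
  qed
  have finH': "arg_pairing \<alpha> x (\<lambda>y z. ennreal \<bar>H z y\<bar>) < \<infinity>"
    using finH arg_pairing_swap[OF \<alpha> x, of "\<lambda>y z. ennreal \<bar>H y z\<bar>"] by simp
  have swap: "(LINT (y, t)|(?\<nu> \<Otimes>\<^sub>M ?S). H y (?A y t) + H y (- ?A y t))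
      = (LINT (y, t)|(?\<nu> \<Otimes>\<^sub>M ?S). H (?A y t) y + H (- ?A y t) y)"
    using arg_pairing_swap[OF \<alpha> x, of "\<lambda>y z. ennreal (H y z)"] arg_pairing_swap[OF \<alpha> x, of "\<lambda>y z. ennreal (- H y z)"]
    by (simp add: integral_arg_pairing[OF \<alpha> _ finH] integral_arg_pairing[OF \<alpha> _ finH'])
  have ae0: "AE y in ?\<nu>. y \<noteq> 0 \<and> y \<noteq> x \<and> y \<noteq> - x"
    using \<alpha> by (subst AE_dunkl_borel_iff) (auto intro!: AE_conjI AE_lborel_singleton)
  have left: "c / 2 * (LINT (y, t)|(?\<nu> \<Otimes>\<^sub>M ?S). H y (?A y t) + H y (- ?A y t))
      = (LINT y:ball 0 r|?\<nu>. dunkl_translation \<alpha> x g y)"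
  proof -
    have "(LINT (y, t)|(?\<nu> \<Otimes>\<^sub>M ?S). H y (?A y t) + H y (- ?A y t))
        = (LINT y|?\<nu>. LINT t|?S. H y (?A y t) + H y (- ?A y t))"
      using P.integral_fst'[OF integrable_arg_pairing[OF \<alpha> _ finH]] by simp
    then have "c / 2 * (LINT (y, t)|(?\<nu> \<Otimes>\<^sub>M ?S). H y (?A y t) + H y (- ?A y t))
        = (LINT y|?\<nu>. c / 2 * (LINT t|?S. H y (?A y t) + H y (- ?A y t)))" by simp
    also have "\<dots> = (LINT y|?\<nu>. indicator (ball 0 r) y *\<^sub>R dunkl_translation \<alpha> x g y)"
    proof (rule integral_cong_AE)
      show "AE y in ?\<nu>. c / 2 * (LINT t|?S. H y (?A y t) + H y (- ?A y t))
          = indicator (ball 0 r) y *\<^sub>R dunkl_translation \<alpha> x g y"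
        using ae0
      proof eventually_elim
        case (elim y)
        have "H y (?A y t) + H y (- ?A y t) = (g (?A y t) + g (- ?A y t)
            + (x + y) / ?A y t * (g (?A y t) - g (- ?A y t))) * (1 - cos t)" if "\<bar>y\<bar> < r" for t
        proof -
          define v where "v = (x + y) / ?A y t"
          have qe: "q y (?A y t) = (1 + v) * (1 - cos t)" "q y (- ?A y t) = (1 - v) * (1 - cos t)"
            using elim by (simp_all add: q_def cosine v_def)
          then show ?thesis using that unfolding H_def v_def[symmetric] qe by (simp add: algebra_simps)
        qed
        then show ?case
          unfolding dunkl_translation_eq[OF \<alpha> g] c_def
          by (cases "\<bar>y\<bar> < r") (simp_all add: H_def)
      qed
    qed measurable
    finally show ?thesis unfolding set_lebesgue_integral_def .
  qed
  have right: "c / 2 * (LINT (y, t)|(?\<nu> \<Otimes>\<^sub>M ?S). H (?A y t) y + H (- ?A y t) y)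
      = (LINT z|?\<nu>. g z * enn2real (ball_kernel \<alpha> r (- x) z))"
  proof -
    have "(LINT (y, t)|(?\<nu> \<Otimes>\<^sub>M ?S). H (?A y t) y + H (- ?A y t) y)
        = (LINT z|?\<nu>. LINT t|?S. H (?A z t) z + H (- ?A z t) z)"
      using P.integral_fst'[OF integrable_arg_pairing[OF \<alpha> _ finH']] by simp
    then have "c / 2 * (LINT (y, t)|(?\<nu> \<Otimes>\<^sub>M ?S). H (?A y t) y + H (- ?A y t) y)
        = (LINT z|?\<nu>. c / 2 * (LINT t|?S. H (?A z t) z + H (- ?A z t) z))" by simp
    also have "\<dots> = (LINT z|?\<nu>. g z * enn2real (ball_kernel \<alpha> r (- x) z))"
    proof (rule integral_cong_AE)
      show "AE z in ?\<nu>. c / 2 * (LINT t|?S. H (?A z t) z + H (- ?A z t) z)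
          = g z * enn2real (ball_kernel \<alpha> r (- x) z)"
        using ae0
      proof eventually_elim
        case (elim z)
        have A: "?A z t > 0" for t using elim by (intro dunkl_arg_pos) (auto simp: abs_eq_iff)
        \<comment> \<open>The odd part in \<open>a\<close> of the weight cancels and the law of cosines simplifies the rest.\<close>
        have q: "q (?A z t) z + q (- ?A z t) z = 2 * (1 + cos t)" for t
        proof -
          define a where "a = ?A z t"
          have a: "a \<noteq> 0" using A[of t] by (simp add: a_def)
          have "q a z + q (- a) z = ((x + z)\<^sup>2 - a\<^sup>2) / (x * z)"
            unfolding q_def using a x elim by (simp add: field_simps power2_eq_square)
          also have "\<dots> = 2 * (1 + cos t)"
            unfolding a_def dunkl_arg_square using x elim by (simp add: field_simps power2_eq_square)
          finally show ?thesis by (simp add: a_def)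
        qed
        have "H (?A z t) z + H (- ?A z t) z = 2 * g z * (if ?A z t < r then 1 + cos t else 0)" for t
          using q[of t] A[of t] unfolding H_def by (simp flip: distrib_left)
        then have "c / 2 * (LINT t|?S. H (?A z t) z + H (- ?A z t) z)
          = g z * (c * (LINT t|?S. (if ?A z t < r then 1 + cos t else 0)))"
          by simp
        also have "c * (LINT t|?S. (if ?A z t < r then 1 + cos t else 0)) = enn2real (ball_kernel \<alpha> r (- x) z)"
          unfolding ball_kernel_uminus_eq_integral[OF \<alpha>] c_def[symmetric] using c
          by (subst enn2real_ennreal) (auto intro!: mult_nonneg_nonneg Bochner_Integration.integral_nonneg simp: one_pm_cos)
        finally show ?case .
      qed
    qed measurable
    finally show ?thesis .
  qed
  show ?thesis using left right swap by simp
qed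


lemma ball_kernel_le_mass:
  assumes \<alpha>: "\<alpha> \<ge> -1/2"
  shows "ball_kernel \<alpha> r x z \<le> emeasure (angle_measure \<alpha>) UNIV * indicator (ball 0 (\<bar>x\<bar> + r)) z"
proof (cases "z \<in> ball 0 (\<bar>x\<bar> + r)")
  case True
  then show ?thesis
    unfolding ball_kernel_def by (simp add: emeasure_mono)
next
  case False
  then have "\<not> dunkl_arg x z t < r" for t
    using dunkl_arg_ge[of x z t] by (auto simp: dist_real_def)
  then show ?thesis by (simp add: ball_kernel_def)
qed

text \<open>At \<open>x = 0\<close> the translation is multiplication by the total mass of the angular measure; for \<open>\<alpha> = -1/2\<close> the
  identity is the translation invariance of Lebesgue measure.\<close>

lemma translation_duality:
  assumes \<alpha>: "\<alpha> \<ge> -1/2" and r: "r > 0"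
    and g[measurable]: "g \<in> borel_measurable borel" and g0: "\<And>z. 0 \<le> g z"
    and fin: "(\<integral>\<^sup>+z. ennreal (g z) * indicator (ball 0 (\<bar>x\<bar> + r)) z \<partial>dunkl_borel \<alpha>) < \<infinity>"
  shows "(LINT y:ball 0 r|dunkl_borel \<alpha>. dunkl_translation \<alpha> x g y)
    = (LINT z|dunkl_borel \<alpha>. g z * enn2real (ball_kernel \<alpha> r (- x) z))"
proof (cases "\<alpha> = -1/2")
  case True
  define a where "a = dunkl_weight \<alpha>"
  have a: "a > 0" unfolding a_def by (rule dunkl_weight_pos[OF \<alpha>])
  have dens: "(LINT y|dunkl_borel \<alpha>. u y) = (LINT y|lborel. a * u y)"
    if [measurable]: "u \<in> borel_measurable borel" for u :: "real \<Rightarrow> real"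
  proof -
    have "(LINT y|dunkl_borel \<alpha>. u y) = (LINT y|lborel. (a * \<bar>y\<bar> powr (2 * \<alpha> + 1)) *\<^sub>R u y)"
      unfolding dunkl_borel_def a_def[symmetric] by (rule integral_density) (use a in auto)
    also have "\<dots> = (LINT y|lborel. a * u y)"
    proof (rule integral_cong_AE)
      have "AE y in lborel. y \<noteq> (0::real)" by (rule AE_lborel_singleton)
      then show "AE y in lborel. (a * \<bar>y\<bar> powr (2 * \<alpha> + 1)) *\<^sub>R u y = a * u y"
        by eventually_elim (simp add: True)
    qed measurable
    finally show ?thesis .
  qed
  have "(LINT y:ball 0 r|dunkl_borel \<alpha>. dunkl_translation \<alpha> x g y)
      = (LINT y|lborel. a * (indicator (ball 0 r) y * g (x + y)))"
    unfolding set_lebesgue_integral_def using True by (subst dens) (simp_all add: dunkl_translation_def)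
  also have "\<dots> = (LINT y|lborel. a * (g (x + y) * enn2real (indicator {..<r} \<bar>- x + (x + y)\<bar>)))"
    by (intro Bochner_Integration.integral_cong refl) (auto simp: indicator_def dist_real_def)
  also have "\<dots> = (LINT z|lborel. a * (g z * enn2real (indicator {..<r} \<bar>- x + z\<bar>)))"
    using lborel_integral_real_affine[of 1 "\<lambda>z. a * (g z * enn2real (indicator {..<r} \<bar>- x + z\<bar>))" x]
    by auto
  also have "\<dots> = (LINT z|dunkl_borel \<alpha>. g z * enn2real (ball_kernel \<alpha> r (- x) z))"
    unfolding True ball_kernel_half unfolding True[symmetric]
    by (subst dens) measurable
  finally show ?thesis .
next
  case False
  then have a: "\<alpha> > -1/2" using \<alpha> by simp
  show ?thesis
  proof (cases "x = 0")
    case x: False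
    show ?thesis by (rule translation_duality_nonzero[OF a x g g0 fin])
  next
    case True
    let ?\<nu> = "dunkl_borel \<alpha>" and ?S = "sin_measure \<alpha>"
      have [measurable]: "(\<lambda>y. dunkl_translation \<alpha> x g y) \<in> borel_measurable borel"
      using measurable_compose[OF _ dunkl_translation_measurable[of \<alpha> g], of "\<lambda>y. (x, y)" borel] \<alpha> by simp
    have [measurable]: "(\<lambda>z. ball_kernel \<alpha> r (- x) z) \<in> borel_measurable borel"
      using \<alpha> by (intro ball_kernel_measurable) auto
    have "(LINT y|?\<nu>. indicator (ball 0 r) y *\<^sub>R dunkl_translation \<alpha> x g y)
      = (LINT z|?\<nu>. g z * enn2real (ball_kernel \<alpha> r (- x) z))"
    proof (rule integral_cong_AE)
      show "AE y in ?\<nu>. indicator (ball 0 r) y *\<^sub>R dunkl_translation \<alpha> x g y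
          = g y * enn2real (ball_kernel \<alpha> r (- x) y)"
      proof -
        have "AE y in ?\<nu>. y \<noteq> 0" using \<alpha> by (subst AE_dunkl_borel_iff) (auto intro: AE_lborel_singleton)
        then show ?thesis
        proof eventually_elim
          case (elim y)
          have A: "dunkl_arg x y t = \<bar>y\<bar>" for t using True by (simp add: dunkl_arg_def)
          have "(g \<bar>y\<bar> + g (- \<bar>y\<bar>) + (x + y) / \<bar>y\<bar> * (g \<bar>y\<bar> - g (- \<bar>y\<bar>))) = 2 * g y"
            using True elim by (cases "y > 0") (auto simp: abs_if)
          then have tau: "dunkl_translation \<alpha> x g y = g y * (dunkl_const \<alpha> * (LINT t|?S. 1 - cos t))"
            unfolding dunkl_translation_eq[OF a g] A by simp
          have ker: "ball_kernel \<alpha> r (- x) y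
              = ennreal (dunkl_const \<alpha> * (LINT t|?S. (if \<bar>y\<bar> < r then 1 - cos t else 0)))"
            using ball_kernel_eq_integral[OF a, of r x y] unfolding A by (simp add: True)
          have "0 \<le> dunkl_const \<alpha> * (LINT t|?S. 1 - cos t)"
            using dunkl_const_pos[OF a]
            by (intro mult_nonneg_nonneg Bochner_Integration.integral_nonneg) (auto simp: one_pm_cos)
          then show ?case unfolding tau ker by (cases "\<bar>y\<bar> < r") auto
        qed
      qed
    qed measurable
    then show ?thesis by (simp add: set_lebesgue_integral_def)
  qed
qed

lemma ball_integral_translation:
  assumes \<alpha>: "\<alpha> \<ge> -1/2" and r: "r > 0"
    and g'[measurable]: "g' \<in> borel_measurable borel" and g0: "\<And>z. 0 \<le> g' z"
    and ae: "AE z in lborel. g z = g' z"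
    and fin: "\<And>R. (\<integral>\<^sup>+z. ennreal (g' z) * indicator (ball 0 R) z \<partial>dunkl_borel \<alpha>) < \<infinity>"
  shows "0 \<le> (LINT y:ball 0 r|dunkl_measure \<alpha>. dunkl_translation \<alpha> x g y)"
    and "ennreal (LINT y:ball 0 r|dunkl_measure \<alpha>. dunkl_translation \<alpha> x g y)
      = (\<integral>\<^sup>+z. ennreal (g' z) * ball_kernel \<alpha> r (- x) z \<partial>dunkl_borel \<alpha>)"
proof -
  let ?\<nu> = "dunkl_borel \<alpha>"
  interpret F: finite_measure "angle_measure \<alpha>" by (rule finite_angle_measure[OF \<alpha>])
  have [measurable]: "(\<lambda>y. dunkl_translation \<alpha> x g' y) \<in> borel_measurable borel"
    using measurable_compose[OF _ dunkl_translation_measurable[of \<alpha> g'], of "\<lambda>y. (x, y)" borel] \<alpha> by simp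
  have [measurable]: "(\<lambda>z. ball_kernel \<alpha> r (- x) z) \<in> borel_measurable borel"
    using \<alpha> by (intro ball_kernel_measurable) auto
  let ?k = "\<lambda>z. g' z * enn2real (ball_kernel \<alpha> r (- x) z)"
  have ae': "AE y in dunkl_measure \<alpha>. dunkl_translation \<alpha> x g y = dunkl_translation \<alpha> x g' y"
    using dunkl_translation_cong_AE[OF ae] \<alpha> by (simp add: AE_dunkl_measure_iff)
  have "(LINT y:ball 0 r|dunkl_measure \<alpha>. dunkl_translation \<alpha> x g y)
      = (LINT y:ball 0 r|dunkl_measure \<alpha>. dunkl_translation \<alpha> x g' y)"
    unfolding set_lebesgue_integral_def dunkl_measure_eq_completion[OF \<alpha>]
  proof (rule completion.integral_cong_AE_complete)
    show "AE y in completion ?\<nu>. indicator (ball 0 r) y *\<^sub>R dunkl_translation \<alpha> x g y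
        = indicator (ball 0 r) y *\<^sub>R dunkl_translation \<alpha> x g' y"
      using ae' unfolding dunkl_measure_eq_completion[OF \<alpha>] by eventually_elim simp
  qed
  also have "\<dots> = (LINT y:ball 0 r|?\<nu>. dunkl_translation \<alpha> x g' y)"
    unfolding set_lebesgue_integral_def dunkl_measure_eq_completion[OF \<alpha>]
    by (rule integral_completion) measurable
  also have "\<dots> = integral\<^sup>L ?\<nu> ?k"
    by (rule translation_duality[OF \<alpha> r g' g0 fin])
  finally have eq: "(LINT y:ball 0 r|dunkl_measure \<alpha>. dunkl_translation \<alpha> x g y) = integral\<^sup>L ?\<nu> ?k" .
  have kfin: "ball_kernel \<alpha> r (- x) z < \<infinity>" for z
    unfolding ball_kernel_def using F.emeasure_finite by (simp add: less_top[symmetric])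
  have k: "ennreal (?k z) = ennreal (g' z) * ball_kernel \<alpha> r (- x) z" for z
    using kfin[of z] g0[of z] by (simp add: ennreal_mult)
  have "(\<integral>\<^sup>+z. ennreal (?k z) \<partial>?\<nu>)
      \<le> (\<integral>\<^sup>+z. emeasure (angle_measure \<alpha>) UNIV * (ennreal (g' z) * indicator (ball 0 (\<bar>x\<bar> + r)) z) \<partial>?\<nu>)"
    unfolding k
  proof (intro nn_integral_mono)
    fix z
    show "ennreal (g' z) * ball_kernel \<alpha> r (- x) z
        \<le> emeasure (angle_measure \<alpha>) UNIV * (ennreal (g' z) * indicator (ball 0 (\<bar>x\<bar> + r)) z)"
      using mult_left_mono[OF ball_kernel_le_mass[OF \<alpha>, of r "- x" z], of "ennreal (g' z)"]
      by (simp add: mult_ac)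
  qed
  also have "\<dots> = emeasure (angle_measure \<alpha>) UNIV * (\<integral>\<^sup>+z. ennreal (g' z) * indicator (ball 0 (\<bar>x\<bar> + r)) z \<partial>?\<nu>)"
    by (rule nn_integral_cmult) measurable
  also have "\<dots> < \<infinity>"
  proof -
    have "emeasure (angle_measure \<alpha>) UNIV < top" by (simp add: less_top[symmetric])
    then show ?thesis using fin by (simp add: ennreal_mult_less_top)
  qed
  finally have "integrable ?\<nu> ?k"
    using g0 by (intro integrableI_nonneg) auto
  from nn_integral_eq_integral[OF this]
  show "ennreal (LINT y:ball 0 r|dunkl_measure \<alpha>. dunkl_translation \<alpha> x g y)
      = (\<integral>\<^sup>+z. ennreal (g' z) * ball_kernel \<alpha> r (- x) z \<partial>?\<nu>)"
    unfolding eq using g0 by (simp add: k)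
  show "0 \<le> (LINT y:ball 0 r|dunkl_measure \<alpha>. dunkl_translation \<alpha> x g y)"
    unfolding eq using g0 by (intro Bochner_Integration.integral_nonneg) auto
qed

section \<open>Translates of even kernels\<close>

text \<open>The signed part of the translation cancels on even functions.\<close>

lemma translation_even_le:
  assumes \<alpha>: "\<alpha> \<ge> -1/2" and [measurable]: "k \<in> borel_measurable borel"
    and k0: "\<And>z. 0 \<le> k z" and even: "\<And>z. k (- z) = k z"
  shows "ennreal \<bar>dunkl_translation \<alpha> x k y\<bar> \<le> (\<integral>\<^sup>+t. ennreal (k (dunkl_arg x y t)) \<partial>angle_measure \<alpha>)"
proof (cases "\<alpha> = -1/2")
  case True
  have "dunkl_arg x y pi = sqrt ((x + y)\<^sup>2)"
    unfolding dunkl_arg_def by (simp add: power2_sum)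
  then have "k (dunkl_arg x y pi) = k (x + y)" using even[of "x + y"] by (auto simp: abs_if)
  then show ?thesis using True k0
    by (simp add: dunkl_translation_def angle_measure_def nn_integral_distr nn_integral_count_space_finite)
next
  case False
  then have a: "\<alpha> > -1/2" using \<alpha> by simp
  let ?S = "sin_measure \<alpha>"
  define F where "F t = dunkl_const \<alpha> * (1 - cos t) * k (dunkl_arg x y t)" for t
  have [measurable]: "F \<in> borel_measurable borel" unfolding F_def by measurable
  have F0: "0 \<le> F t" for t using k0 dunkl_const_pos[OF a] by (simp add: F_def one_pm_cos)
  have "dunkl_translation \<alpha> x k y = (LINT t|?S. F t)"
  proof -
    have "dunkl_translation \<alpha> x k y = (LINT t|?S. dunkl_const \<alpha> / 2 * ((k (dunkl_arg x y t) + k (- dunkl_arg x y t)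
       + (x + y) / dunkl_arg x y t * (k (dunkl_arg x y t) - k (- dunkl_arg x y t))) * (1 - cos t)))"
      by (subst dunkl_translation_eq[OF a]) auto
    also have "\<dots> = (LINT t|?S. F t)"
      by (intro Bochner_Integration.integral_cong refl) (simp add: F_def even)
    finally show ?thesis .
  qed
  moreover have "0 \<le> (LINT t|?S. F t)" using F0 by (intro Bochner_Integration.integral_nonneg) auto
  moreover have "ennreal (LINT t|?S. F t) \<le> (\<integral>\<^sup>+t. ennreal (F t) \<partial>?S)"
  proof (cases "integrable ?S F")
    case True
    then show ?thesis using F0 by (simp add: nn_integral_eq_integral)
  qed (simp add: not_integrable_integral_eq)
  moreover have "(\<integral>\<^sup>+t. ennreal (F t) \<partial>?S) = (\<integral>\<^sup>+t. ennreal (k (dunkl_arg x y t)) \<partial>angle_measure \<alpha>)"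
    using k0 dunkl_const_pos[OF a]
    by (subst nn_integral_angle_measure[OF a])
       (auto simp: F_def one_pm_cos ennreal_mult intro!: nn_integral_cong)
  ultimately show ?thesis by simp
qed

lemma translation_le_ball_kernels:
  assumes \<alpha>: "\<alpha> \<ge> -1/2" and [measurable]: "k \<in> borel_measurable borel" "w \<in> borel_measurable borel"
    and k0: "\<And>z. 0 \<le> k z" and even: "\<And>z. k (- z) = k z"
    and kw: "\<And>z. ennreal (k z) \<le> (\<integral>\<^sup>+s. w s * (if \<bar>z\<bar> < s then 1 else 0) \<partial>lborel)"
  shows "ennreal \<bar>dunkl_translation \<alpha> x k y\<bar> \<le> (\<integral>\<^sup>+s. w s * ball_kernel \<alpha> s x y \<partial>lborel)"
proof -
  interpret A: sigma_finite_measure "angle_measure \<alpha>" by (rule sigma_finite_angle_measure[OF \<alpha>])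
  interpret P: pair_sigma_finite lborel "angle_measure \<alpha>" by standard
  have "ennreal \<bar>dunkl_translation \<alpha> x k y\<bar> \<le> (\<integral>\<^sup>+t. ennreal (k (dunkl_arg x y t)) \<partial>angle_measure \<alpha>)"
    using \<alpha> k0 even by (intro translation_even_le) auto
  also have "\<dots> \<le> (\<integral>\<^sup>+t. \<integral>\<^sup>+s. w s * (if dunkl_arg x y t < s then 1 else 0) \<partial>lborel \<partial>angle_measure \<alpha>)"
  proof (intro nn_integral_mono)
    fix t
    show "ennreal (k (dunkl_arg x y t)) \<le> (\<integral>\<^sup>+s. w s * (if dunkl_arg x y t < s then 1 else 0) \<partial>lborel)"
      using kw[of "dunkl_arg x y t"] by simp
  qed
  also have "\<dots> = (\<integral>\<^sup>+s. \<integral>\<^sup>+t. w s * (if dunkl_arg x y t < s then 1 else 0) \<partial>angle_measure \<alpha> \<partial>lborel)"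
    by (rule P.Fubini') measurable
  also have "\<dots> = (\<integral>\<^sup>+s. w s * ball_kernel \<alpha> s x y \<partial>lborel)"
    unfolding ball_kernel_eq_nn_integral by (intro nn_integral_cong nn_integral_cmult) measurable
  finally show ?thesis .
qed

section \<open>The maximal function\<close>

text \<open>Up to constants, the measure of the ball with centre \<open>x\<close> and radius \<open>r\<close>.\<close>

definition dunkl_vol :: "real \<Rightarrow> real \<Rightarrow> real \<Rightarrow> real" where
  "dunkl_vol \<alpha> x r = r * (\<bar>x\<bar> + r) powr (2 * \<alpha> + 1)"

lemma dunkl_vol_pos: "r > 0 \<Longrightarrow> dunkl_vol \<alpha> x r > 0"
  by (simp add: dunkl_vol_def)

lemma dunkl_vol_minus [simp]: "dunkl_vol \<alpha> (- x) r = dunkl_vol \<alpha> x r"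
  by (simp add: dunkl_vol_def)

lemma dunkl_vol_scale:
  assumes "\<alpha> \<ge> -1/2" "r > 0" "s \<ge> 1"
  shows "dunkl_vol \<alpha> x (s * r) \<le> s powr (2 * \<alpha> + 2) * dunkl_vol \<alpha> x r"
proof -
  have "\<bar>x\<bar> * 1 \<le> \<bar>x\<bar> * s" using assms by (intro mult_left_mono) auto
  then have "\<bar>x\<bar> + s * r \<le> s * (\<bar>x\<bar> + r)" by (simp add: algebra_simps)
  then have "(\<bar>x\<bar> + s * r) powr (2 * \<alpha> + 1) \<le> (s * (\<bar>x\<bar> + r)) powr (2 * \<alpha> + 1)"
    using assms by (intro powr_mono2) auto
  also have "\<dots> = s powr (2 * \<alpha> + 1) * (\<bar>x\<bar> + r) powr (2 * \<alpha> + 1)" by (rule powr_mult)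
  finally have "s * r * (\<bar>x\<bar> + s * r) powr (2 * \<alpha> + 1) \<le> s * r * (s powr (2 * \<alpha> + 1) * (\<bar>x\<bar> + r) powr (2 * \<alpha> + 1))"
    using assms by (intro mult_left_mono) auto
  moreover have "s powr (2 * \<alpha> + 2) = s * s powr (2 * \<alpha> + 1)"
    using assms powr_add[of s 1 "2 * \<alpha> + 1"] by (simp add: add_ac)
  ultimately show ?thesis unfolding dunkl_vol_def by (simp add: mult_ac)
qed

lemma emeasure_dunkl_ball_le:
  assumes \<alpha>: "\<alpha> \<ge> -1/2"
  obtains C where "C > 0" "\<And>x r. r > 0 \<Longrightarrow> emeasure (dunkl_borel \<alpha>) (ball x r) \<le> ennreal (C * dunkl_vol \<alpha> x r)"
proof -
  define a where "a = dunkl_weight \<alpha>"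
  have a: "a > 0" unfolding a_def by (rule dunkl_weight_pos[OF \<alpha>])
  have "emeasure (dunkl_borel \<alpha>) (ball x r) \<le> ennreal (2 * a * dunkl_vol \<alpha> x r)" if r: "r > 0" for x r :: real
  proof -
    have "emeasure (dunkl_borel \<alpha>) (ball x r) = (\<integral>\<^sup>+y. indicator (ball x r) y \<partial>dunkl_borel \<alpha>)"
      by simp
    also have "\<dots> = (\<integral>\<^sup>+y. ennreal (a * \<bar>y\<bar> powr (2 * \<alpha> + 1)) * indicator (ball x r) y \<partial>lborel)"
      unfolding a_def by (rule nn_integral_dunkl_borel) measurable
    also have "\<dots> \<le> (\<integral>\<^sup>+y. ennreal (a * (\<bar>x\<bar> + r) powr (2 * \<alpha> + 1)) * indicator (ball x r) y \<partial>lborel)"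
    proof (intro nn_integral_mono)
      fix y
      show "ennreal (a * \<bar>y\<bar> powr (2 * \<alpha> + 1)) * indicator (ball x r) y
        \<le> ennreal (a * (\<bar>x\<bar> + r) powr (2 * \<alpha> + 1)) * indicator (ball x r) y"
      proof (cases "y \<in> ball x r")
        case True
        then have "\<bar>y\<bar> \<le> \<bar>x\<bar> + r" by (auto simp: dist_real_def)
        then have "\<bar>y\<bar> powr (2 * \<alpha> + 1) \<le> (\<bar>x\<bar> + r) powr (2 * \<alpha> + 1)" using \<alpha> by (intro powr_mono2) auto
        then show ?thesis using True a by (simp add: ennreal_leI)
      qed simp
    qed
    also have "\<dots> = ennreal (a * (\<bar>x\<bar> + r) powr (2 * \<alpha> + 1)) * emeasure lborel (ball x r)"
      by (rule nn_integral_cmult_indicator) simp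
    also have "emeasure lborel (ball x r) = ennreal (2 * r)"
      using r by (simp add: ball_eq_greaterThanLessThan)
    also have "ennreal (a * (\<bar>x\<bar> + r) powr (2 * \<alpha> + 1)) * ennreal (2 * r) = ennreal (2 * a * dunkl_vol \<alpha> x r)"
      using a r by (simp add: dunkl_vol_def mult_ac flip: ennreal_mult)
    finally show ?thesis .
  qed
  then show ?thesis using that[of "2 * a"] a by simp
qed

abbreviation ball_integral :: "real \<Rightarrow> (real \<Rightarrow> ennreal) \<Rightarrow> real \<Rightarrow> real \<Rightarrow> ennreal" where
  "ball_integral \<alpha> h x r \<equiv> (\<integral>\<^sup>+y. (if \<bar>y - x\<bar> < r then h y else 0) \<partial>dunkl_borel \<alpha>)"

definition ball_mean :: "real \<Rightarrow> (real \<Rightarrow> ennreal) \<Rightarrow> real \<Rightarrow> real \<Rightarrow> ennreal" where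
  "ball_mean \<alpha> h x r =
     ennreal (1 / dunkl_vol \<alpha> x r) * ball_integral \<alpha> h x r"

text \<open>Radii that are powers of two suffice up to a constant, and they make the supremum countable.\<close>

definition dyadic_maximal :: "real \<Rightarrow> (real \<Rightarrow> ennreal) \<Rightarrow> real \<Rightarrow> ennreal" where
  "dyadic_maximal \<alpha> h x = (SUP j::int. ball_mean \<alpha> h x (2 powr j))"

lemma ball_mean_measurable [measurable (raw)]:
  assumes [measurable]: "h \<in> borel_measurable borel" "f \<in> borel_measurable M" "g \<in> borel_measurable M"
  shows "(\<lambda>w. ball_mean \<alpha> h (f w) (g w)) \<in> borel_measurable M"
proof -
  interpret sigma_finite_measure "dunkl_borel \<alpha>" by (rule sigma_finite_dunkl_borel)
  show ?thesis unfolding ball_mean_def dunkl_vol_def by measurable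
qed

lemma dyadic_maximal_measurable [measurable]:
  assumes [measurable]: "h \<in> borel_measurable borel"
  shows "dyadic_maximal \<alpha> h \<in> borel_measurable borel"
  unfolding dyadic_maximal_def by measurable

lemma ball_mean_mono:
  assumes "\<And>y. \<bar>y - x\<bar> < r \<Longrightarrow> h y \<le> k y"
  shows "ball_mean \<alpha> h x r \<le> ball_mean \<alpha> k x r"
  unfolding ball_mean_def by (intro mult_left_mono nn_integral_mono) (use assms in auto)

lemma ball_integral_eq_ball_mean:
  assumes "r > 0"
  shows "ball_integral \<alpha> h x r = ennreal (dunkl_vol \<alpha> x r) * ball_mean \<alpha> h x r"
proof -
  have "ennreal (dunkl_vol \<alpha> x r) * ennreal (1 / dunkl_vol \<alpha> x r) = 1"
    using dunkl_vol_pos[OF assms, of \<alpha> x] by (simp flip: ennreal_mult)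
  then show ?thesis unfolding ball_mean_def by (simp flip: mult.assoc)
qed

lemma ball_mean_le_iff:
  assumes "r > 0" "c \<ge> 0"
  shows "ball_mean \<alpha> h x r \<le> ennreal c
    \<longleftrightarrow> ball_integral \<alpha> h x r \<le> ennreal (c * dunkl_vol \<alpha> x r)"
proof -
  let ?V = "dunkl_vol \<alpha> x r"
  have V: "?V > 0" by (rule dunkl_vol_pos[OF assms(1)])
  have eq: "ennreal (c * ?V) = ennreal ?V * ennreal c"
    using V assms by (simp add: mult.commute flip: ennreal_mult)
  show ?thesis
    unfolding ball_integral_eq_ball_mean[OF assms(1)] eq
    using V by (subst ennreal_mult_le_mult_iff) auto
qed

text \<open>For radii at most \<open>2\<^sup>J\<close>, Vitali's lemma selects disjoint balls on which the mean of \<open>h\<close> exceeds \<open>l\<close> and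
  whose fivefold enlargements cover the level set. The bound does not depend on \<open>J\<close>.\<close>

lemma weak_type_maximal:
  assumes \<alpha>: "\<alpha> \<ge> -1/2"
  obtains C where "C > 0"
    "\<And>h l. h \<in> borel_measurable borel \<Longrightarrow> l > 0 \<Longrightarrow>
       emeasure (dunkl_borel \<alpha>) {x. ennreal l < dyadic_maximal \<alpha> h x}
         \<le> ennreal (C / l) * (\<integral>\<^sup>+y. h y \<partial>dunkl_borel \<alpha>)"
proof -
  let ?\<nu> = "dunkl_borel \<alpha>"
  obtain C1 where C1: "C1 > 0" "\<And>x r. r > 0 \<Longrightarrow> emeasure ?\<nu> (ball x r) \<le> ennreal (C1 * dunkl_vol \<alpha> x r)"
    using emeasure_dunkl_ball_le[OF \<alpha>] by blast
  define C where "C = C1 * 5 powr (2 * \<alpha> + 2)"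
  have C: "C > 0" using C1 by (simp add: C_def)
  have five: "emeasure ?\<nu> (ball x (5 * r)) \<le> ennreal (C * dunkl_vol \<alpha> x r)" if "r > 0" for x r
  proof -
    have "emeasure ?\<nu> (ball x (5 * r)) \<le> ennreal (C1 * dunkl_vol \<alpha> x (5 * r))" using C1 that by simp
    also have "\<dots> \<le> ennreal (C * dunkl_vol \<alpha> x r)"
      using dunkl_vol_scale[OF \<alpha> that, of 5 x] C1 unfolding C_def
      by (intro ennreal_leI) (simp add: mult.assoc)
    finally show ?thesis .
  qed
  have "emeasure ?\<nu> {x. ennreal l < dyadic_maximal \<alpha> h x} \<le> ennreal (C / l) * (\<integral>\<^sup>+y. h y \<partial>?\<nu>)"
    if h[measurable]: "h \<in> borel_measurable borel" and l: "l > 0" for h and l :: real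
  proof -
    define E where "E J = {x. \<exists>j::int\<in>{..int J}. ennreal l < ball_mean \<alpha> h x (2 powr j)}" for J :: nat
    have E_meas [measurable]: "E J \<in> sets borel" for J unfolding E_def by measurable
    have union: "{x. ennreal l < dyadic_maximal \<alpha> h x} = (\<Union>J. E J)"
    proof (intro set_eqI iffI)
      fix x assume "x \<in> {x. ennreal l < dyadic_maximal \<alpha> h x}"
      then obtain j :: int where j: "ennreal l < ball_mean \<alpha> h x (2 powr j)"
        unfolding dyadic_maximal_def by (auto simp: less_SUP_iff)
      have "j \<le> int (nat j)" by simp
      then have "x \<in> E (nat j)" using j unfolding E_def by blast
      then show "x \<in> (\<Union>J. E J)" by blast
    next
      fix x assume "x \<in> (\<Union>J. E J)"
      then show "x \<in> {x. ennreal l < dyadic_maximal \<alpha> h x}"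
        unfolding dyadic_maximal_def E_def by (auto simp: less_SUP_iff)
    qed
    have inc: "incseq E"
    proof (rule incseq_SucI, rule subsetI)
      fix J x assume "x \<in> E J"
      then show "x \<in> E (Suc J)" unfolding E_def by auto
    qed
    have bound: "emeasure ?\<nu> (E J) \<le> ennreal (C / l) * (\<integral>\<^sup>+y. h y \<partial>?\<nu>)" for J
    proof -
      have "\<forall>x\<in>E J. \<exists>r. 0 < r \<and> r \<le> 2 powr J \<and> ennreal l < ball_mean \<alpha> h x r"
      proof
        fix x assume "x \<in> E J"
        then obtain j :: int where j: "j \<le> int J" "ennreal l < ball_mean \<alpha> h x (2 powr j)"
          unfolding E_def by blast
        have "(2::real) powr j \<le> 2 powr J" using j(1) by (intro powr_mono) auto
        then show "\<exists>r. 0 < r \<and> r \<le> 2 powr J \<and> ennreal l < ball_mean \<alpha> h x r"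
          using j(2) by (intro exI[of _ "2 powr j"]) simp
      qed
      then obtain R where R: "\<And>x. x \<in> E J \<Longrightarrow> 0 < R x \<and> R x \<le> 2 powr J"
        and mean: "\<And>x. x \<in> E J \<Longrightarrow> ennreal l < ball_mean \<alpha> h x (R x)" by metis
      obtain I where I: "countable I" "I \<subseteq> E J"
        and disj: "pairwise (\<lambda>i j. disjnt (ball i (R i)) (ball j (R j))) I"
        and cover: "E J \<subseteq> (\<Union>i\<in>I. ball i (5 * R i))"
        by (rule Vitali_covering_lemma_balls[where S = "E J" and K = "E J" and a = "\<lambda>x. x" and r = R and B = "2 powr J"]) (use R in auto)
      have Ri: "R i > 0" if "i \<in> I" for i using R I that by blast
      have "emeasure ?\<nu> (E J) = (\<integral>\<^sup>+x. indicator (E J) x \<partial>?\<nu>)" by simp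
      also have "\<dots> \<le> (\<integral>\<^sup>+x. \<integral>\<^sup>+i. indicator (ball i (5 * R i)) x \<partial>count_space I \<partial>?\<nu>)"
      proof (intro nn_integral_mono)
        fix x
        show "indicator (E J) x \<le> (\<integral>\<^sup>+i. indicator (ball i (5 * R i)) x \<partial>count_space I)"
        proof (cases "x \<in> E J")
          case True
          then obtain i where i: "i \<in> I" "x \<in> ball i (5 * R i)" using cover by blast
          then have "indicator (E J) x \<le> (indicator (ball i (5 * R i)) x :: ennreal)" by (auto simp: indicator_def)
          also have "\<dots> \<le> (\<integral>\<^sup>+i. indicator (ball i (5 * R i)) x \<partial>count_space I)"
            by (rule nn_integral_ge_point[OF i(1)])
          finally show ?thesis .
        qed simp
      qed
      also have "\<dots> = (\<integral>\<^sup>+i. \<integral>\<^sup>+x. indicator (ball i (5 * R i)) x \<partial>?\<nu> \<partial>count_space I)"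
        by (rule nn_integral_count_space_nn_integral[OF I(1)]) simp
      also have "\<dots> \<le> (\<integral>\<^sup>+i. ennreal (C / l) * ball_integral \<alpha> h i (R i) \<partial>count_space I)"
      proof (intro nn_integral_mono)
        fix i assume "i \<in> space (count_space I)"
        then have i: "i \<in> I" by simp
        have V: "dunkl_vol \<alpha> i (R i) > 0" by (rule dunkl_vol_pos[OF Ri[OF i]])
        have "(\<integral>\<^sup>+x. indicator (ball i (5 * R i)) x \<partial>?\<nu>) = emeasure ?\<nu> (ball i (5 * R i))" by simp
        also have "\<dots> \<le> ennreal (C * dunkl_vol \<alpha> i (R i))" by (rule five[OF Ri[OF i]])
        also have "\<dots> = ennreal (C / l) * (ennreal (dunkl_vol \<alpha> i (R i)) * ennreal l)"
          using C l V by (simp flip: ennreal_mult)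
        also have "\<dots> \<le> ennreal (C / l) * (ennreal (dunkl_vol \<alpha> i (R i)) * ball_mean \<alpha> h i (R i))"
          using mean[of i] i I by (intro mult_left_mono) auto
        also have "\<dots> = ennreal (C / l) * ball_integral \<alpha> h i (R i)"
          by (simp add: ball_integral_eq_ball_mean[OF Ri[OF i]])
        finally show "(\<integral>\<^sup>+x. indicator (ball i (5 * R i)) x \<partial>?\<nu>)
          \<le> ennreal (C / l) * ball_integral \<alpha> h i (R i)" .
      qed
      also have "\<dots> = ennreal (C / l) * (\<integral>\<^sup>+i. \<integral>\<^sup>+y. (if \<bar>y - i\<bar> < R i then h y else 0) \<partial>?\<nu> \<partial>count_space I)"
        by (rule nn_integral_cmult) simp
      also have "(\<integral>\<^sup>+i. \<integral>\<^sup>+y. (if \<bar>y - i\<bar> < R i then h y else 0) \<partial>?\<nu> \<partial>count_space I)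
          = (\<integral>\<^sup>+y. \<integral>\<^sup>+i. (if \<bar>y - i\<bar> < R i then h y else 0) \<partial>count_space I \<partial>?\<nu>)"
        by (rule nn_integral_count_space_nn_integral[OF I(1), symmetric]) simp
      also have "\<dots> \<le> (\<integral>\<^sup>+y. h y \<partial>?\<nu>)"
      proof (intro nn_integral_mono)
        fix y
        show "(\<integral>\<^sup>+i. (if \<bar>y - i\<bar> < R i then h y else 0) \<partial>count_space I) \<le> h y"
        proof (cases "\<exists>i\<in>I. \<bar>y - i\<bar> < R i")
          case True
          then obtain i where i: "i \<in> I" "\<bar>y - i\<bar> < R i" by blast
          have uniq: "k = i" if "k \<in> I" "\<bar>y - k\<bar> < R k" for k
          proof (rule ccontr)
            assume "k \<noteq> i"
            then have "disjnt (ball k (R k)) (ball i (R i))" using disj i that unfolding pairwise_def by blast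
            moreover have "y \<in> ball k (R k)" "y \<in> ball i (R i)"
              using i that by (auto simp: dist_real_def abs_minus_commute)
            ultimately show False by (auto simp: disjnt_iff)
          qed
          have "(\<integral>\<^sup>+i. (if \<bar>y - i\<bar> < R i then h y else 0) \<partial>count_space I)
              \<le> (\<integral>\<^sup>+k. h y * indicator {i} k \<partial>count_space I)"
            by (intro nn_integral_mono) (use uniq in \<open>auto simp: indicator_def\<close>)
          also have "\<dots> = h y * emeasure (count_space I) {i}"
            using i by (intro nn_integral_cmult_indicator) auto
          also have "\<dots> = h y" using i by simp
          finally show ?thesis .
        next
          case False
          then have "(\<integral>\<^sup>+i. (if \<bar>y - i\<bar> < R i then h y else 0) \<partial>count_space I) = (\<integral>\<^sup>+i. 0 \<partial>count_space I)"
            by (intro nn_integral_cong) auto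
          then show ?thesis by simp
        qed
      qed
      finally show ?thesis by (simp add: mult_left_mono)
    qed
    have "emeasure ?\<nu> {x. ennreal l < dyadic_maximal \<alpha> h x} = (SUP J. emeasure ?\<nu> (E J))"
      unfolding union by (rule SUP_emeasure_incseq[symmetric]) (use inc in auto)
    also have "\<dots> \<le> ennreal (C / l) * (\<integral>\<^sup>+y. h y \<partial>?\<nu>)" by (rule SUP_least) (rule bound)
    finally show ?thesis .
  qed
  then show ?thesis using that C by blast
qed

text \<open>This is \<open>u\<^sup>p\<close>, written as the integral of \<open>p l\<^bsup>p-1\<^esup>\<close> over the levels \<open>l\<close> below \<open>u\<close>. The form takes the value
  \<open>\<infinity>\<close> at \<open>\<infinity>\<close> and is ready for Tonelli's theorem.\<close>

definition layer_power :: "real \<Rightarrow> ennreal \<Rightarrow> ennreal" where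
  "layer_power p u = (\<integral>\<^sup>+l. (if 0 < l \<and> ennreal l < u then ennreal (p * l powr (p - 1)) else 0) \<partial>lborel)"

lemma layer_power_ennreal:
  assumes "p > 0" "u \<ge> 0"
  shows "layer_power p (ennreal u) = ennreal (u powr p)"
proof -
  have "layer_power p (ennreal u) = (\<integral>\<^sup>+l. ennreal p * (ennreal (l powr (p - 1)) * indicator {0<..<u} l) \<partial>lborel)"
    unfolding layer_power_def using assms
    by (intro nn_integral_cong) (auto simp: indicator_def ennreal_mult ennreal_less_iff)
  also have "\<dots> = ennreal p * (\<integral>\<^sup>+l. ennreal (l powr (p - 1)) * indicator {0<..<u} l \<partial>lborel)"
    by (rule nn_integral_cmult) simp
  also have "\<dots> = ennreal p * ennreal (u powr (p - 1 + 1) / (p - 1 + 1))"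
    using assms by (subst nn_integral_powr_from_0) auto
  also have "\<dots> = ennreal (u powr p)" using assms by (simp flip: ennreal_mult)
  finally show ?thesis .
qed

lemma layer_power_mono: "u \<le> v \<Longrightarrow> layer_power p u \<le> layer_power p v"
  unfolding layer_power_def by (intro nn_integral_mono) auto

lemma layer_power_finite:
  assumes "p > 0" "layer_power p u < \<infinity>"
  shows "u < \<infinity>"
proof (rule ccontr)
  assume "\<not> u < \<infinity>"
  then have u: "u = top" by (simp add: top.not_eq_extremum[symmetric])
  have le: "ennreal s \<le> layer_power p u" if s: "s \<ge> 0" for s
  proof -
    have "ennreal s = layer_power p (ennreal (s powr (1 / p)))"
      using assms(1) s by (simp add: layer_power_ennreal powr_powr)
    also have "\<dots> \<le> layer_power p u" unfolding u by (rule layer_power_mono) simp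
    finally show ?thesis .
  qed
  obtain s where s: "s \<ge> 0" "layer_power p u = ennreal s"
    using assms(2) by (cases "layer_power p u") auto
  then show False using le[of "s + 1"] by simp
qed

lemma layer_power_measurable [measurable (raw)]:
  assumes [measurable]: "f \<in> borel_measurable M"
  shows "(\<lambda>x. layer_power p (f x)) \<in> borel_measurable M"
  unfolding layer_power_def by measurable

text \<open>On the set where the maximal function exceeds \<open>l\<close>, only the part of \<open>h\<close> above a fixed multiple of \<open>l\<close> matters.
  The weak type estimate for this part is integrated over \<open>l\<close> with weight \<open>p l\<^bsup>p-1\<^esup>\<close>; the resulting inner
  integral of \<open>l\<^bsup>p-2\<^esup>\<close> converges at \<open>0\<close> because \<open>p > 1\<close>.\<close>

lemma strong_type_maximal:
  assumes \<alpha>: "\<alpha> \<ge> -1/2" and p: "p > 1"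
  obtains C where "C > 0"
    "\<And>h :: real \<Rightarrow> real. h \<in> borel_measurable borel \<Longrightarrow> (\<And>y. 0 \<le> h y) \<Longrightarrow>
       (\<integral>\<^sup>+x. layer_power p (dyadic_maximal \<alpha> (\<lambda>y. ennreal (h y)) x) \<partial>dunkl_borel \<alpha>)
         \<le> ennreal C * (\<integral>\<^sup>+y. ennreal (h y powr p) \<partial>dunkl_borel \<alpha>)"
proof -
  let ?\<nu> = "dunkl_borel \<alpha>"
  interpret N: sigma_finite_measure ?\<nu> by (rule sigma_finite_dunkl_borel)
  interpret P: pair_sigma_finite lborel ?\<nu> by standard
  obtain C1 where C1: "C1 > 0" "\<And>x r. r > 0 \<Longrightarrow> emeasure ?\<nu> (ball x r) \<le> ennreal (C1 * dunkl_vol \<alpha> x r)"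
    using emeasure_dunkl_ball_le[OF \<alpha>] by blast
  obtain C2 where C2: "C2 > 0" "\<And>h l. h \<in> borel_measurable borel \<Longrightarrow> l > 0 \<Longrightarrow>
       emeasure ?\<nu> {x. ennreal l < dyadic_maximal \<alpha> h x} \<le> ennreal (C2 / l) * (\<integral>\<^sup>+y. h y \<partial>?\<nu>)"
    using weak_type_maximal[OF \<alpha>] by blast
  define C where "C = 2 * C2 * p * (2 * C1) powr (p - 1) / (p - 1)"
  have C: "C > 0" using C1 C2 p by (simp add: C_def)
  have "(\<integral>\<^sup>+x. layer_power p (dyadic_maximal \<alpha> (\<lambda>y. ennreal (h y)) x) \<partial>?\<nu>)
      \<le> ennreal C * (\<integral>\<^sup>+y. ennreal (h y powr p) \<partial>?\<nu>)"
    if h[measurable]: "h \<in> borel_measurable borel" and h0: "\<And>y. 0 \<le> h y" for h :: "real \<Rightarrow> real"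
  proof -
    let ?M = "dyadic_maximal \<alpha> (\<lambda>y. ennreal (h y))"
    define h1 where "h1 l y = (if l < 2 * C1 * h y then ennreal (h y) else 0)" for l y
    have [measurable]: "(\<lambda>(l, y). h1 l y) \<in> borel_measurable (borel \<Otimes>\<^sub>M borel)"
      unfolding h1_def by measurable
    \<comment> \<open>Values below \<open>l / (2 C1)\<close> contribute at most \<open>l / 2\<close> to every mean.\<close>
    have trunc: "{x. ennreal l < ?M x} \<subseteq> {x. ennreal (l / 2) < dyadic_maximal \<alpha> (h1 l) x}" if l: "l > 0" for l
    proof safe
      fix x assume "ennreal l < ?M x"
      then obtain j :: int where j: "ennreal l < ball_mean \<alpha> (\<lambda>y. ennreal (h y)) x (2 powr j)"
        unfolding dyadic_maximal_def by (auto simp: less_SUP_iff)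
      define r where "r = (2::real) powr j"
      have r: "r > 0" by (simp add: r_def)
      have V: "dunkl_vol \<alpha> x r > 0" by (rule dunkl_vol_pos[OF r])
      have "ennreal (l / 2) < ball_mean \<alpha> (h1 l) x r"
      proof (rule ccontr)
        assume "\<not> ?thesis"
        then have "ball_mean \<alpha> (h1 l) x r \<le> ennreal (l / 2)" by simp
        then have small: "ball_integral \<alpha> (\<lambda>y. h1 l y) x r \<le> ennreal (l / 2 * dunkl_vol \<alpha> x r)"
          using l r by (subst (asm) ball_mean_le_iff) auto
        have "ball_integral \<alpha> (\<lambda>y. ennreal (h y)) x r
            \<le> (\<integral>\<^sup>+y. (if \<bar>y - x\<bar> < r then h1 l y else 0) + ennreal (l / (2 * C1)) * indicator (ball x r) y \<partial>?\<nu>)"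
        proof (intro nn_integral_mono)
          fix y
          show "(if \<bar>y - x\<bar> < r then ennreal (h y) else 0)
             \<le> (if \<bar>y - x\<bar> < r then h1 l y else 0) + ennreal (l / (2 * C1)) * indicator (ball x r) y"
          proof (cases "\<bar>y - x\<bar> < r \<and> \<not> l < 2 * C1 * h y")
            case True
            then have "h y \<le> l / (2 * C1)" using C1 by (simp add: field_simps)
            moreover have "y \<in> ball x r" using True by (auto simp: dist_real_def abs_minus_commute)
            ultimately show ?thesis using True by (simp add: h1_def ennreal_leI)
          qed (auto simp: h1_def)
        qed
        also have "\<dots> = ball_integral \<alpha> (\<lambda>y. h1 l y) x r
            + (\<integral>\<^sup>+y. ennreal (l / (2 * C1)) * indicator (ball x r) y \<partial>?\<nu>)"
          by (rule nn_integral_add) measurable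
        also have "(\<integral>\<^sup>+y. ennreal (l / (2 * C1)) * indicator (ball x r) y \<partial>?\<nu>)
            = ennreal (l / (2 * C1)) * emeasure ?\<nu> (ball x r)"
          by (rule nn_integral_cmult_indicator) simp
        also have "ball_integral \<alpha> (\<lambda>y. h1 l y) x r + ennreal (l / (2 * C1)) * emeasure ?\<nu> (ball x r)
            \<le> ennreal (l / 2 * dunkl_vol \<alpha> x r) + ennreal (l / (2 * C1)) * ennreal (C1 * dunkl_vol \<alpha> x r)"
          by (intro add_mono small mult_left_mono C1 r) simp
        also have "\<dots> = ennreal (l * dunkl_vol \<alpha> x r)"
          using l C1 V by (simp add: field_simps flip: ennreal_mult ennreal_plus)
        finally have "ball_mean \<alpha> (\<lambda>y. ennreal (h y)) x r \<le> ennreal l"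
          using l r by (subst ball_mean_le_iff) auto
        then show False using j by (simp add: r_def)
      qed
      also have "\<dots> \<le> dyadic_maximal \<alpha> (h1 l) x"
        unfolding dyadic_maximal_def r_def by (rule SUP_upper) simp
      finally show "ennreal (l / 2) < dyadic_maximal \<alpha> (h1 l) x" .
    qed
    let ?w = "\<lambda>l. ennreal (p * l powr (p - 1))"
    have "(\<integral>\<^sup>+x. layer_power p (?M x) \<partial>?\<nu>)
        = (\<integral>\<^sup>+l. \<integral>\<^sup>+x. (if 0 < l \<and> ennreal l < ?M x then ?w l else 0) \<partial>?\<nu> \<partial>lborel)"
      unfolding layer_power_def by (rule P.Fubini') measurable
    also have "\<dots> \<le> (\<integral>\<^sup>+l. \<integral>\<^sup>+y. (if 0 < l \<and> l < 2 * C1 * h y then ennreal (2 * C2 * p * h y * l powr (p - 2)) else 0) \<partial>?\<nu> \<partial>lborel)"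
    proof (rule nn_integral_mono)
      fix l :: real
      show "(\<integral>\<^sup>+x. (if 0 < l \<and> ennreal l < ?M x then ?w l else 0) \<partial>?\<nu>)
        \<le> (\<integral>\<^sup>+y. (if 0 < l \<and> l < 2 * C1 * h y then ennreal (2 * C2 * p * h y * l powr (p - 2)) else 0) \<partial>?\<nu>)"
      proof (cases "l > 0")
        case True
        have [measurable]: "h1 l \<in> borel_measurable borel" unfolding h1_def by measurable
        have "(\<integral>\<^sup>+x. (if 0 < l \<and> ennreal l < ?M x then ?w l else 0) \<partial>?\<nu>)
            = (\<integral>\<^sup>+x. ?w l * indicator {x. ennreal l < ?M x} x \<partial>?\<nu>)"
          using True by (intro nn_integral_cong) (auto simp: indicator_def)
        also have "\<dots> = ?w l * emeasure ?\<nu> {x. ennreal l < ?M x}"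
          by (rule nn_integral_cmult_indicator) simp
        also have "\<dots> \<le> ?w l * emeasure ?\<nu> {x. ennreal (l / 2) < dyadic_maximal \<alpha> (h1 l) x}"
          by (intro mult_left_mono emeasure_mono trunc[OF True]) auto
        also have "\<dots> \<le> ?w l * (ennreal (C2 / (l / 2)) * (\<integral>\<^sup>+y. h1 l y \<partial>?\<nu>))"
          using True by (intro mult_left_mono C2) auto
        also have "\<dots> = (\<integral>\<^sup>+y. ?w l * ennreal (C2 / (l / 2)) * h1 l y \<partial>?\<nu>)"
          by (subst nn_integral_cmult) (auto simp: mult.assoc)
        also have "\<dots> = (\<integral>\<^sup>+y. (if 0 < l \<and> l < 2 * C1 * h y then ennreal (2 * C2 * p * h y * l powr (p - 2)) else 0) \<partial>?\<nu>)"
        proof (intro nn_integral_cong)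
          fix y
          have "l powr (p - 1) = l powr (p - 2) * l"
            using True powr_add[of l "p - 2" 1] by simp
          then have "p * l powr (p - 1) * (C2 / (l / 2)) * h y = 2 * C2 * p * h y * l powr (p - 2)"
            using True by simp
          then show "?w l * ennreal (C2 / (l / 2)) * h1 l y
            = (if 0 < l \<and> l < 2 * C1 * h y then ennreal (2 * C2 * p * h y * l powr (p - 2)) else 0)"
            using True p C2 h0[of y] by (auto simp: h1_def simp flip: ennreal_mult)
        qed
        finally show ?thesis .
      qed simp
    qed
    also have "\<dots> = (\<integral>\<^sup>+y. \<integral>\<^sup>+l. (if 0 < l \<and> l < 2 * C1 * h y then ennreal (2 * C2 * p * h y * l powr (p - 2)) else 0) \<partial>lborel \<partial>?\<nu>)"
      by (rule P.Fubini'[symmetric]) measurable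
    also have "\<dots> = (\<integral>\<^sup>+y. ennreal C * ennreal (h y powr p) \<partial>?\<nu>)"
    proof (intro nn_integral_cong)
      fix y
      have "(\<integral>\<^sup>+l. (if 0 < l \<and> l < 2 * C1 * h y then ennreal (2 * C2 * p * h y * l powr (p - 2)) else 0) \<partial>lborel)
          = (\<integral>\<^sup>+l. ennreal (2 * C2 * p * h y) * (ennreal (l powr (p - 2)) * indicator {0<..<2 * C1 * h y} l) \<partial>lborel)"
        using C2 p h0[of y] by (intro nn_integral_cong) (auto simp: indicator_def simp flip: ennreal_mult)
      also have "\<dots> = ennreal (2 * C2 * p * h y) * (\<integral>\<^sup>+l. ennreal (l powr (p - 2)) * indicator {0<..<2 * C1 * h y} l \<partial>lborel)"
        by (rule nn_integral_cmult) simp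
      also have "\<dots> = ennreal (2 * C2 * p * h y) * ennreal ((2 * C1 * h y) powr (p - 2 + 1) / (p - 2 + 1))"
        using p C1 h0[of y] by (subst nn_integral_powr_from_0) auto
      also have "\<dots> = ennreal (2 * C2 * p * h y * ((2 * C1 * h y) powr (p - 1) / (p - 1)))"
        using C2 p h0[of y] by (subst ennreal_mult) auto
      also have "2 * C2 * p * h y * ((2 * C1 * h y) powr (p - 1) / (p - 1)) = C * h y powr p"
      proof -
        have "h y powr p = h y * h y powr (p - 1)"
          using h0[of y] powr_add[of "h y" 1 "p - 1"] by simp
        then show ?thesis using p unfolding C_def powr_mult[of "2 * C1"] by (simp add: field_simps)
      qed
      finally show "(\<integral>\<^sup>+l. (if 0 < l \<and> l < 2 * C1 * h y then ennreal (2 * C2 * p * h y * l powr (p - 2)) else 0) \<partial>lborel)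
          = ennreal C * ennreal (h y powr p)"
        using C by (simp add: ennreal_mult)
    qed
    also have "\<dots> = ennreal C * (\<integral>\<^sup>+y. ennreal (h y powr p) \<partial>?\<nu>)"
      by (rule nn_integral_cmult) simp
    finally show ?thesis .
  qed
  then show ?thesis using that C by blast
qed

section \<open>Morrey bounds over ordinary balls\<close>

text \<open>The Morrey condition over ordinary balls; \<open>u(r)\<close> stands for the product of \<open>\<phi>(r)\<close> and a bound for the norm.\<close>

definition morrey_bound :: "real \<Rightarrow> real \<Rightarrow> real \<Rightarrow> (real \<Rightarrow> real) \<Rightarrow> (real \<Rightarrow> real) \<Rightarrow> bool" where
  "morrey_bound \<alpha> p D u h \<longleftrightarrow>
     (\<forall>x r. r > 0 \<longrightarrow>
       (ball_integral \<alpha> (\<lambda>y. ennreal (h y powr p)) x r)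
         \<le> ennreal (D * dunkl_vol \<alpha> x r * u r powr p))"

lemma dunkl_vol_ratio:
  assumes "r > 0"
  shows "(r / (\<bar>x\<bar> + r)) powr (2 * \<alpha> + 1) * dunkl_vol \<alpha> x r = r powr dunkl_dim \<alpha>"
proof -
  have "(r / (\<bar>x\<bar> + r)) powr (2 * \<alpha> + 1) * dunkl_vol \<alpha> x r = r * r powr (2 * \<alpha> + 1)"
    using assms unfolding dunkl_vol_def powr_divide by simp
  also have "\<dots> = r powr dunkl_dim \<alpha>"
  proof -
    have "dunkl_dim \<alpha> = 1 + (2 * \<alpha> + 1)" by (simp add: dunkl_dim_def)
    then show ?thesis using assms by (simp only: powr_add) simp
  qed
  finally show ?thesis .
qed

lemma norm_powr_locally_finite:
  fixes f f' :: "real \<Rightarrow> complex"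
  assumes \<alpha>: "\<alpha> \<ge> -1/2" and ae: "AE z in lborel. f z = f' z"
    and loc: "\<forall>K. compact K \<longrightarrow> set_integrable (dunkl_measure \<alpha>) K (\<lambda>x. norm (f x) powr p)"
  shows "(\<integral>\<^sup>+z. ennreal (norm (f' z) powr p) * indicator (ball 0 R) z \<partial>dunkl_borel \<alpha>) < \<infinity>"
proof -
  have ae': "AE z in dunkl_borel \<alpha>. f z = f' z" using ae by (simp add: AE_dunkl_borel_iff[OF \<alpha>])
  have "(\<integral>\<^sup>+z. ennreal (norm (f' z) powr p) * indicator (ball 0 R) z \<partial>dunkl_borel \<alpha>)
      \<le> (\<integral>\<^sup>+z. ennreal (norm (indicator (cball 0 R) z *\<^sub>R (norm (f z) powr p))) \<partial>dunkl_borel \<alpha>)"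
  proof (rule nn_integral_mono_AE)
    show "AE z in dunkl_borel \<alpha>. ennreal (norm (f' z) powr p) * indicator (ball 0 R) z
        \<le> ennreal (norm (indicator (cball 0 R) z *\<^sub>R (norm (f z) powr p)))"
      using ae' by eventually_elim (auto simp: indicator_def)
  qed
  also have "\<dots> = (\<integral>\<^sup>+z. ennreal (norm (indicator (cball 0 R) z *\<^sub>R (norm (f z) powr p))) \<partial>dunkl_measure \<alpha>)"
    by (simp add: dunkl_measure_eq_completion[OF \<alpha>] nn_integral_completion)
  also have "\<dots> < \<infinity>"
    using loc[rule_format, of "cball 0 R"] unfolding set_integrable_def integrable_iff_bounded by simp
  finally show ?thesis .
qed

text \<open>By duality the Morrey norm controls integrals of \<open>\<bar>f\<bar>\<^sup>p\<close> against \<open>ball_kernel \<alpha> r (-x)\<close>, and for \<open>r = 4s\<close> this kernel is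
  bounded below on the ball of radius \<open>s\<close> around \<open>x\<close>. The passage from \<open>\<phi>(4s)\<close> to \<open>\<phi>(s)\<close> uses that \<open>\<phi>\<close> is almost
  decreasing.\<close>

lemma morrey_bound_of_norm:
  assumes \<alpha>: "\<alpha> \<ge> -1/2" and p: "p > 0" and A: "A > 0"
  obtains D where "D > 0"
    "\<And>\<phi> N (f :: real \<Rightarrow> complex) f'. f' \<in> borel_measurable borel \<Longrightarrow> AE z in lborel. f z = f' z \<Longrightarrow>
       (\<forall>K. compact K \<longrightarrow> set_integrable (dunkl_measure \<alpha>) K (\<lambda>x. norm (f x) powr p)) \<Longrightarrow>
       (\<forall>r>0. \<phi> r > 0) \<Longrightarrow> (\<forall>r s. 0 < r \<longrightarrow> r \<le> s \<longrightarrow> \<phi> s \<le> A * \<phi> r) \<Longrightarrow> N > 0 \<Longrightarrow>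
       morrey_norm \<alpha> p \<phi> f \<le> ennreal N \<Longrightarrow>
       morrey_bound \<alpha> p D (\<lambda>r. \<phi> r * N) (\<lambda>y. norm (f' y))"
proof -
  let ?\<nu> = "dunkl_borel \<alpha>"
  obtain c where c: "c > 0" "\<And>r x z. r > 0 \<Longrightarrow> \<bar>z - x\<bar> < r / 4 \<Longrightarrow>
       ennreal (c * (r / (\<bar>x\<bar> + r)) powr (2 * \<alpha> + 1)) \<le> ball_kernel \<alpha> r (-x) z"
    using ball_kernel_ge[OF \<alpha>] by blast
  define D where "D = 4 powr (2 * \<alpha> + 2) * A powr p / c"
  have D: "D > 0" using c A by (simp add: D_def)
  have main: "ball_integral \<alpha> (\<lambda>y. ennreal (norm (f' y) powr p)) x s
      \<le> ennreal (D * dunkl_vol \<alpha> x s * (\<phi> s * N) powr p)"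
    if f'[measurable]: "f' \<in> borel_measurable borel" and ae: "AE z in lborel. f z = f' z"
      and loc: "\<forall>K. compact K \<longrightarrow> set_integrable (dunkl_measure \<alpha>) K (\<lambda>x. norm (f x) powr p)"
      and \<phi>: "\<forall>r>0. \<phi> r > 0" "\<forall>r s. 0 < r \<longrightarrow> r \<le> s \<longrightarrow> \<phi> s \<le> A * \<phi> r" and N: "N > 0"
      and norm: "morrey_norm \<alpha> p \<phi> f \<le> ennreal N" and s: "s > 0"
    for \<phi> and N and f f' :: "real \<Rightarrow> complex" and x s
  proof -
    define r where "r = 4 * s"
    have r: "r > 0" using s by (simp add: r_def)
    define I where "I = (LINT y:ball 0 r|dunkl_measure \<alpha>. dunkl_translation \<alpha> x (\<lambda>z. norm (f z) powr p) y)"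
    have ae_powr: "AE z in lborel. norm (f z) powr p = norm (f' z) powr p"
      using ae by eventually_elim simp
    note dual = ball_integral_translation[OF \<alpha> r _ _ ae_powr norm_powr_locally_finite[OF \<alpha> ae loc], of x]
    have I0: "I \<ge> 0" unfolding I_def by (rule dual(1)) auto
    have I: "ennreal I = (\<integral>\<^sup>+z. ennreal (norm (f' z) powr p) * ball_kernel \<alpha> r (- x) z \<partial>?\<nu>)"
      unfolding I_def by (rule dual(2)) auto
    have "ennreal (1 / \<phi> r * (1 / r powr dunkl_dim \<alpha> * I) powr (1 / p)) \<le> morrey_norm \<alpha> p \<phi> f"
      unfolding morrey_norm_def I_def using r by (intro SUP_upper2[of r] SUP_upper) auto
    then have "ennreal (1 / \<phi> r * (1 / r powr dunkl_dim \<alpha> * I) powr (1 / p)) \<le> ennreal N"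
      using norm by (rule order_trans)
    then have "1 / \<phi> r * (1 / r powr dunkl_dim \<alpha> * I) powr (1 / p) \<le> N"
      using N by (subst (asm) ennreal_le_iff) auto
    then have "(1 / r powr dunkl_dim \<alpha> * I) powr (1 / p) \<le> \<phi> r * N"
      using \<phi>(1)[rule_format, OF r] by (simp add: field_simps)
    then have "((1 / r powr dunkl_dim \<alpha> * I) powr (1 / p)) powr p \<le> (\<phi> r * N) powr p"
      using p by (intro powr_mono2) auto
    then have "1 / r powr dunkl_dim \<alpha> * I \<le> (\<phi> r * N) powr p"
      using p I0 by (simp add: powr_powr)
    then have I_le: "I \<le> r powr dunkl_dim \<alpha> * (\<phi> r * N) powr p"
      using r by (simp add: field_simps)
    define k where "k = c * (r / (\<bar>x\<bar> + r)) powr (2 * \<alpha> + 1)"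
    have k: "k > 0" using c r by (simp add: k_def)
    have "ennreal k * ball_integral \<alpha> (\<lambda>y. ennreal (norm (f' y) powr p)) x s
        = (\<integral>\<^sup>+y. ennreal k * (if \<bar>y - x\<bar> < s then ennreal (norm (f' y) powr p) else 0) \<partial>?\<nu>)"
      by (rule nn_integral_cmult[symmetric]) measurable
    also have "\<dots> \<le> ennreal I"
      unfolding I
    proof (rule nn_integral_mono)
      fix y
      show "ennreal k * (if \<bar>y - x\<bar> < s then ennreal (norm (f' y) powr p) else 0)
          \<le> ennreal (norm (f' y) powr p) * ball_kernel \<alpha> r (- x) y"
        using c(2)[OF r, of y x] by (auto simp: k_def r_def mult.commute intro!: mult_left_mono)
    qed
    also have "\<dots> \<le> ennreal (k * (D * dunkl_vol \<alpha> x s * (\<phi> s * N) powr p))"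
    proof (rule ennreal_leI)
      have "k * dunkl_vol \<alpha> x r = c * r powr dunkl_dim \<alpha>"
        using dunkl_vol_ratio[OF r, of x \<alpha>] by (simp add: k_def mult.assoc)
      then have rd: "r powr dunkl_dim \<alpha> = k * dunkl_vol \<alpha> x r / c" using c by simp
      have "\<phi> r \<le> A * \<phi> s" using \<phi>(2)[rule_format, of s r] s by (simp add: r_def)
      then have "(\<phi> r * N) powr p \<le> (A * (\<phi> s * N)) powr p"
        using p N \<phi>(1)[rule_format, OF r] by (intro powr_mono2) (auto simp: mult.assoc[symmetric])
      also have "\<dots> = A powr p * (\<phi> s * N) powr p" by (rule powr_mult)
      finally have 1: "(\<phi> r * N) powr p \<le> A powr p * (\<phi> s * N) powr p" .
      have 2: "dunkl_vol \<alpha> x r \<le> 4 powr (2 * \<alpha> + 2) * dunkl_vol \<alpha> x s"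
        unfolding r_def by (rule dunkl_vol_scale[OF \<alpha> s]) simp
      have "I \<le> k * dunkl_vol \<alpha> x r / c * (\<phi> r * N) powr p" using I_le unfolding rd .
      also have "\<dots> \<le> k * (4 powr (2 * \<alpha> + 2) * dunkl_vol \<alpha> x s) / c * (A powr p * (\<phi> s * N) powr p)"
        using 1 2 k c dunkl_vol_pos[OF s, of \<alpha> x]
        by (intro mult_mono divide_right_mono mult_left_mono) auto
      also have "\<dots> = k * (D * dunkl_vol \<alpha> x s * (\<phi> s * N) powr p)"
        by (simp add: D_def)
      finally show "I \<le> k * (D * dunkl_vol \<alpha> x s * (\<phi> s * N) powr p)" .
    qed
    also have "\<dots> = ennreal k * ennreal (D * dunkl_vol \<alpha> x s * (\<phi> s * N) powr p)"
      using k D dunkl_vol_pos[OF s, of \<alpha> x] by (intro ennreal_mult) auto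
    finally show ?thesis using k by (subst (asm) ennreal_mult_le_mult_iff) auto
  qed
  show ?thesis
  proof (rule that[OF D])
    fix \<phi> :: "real \<Rightarrow> real" and N :: real and f f' :: "real \<Rightarrow> complex"
    assume "f' \<in> borel_measurable borel" "AE z in lborel. f z = f' z"
      "\<forall>K. compact K \<longrightarrow> set_integrable (dunkl_measure \<alpha>) K (\<lambda>x. norm (f x) powr p)"
      "\<forall>r>0. \<phi> r > 0" "\<forall>r s. 0 < r \<longrightarrow> r \<le> s \<longrightarrow> \<phi> s \<le> A * \<phi> r" "N > 0"
      "morrey_norm \<alpha> p \<phi> f \<le> ennreal N"
    from main[OF this] show "morrey_bound \<alpha> p D (\<lambda>r. \<phi> r * N) (\<lambda>y. norm (f' y))"
      unfolding morrey_bound_def by simp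
  qed
qed

lemma nn_integral_ball_kernel_le:
  assumes \<alpha>: "\<alpha> \<ge> -1/2"
  obtains C where "C > 0"
    "\<And>g r x. g \<in> borel_measurable borel \<Longrightarrow> r > 0 \<Longrightarrow>
       (\<integral>\<^sup>+y. g y * ball_kernel \<alpha> r x y \<partial>dunkl_borel \<alpha>)
         \<le> ennreal (C * r powr dunkl_dim \<alpha>) * (ball_mean \<alpha> g x r + ball_mean \<alpha> g (- x) r)"
proof -
  let ?\<nu> = "dunkl_borel \<alpha>"
  obtain C where C: "C > 0" "\<And>r x y. r > 0 \<Longrightarrow>
       ball_kernel \<alpha> r x y \<le> ennreal (C * (r / (\<bar>x\<bar> + r)) powr (2 * \<alpha> + 1)) * indicator {..<r} \<bar>\<bar>x\<bar> - \<bar>y\<bar>\<bar>"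
    using ball_kernel_le[OF \<alpha>] by blast
  have "(\<integral>\<^sup>+y. g y * ball_kernel \<alpha> r x y \<partial>?\<nu>)
      \<le> ennreal (C * r powr dunkl_dim \<alpha>) * (ball_mean \<alpha> g x r + ball_mean \<alpha> g (- x) r)"
    if [measurable]: "g \<in> borel_measurable borel" and r: "r > 0" for g r x
  proof -
    let ?V = "dunkl_vol \<alpha> x r"
    have V: "?V > 0" by (rule dunkl_vol_pos[OF r])
    let ?I = "\<lambda>x y. (if \<bar>y - x\<bar> < r then g y else 0)"
    have rat: "C * (r / (\<bar>x\<bar> + r)) powr (2 * \<alpha> + 1) = C * r powr dunkl_dim \<alpha> * (1 / ?V)"
      using dunkl_vol_ratio[OF r, of x \<alpha>] V by (simp add: field_simps)
    have "(\<integral>\<^sup>+y. g y * ball_kernel \<alpha> r x y \<partial>?\<nu>)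
        \<le> (\<integral>\<^sup>+y. ennreal (C * r powr dunkl_dim \<alpha> * (1 / ?V)) * (?I x y + ?I (- x) y) \<partial>?\<nu>)"
    proof (rule nn_integral_mono)
      fix y
      have "g y * ball_kernel \<alpha> r x y
          \<le> g y * (ennreal (C * r powr dunkl_dim \<alpha> * (1 / ?V)) * indicator {..<r} \<bar>\<bar>x\<bar> - \<bar>y\<bar>\<bar>)"
        using C(2)[OF r, of x y] unfolding rat by (intro mult_left_mono) auto
      also have "\<dots> = ennreal (C * r powr dunkl_dim \<alpha> * (1 / ?V)) * (g y * indicator {..<r} \<bar>\<bar>x\<bar> - \<bar>y\<bar>\<bar>)"
        by (simp only: mult_ac)
      also have "\<dots> \<le> ennreal (C * r powr dunkl_dim \<alpha> * (1 / ?V)) * (?I x y + ?I (- x) y)"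
      proof (rule mult_left_mono)
        have "\<bar>y - x\<bar> < r \<or> \<bar>y - - x\<bar> < r" if "\<bar>\<bar>x\<bar> - \<bar>y\<bar>\<bar> < r" using that by linarith
        then show "g y * indicator {..<r} \<bar>\<bar>x\<bar> - \<bar>y\<bar>\<bar> \<le> ?I x y + ?I (- x) y"
          by (auto simp: indicator_def)
      qed simp
      finally show "g y * ball_kernel \<alpha> r x y
          \<le> ennreal (C * r powr dunkl_dim \<alpha> * (1 / ?V)) * (?I x y + ?I (- x) y)" .
    qed
    also have "\<dots> = ennreal (C * r powr dunkl_dim \<alpha> * (1 / ?V)) * (\<integral>\<^sup>+y. ?I x y + ?I (- x) y \<partial>?\<nu>)"
      by (rule nn_integral_cmult) measurable
    also have "(\<integral>\<^sup>+y. ?I x y + ?I (- x) y \<partial>?\<nu>) = (\<integral>\<^sup>+y. ?I x y \<partial>?\<nu>) + (\<integral>\<^sup>+y. ?I (- x) y \<partial>?\<nu>)"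
      by (rule nn_integral_add) measurable
    also have "ennreal (C * r powr dunkl_dim \<alpha> * (1 / ?V)) * ((\<integral>\<^sup>+y. ?I x y \<partial>?\<nu>) + (\<integral>\<^sup>+y. ?I (- x) y \<partial>?\<nu>))
        = ennreal (C * r powr dunkl_dim \<alpha>) * (ball_mean \<alpha> g x r + ball_mean \<alpha> g (- x) r)"
      unfolding ball_mean_def dunkl_vol_minus using C(1) V
      by (subst ennreal_mult) (auto simp: distrib_left mult.assoc)
    finally show ?thesis .
  qed
  then show ?thesis using that C(1) by blast
qed

lemma morrey_bound_ball_mean:
  assumes "morrey_bound \<alpha> p D u h" "r > 0" "D \<ge> 0"
  shows "ball_mean \<alpha> (\<lambda>y. ennreal (h y powr p)) x r \<le> ennreal (D * u r powr p)"
proof -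
  have "0 \<le> D * u r powr p" using assms(3) by simp
  from ball_mean_le_iff[OF assms(2) this] show ?thesis
    using assms(1)[unfolded morrey_bound_def, rule_format, OF assms(2), of x] by (simp add: mult_ac)
qed

text \<open>Conversely the kernel is bounded above and supported in two balls of radius \<open>r\<close>, around \<open>x\<close> and \<open>-x\<close>; the
  condition over ordinary balls controls both.\<close>

lemma morrey_norm_of_bound:
  assumes \<alpha>: "\<alpha> \<ge> -1/2" and q: "q > 0" and Q: "Q > 0"
  obtains C where "C > 0"
    "\<And>\<psi> N (f :: real \<Rightarrow> complex). f \<in> borel_measurable borel \<Longrightarrow>
       (\<forall>r>0. \<psi> r > 0) \<Longrightarrow> N > 0 \<Longrightarrow>
       morrey_bound \<alpha> q Q (\<lambda>r. \<psi> r * N) (\<lambda>y. norm (f y)) \<Longrightarrow>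
       f \<in> morrey_space \<alpha> q \<psi> \<and> morrey_norm \<alpha> q \<psi> f \<le> ennreal (C * N)"
proof -
  let ?\<nu> = "dunkl_borel \<alpha>"
  obtain B where B: "B > 0" "\<And>g r x. g \<in> borel_measurable borel \<Longrightarrow> r > 0 \<Longrightarrow>
       (\<integral>\<^sup>+y. g y * ball_kernel \<alpha> r x y \<partial>?\<nu>)
         \<le> ennreal (B * r powr dunkl_dim \<alpha>) * (ball_mean \<alpha> g x r + ball_mean \<alpha> g (- x) r)"
    using nn_integral_ball_kernel_le[OF \<alpha>] by blast
  define C where "C = (2 * B * Q) powr (1 / q)"
  have C: "C > 0" using B Q by (simp add: C_def)
  have "f \<in> morrey_space \<alpha> q \<psi> \<and> morrey_norm \<alpha> q \<psi> f \<le> ennreal (C * N)"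
    if f[measurable]: "f \<in> borel_measurable borel" and \<psi>: "\<forall>r>0. \<psi> r > 0" and N: "N > 0"
      and bound: "morrey_bound \<alpha> q Q (\<lambda>r. \<psi> r * N) (\<lambda>y. norm (f y))"
    for \<psi> N and f :: "real \<Rightarrow> complex"
  proof -
    let ?g = "\<lambda>z. norm (f z) powr q"
    have fin: "(\<integral>\<^sup>+z. ennreal (?g z) * indicator (ball 0 R) z \<partial>?\<nu>) < \<infinity>" for R
    proof -
      have "(\<integral>\<^sup>+z. ennreal (?g z) * indicator (ball 0 R) z \<partial>?\<nu>)
          \<le> ball_integral \<alpha> (\<lambda>z. ennreal (?g z)) 0 (max R 1)"
        by (intro nn_integral_mono) (auto simp: indicator_def dist_real_def)
      also have "\<dots> \<le> ennreal (Q * dunkl_vol \<alpha> 0 (max R 1) * (\<psi> (max R 1) * N) powr q)"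
        using bound[unfolded morrey_bound_def, rule_format, of "max R 1" 0] by simp
      also have "\<dots> < \<infinity>" by simp
      finally show ?thesis .
    qed
    have norm: "morrey_norm \<alpha> q \<psi> f \<le> ennreal (C * N)"
      unfolding morrey_norm_def
    proof (intro SUP_least)
      fix r x :: real assume "r \<in> {0<..}"
      then have r: "r > 0" by simp
      define I where "I = (LINT y:ball 0 r|dunkl_measure \<alpha>. dunkl_translation \<alpha> x ?g y)"
      have I0: "I \<ge> 0" unfolding I_def
        by (rule ball_integral_translation(1)[where g' = ?g]) (use \<alpha> r fin in auto)
      have "ennreal I = (\<integral>\<^sup>+z. ennreal (?g z) * ball_kernel \<alpha> r (- x) z \<partial>?\<nu>)"
        unfolding I_def by (rule ball_integral_translation(2)) (use \<alpha> r fin in auto)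
      also have "\<dots> \<le> ennreal (B * r powr dunkl_dim \<alpha>) *
          (ball_mean \<alpha> (\<lambda>z. ennreal (?g z)) (- x) r + ball_mean \<alpha> (\<lambda>z. ennreal (?g z)) (- (- x)) r)"
        by (rule B(2)) (use r in auto)
      also have "\<dots> \<le> ennreal (B * r powr dunkl_dim \<alpha>) *
          (ennreal (Q * (\<psi> r * N) powr q) + ennreal (Q * (\<psi> r * N) powr q))"
        using Q by (intro mult_left_mono add_mono morrey_bound_ball_mean[OF bound r]) auto
      also have "\<dots> = ennreal (r powr dunkl_dim \<alpha> * (2 * B * Q * (\<psi> r * N) powr q))"
        using B Q by (simp add: mult_ac flip: ennreal_mult ennreal_plus)
      finally have "I \<le> r powr dunkl_dim \<alpha> * (2 * B * Q * (\<psi> r * N) powr q)"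
        using B Q by (subst (asm) ennreal_le_iff) auto
      then have "1 / r powr dunkl_dim \<alpha> * I \<le> 2 * B * Q * (\<psi> r * N) powr q"
        using r by (simp add: field_simps)
      then have "(1 / r powr dunkl_dim \<alpha> * I) powr (1 / q) \<le> (2 * B * Q * (\<psi> r * N) powr q) powr (1 / q)"
        using q I0 by (intro powr_mono2) auto
      also have "\<dots> = C * (\<psi> r * N)"
        using q \<psi>[rule_format, OF r] N unfolding C_def powr_mult[of "2 * B * Q"] by (simp add: powr_powr)
      finally have "1 / \<psi> r * (1 / r powr dunkl_dim \<alpha> * I) powr (1 / q) \<le> C * N"
        using \<psi>[rule_format, OF r] by (simp add: field_simps)
      then show "ennreal (1 / \<psi> r * (1 / r powr dunkl_dim \<alpha> *
          (LINT y:ball 0 r|dunkl_measure \<alpha>. dunkl_translation \<alpha> x ?g y)) powr (1 / q)) \<le> ennreal (C * N)"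
        unfolding I_def by (rule ennreal_leI)
    qed
    moreover have "f \<in> borel_measurable (dunkl_measure \<alpha>)"
      unfolding dunkl_measure_eq_completion[OF \<alpha>] by (rule measurable_completion) simp
    moreover have "set_integrable (dunkl_measure \<alpha>) K ?g" if K: "compact K" for K
    proof -
      have [measurable]: "K \<in> sets borel" using K by (simp add: borel_compact)
      obtain R where R: "K \<subseteq> ball 0 R"
        using compact_imp_bounded[OF K] bounded_subset_ballD by blast
      have "(\<integral>\<^sup>+z. ennreal (norm (indicator K z *\<^sub>R ?g z)) \<partial>?\<nu>)
          \<le> (\<integral>\<^sup>+z. ennreal (?g z) * indicator (ball 0 R) z \<partial>?\<nu>)"
        by (intro nn_integral_mono) (use R in \<open>auto simp: indicator_def\<close>)
      also have "\<dots> < \<infinity>" by (rule fin)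
      finally have "integrable ?\<nu> (\<lambda>z. indicator K z *\<^sub>R ?g z)"
        by (intro integrableI_bounded) auto
      then show ?thesis
        unfolding set_integrable_def dunkl_measure_eq_completion[OF \<alpha>]
        by (subst integrable_completion) auto
    qed
    ultimately show ?thesis
      unfolding morrey_space_def by (auto intro: order_le_less_trans)
  qed
  then show ?thesis using that C by blast
qed

section \<open>The maximal function on Morrey spaces\<close>

text \<open>With \<open>s = u(r)\<close> one has \<open>h \<le> s + s\<^bsup>1-p\<^esup> h\<^sup>p\<close> pointwise, and both terms have a mean of order \<open>s\<close>. This takes the place of
  Hoelder's inequality.\<close>

lemma morrey_bound_ball_mean_le:
  assumes \<alpha>: "\<alpha> \<ge> -1/2" and p: "p > 1" and D: "D > 0"
  obtains E where "E > 0"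
    "\<And>h u x r. h \<in> borel_measurable borel \<Longrightarrow> (\<forall>y. 0 \<le> h y) \<Longrightarrow> (\<forall>r>0. u r > 0) \<Longrightarrow>
       morrey_bound \<alpha> p D u h \<Longrightarrow> r > 0 \<Longrightarrow>
       ball_mean \<alpha> (\<lambda>y. ennreal (h y)) x r \<le> ennreal (E * u r)"
proof -
  let ?\<nu> = "dunkl_borel \<alpha>"
  obtain C1 where C1: "C1 > 0" "\<And>x r. r > 0 \<Longrightarrow> emeasure ?\<nu> (ball x r) \<le> ennreal (C1 * dunkl_vol \<alpha> x r)"
    using emeasure_dunkl_ball_le[OF \<alpha>] by blast
  define E where "E = C1 + D"
  have E: "E > 0" using C1 D by (simp add: E_def)
  have mean: "ball_mean \<alpha> (\<lambda>y. ennreal (h y)) x r \<le> ennreal (E * u r)"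
    if [measurable]: "h \<in> borel_measurable borel" and h0: "\<forall>y. 0 \<le> h y" and u: "\<forall>r>0. u r > 0"
      and bound: "morrey_bound \<alpha> p D u h" and r: "r > 0" for h u x r
  proof -
    define s where "s = u r"
    have s: "s > 0" using u r by (simp add: s_def)
    have V: "dunkl_vol \<alpha> x r > 0" by (rule dunkl_vol_pos[OF r])
    have young: "h y \<le> s + s powr (1 - p) * h y powr p" for y
    proof (cases "h y \<le> s")
      case True
      then show ?thesis by (simp add: add_increasing2)
    next
      case False
      then have "h y powr (1 - p) \<le> s powr (1 - p)" using s p by (intro powr_mono2') auto
      then have "h y powr (1 - p) * h y powr p \<le> s powr (1 - p) * h y powr p"
        by (intro mult_right_mono) auto
      moreover have "h y powr (1 - p) * h y powr p = h y"
        using False s by (simp flip: powr_add)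
      ultimately show ?thesis using s by simp
    qed
    have "ball_integral \<alpha> (\<lambda>y. ennreal (h y)) x r
        \<le> (\<integral>\<^sup>+y. ennreal s * indicator (ball x r) y
            + ennreal (s powr (1 - p)) * (if \<bar>y - x\<bar> < r then ennreal (h y powr p) else 0) \<partial>?\<nu>)"
    proof (rule nn_integral_mono)
      fix y
      show "(if \<bar>y - x\<bar> < r then ennreal (h y) else 0) \<le> ennreal s * indicator (ball x r) y
            + ennreal (s powr (1 - p)) * (if \<bar>y - x\<bar> < r then ennreal (h y powr p) else 0)"
      proof (cases "\<bar>y - x\<bar> < r")
        case True
        then have "y \<in> ball x r" by (auto simp: dist_real_def abs_minus_commute)
        then show ?thesis using True young[of y] s by (simp add: ennreal_leI flip: ennreal_mult ennreal_plus)
      qed simp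
    qed
    also have "\<dots> = (\<integral>\<^sup>+y. ennreal s * indicator (ball x r) y \<partial>?\<nu>)
        + (\<integral>\<^sup>+y. ennreal (s powr (1 - p)) * (if \<bar>y - x\<bar> < r then ennreal (h y powr p) else 0) \<partial>?\<nu>)"
      by (rule nn_integral_add) measurable
    also have "(\<integral>\<^sup>+y. ennreal s * indicator (ball x r) y \<partial>?\<nu>) = ennreal s * emeasure ?\<nu> (ball x r)"
      by (rule nn_integral_cmult_indicator) simp
    also have "(\<integral>\<^sup>+y. ennreal (s powr (1 - p)) * (if \<bar>y - x\<bar> < r then ennreal (h y powr p) else 0) \<partial>?\<nu>)
        = ennreal (s powr (1 - p)) * ball_integral \<alpha> (\<lambda>y. ennreal (h y powr p)) x r"
      by (rule nn_integral_cmult) measurable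
    also have "ennreal s * emeasure ?\<nu> (ball x r) + ennreal (s powr (1 - p)) * ball_integral \<alpha> (\<lambda>y. ennreal (h y powr p)) x r
        \<le> ennreal s * ennreal (C1 * dunkl_vol \<alpha> x r) + ennreal (s powr (1 - p)) * ennreal (D * dunkl_vol \<alpha> x r * s powr p)"
      using bound r unfolding morrey_bound_def s_def
      by (intro add_mono mult_left_mono C1) auto
    also have "\<dots> = ennreal (E * u r * dunkl_vol \<alpha> x r)"
    proof -
      have "s powr (1 - p) * s powr p = s" using s by (simp flip: powr_add)
      then have "s * (C1 * dunkl_vol \<alpha> x r) + s powr (1 - p) * (D * dunkl_vol \<alpha> x r * s powr p) = E * s * dunkl_vol \<alpha> x r"
        unfolding E_def by (simp add: algebra_simps)
      then show ?thesis using s C1 D V by (simp add: s_def flip: ennreal_mult ennreal_plus)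
    qed
    finally show ?thesis
      using ball_mean_le_iff[of r "E * u r" \<alpha> _ x] r s E by (simp add: s_def)
  qed
  then show ?thesis using that[OF E] by blast
qed

text \<open>For \<open>z\<close> in the ball, dyadic radii up to \<open>r\<close> see only the part of \<open>h\<close> in the doubled ball, to which the strong
  type estimate applies. Means over larger radii \<open>R\<close> are at most a constant times \<open>u(R)\<close>, hence times \<open>u(r)\<close>.\<close>

lemma maximal_morrey:
  assumes \<alpha>: "\<alpha> \<ge> -1/2" and p: "p > 1" and D: "D > 0" and A: "A > 0"
  obtains F where "F > 0"
    "\<And>h u x r. h \<in> borel_measurable borel \<Longrightarrow> (\<forall>y. 0 \<le> h y) \<Longrightarrow> (\<forall>r>0. u r > 0) \<Longrightarrow>
       (\<forall>r s. 0 < r \<longrightarrow> r \<le> s \<longrightarrow> u s \<le> A * u r) \<Longrightarrow> morrey_bound \<alpha> p D u h \<Longrightarrow> r > 0 \<Longrightarrow>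
       (ball_integral \<alpha> (\<lambda>z. layer_power p (dyadic_maximal \<alpha> (\<lambda>y. ennreal (h y)) z)) x r)
         \<le> ennreal (F * dunkl_vol \<alpha> x r * u r powr p)"
proof -
  let ?\<nu> = "dunkl_borel \<alpha>"
  obtain C1 where C1: "C1 > 0" "\<And>x r. r > 0 \<Longrightarrow> emeasure ?\<nu> (ball x r) \<le> ennreal (C1 * dunkl_vol \<alpha> x r)"
    using emeasure_dunkl_ball_le[OF \<alpha>] by blast
  obtain C3 where C3: "C3 > 0" "\<And>h :: real \<Rightarrow> real. h \<in> borel_measurable borel \<Longrightarrow> (\<And>y. 0 \<le> h y) \<Longrightarrow>
       (\<integral>\<^sup>+x. layer_power p (dyadic_maximal \<alpha> (\<lambda>y. ennreal (h y)) x) \<partial>?\<nu>)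
         \<le> ennreal C3 * (\<integral>\<^sup>+y. ennreal (h y powr p) \<partial>?\<nu>)"
    using strong_type_maximal[OF \<alpha> p] by blast
  obtain E where E: "E > 0" and mean: "\<And>h u x r. h \<in> borel_measurable borel \<Longrightarrow>
       (\<forall>y. 0 \<le> h y) \<Longrightarrow> (\<forall>r>0. u r > 0) \<Longrightarrow> morrey_bound \<alpha> p D u h \<Longrightarrow> r > 0 \<Longrightarrow>
       ball_mean \<alpha> (\<lambda>y. ennreal (h y)) x r \<le> ennreal (E * u r)"
    by (rule morrey_bound_ball_mean_le[OF \<alpha> p D]) (rule that, assumption, blast)
  define F where "F = C3 * D * 2 powr (2 * \<alpha> + 2) * A powr p + C1 * (E * A) powr p"
  have F: "F > 0" using C1 C3 D A E by (simp add: F_def add_pos_pos)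
  have "ball_integral \<alpha> (\<lambda>z. layer_power p (dyadic_maximal \<alpha> (\<lambda>y. ennreal (h y)) z)) x r
         \<le> ennreal (F * dunkl_vol \<alpha> x r * u r powr p)"
    if h[measurable]: "h \<in> borel_measurable borel" and h0: "\<forall>y. 0 \<le> h y" and u: "\<forall>r>0. u r > 0"
      and dec: "\<forall>r s. 0 < r \<longrightarrow> r \<le> s \<longrightarrow> u s \<le> A * u r"
      and bound: "morrey_bound \<alpha> p D u h" and r: "r > 0" for h u x r
  proof -
    define h1 where "h1 y = (if \<bar>y - x\<bar> < 2 * r then h y else 0)" for y
    have [measurable]: "h1 \<in> borel_measurable borel" unfolding h1_def by measurable
    define T where "T = E * (A * u r)"
    have T: "T > 0" using E A u r by (simp add: T_def)
    have V: "dunkl_vol \<alpha> x r > 0" by (rule dunkl_vol_pos[OF r])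
    let ?M = "dyadic_maximal \<alpha> (\<lambda>y. ennreal (h y))" and ?M1 = "dyadic_maximal \<alpha> (\<lambda>y. ennreal (h1 y))"
    have M: "?M z \<le> max (?M1 z) (ennreal T)" if z: "\<bar>z - x\<bar> < r" for z
      unfolding dyadic_maximal_def[of _ "\<lambda>y. ennreal (h y)"]
    proof (rule SUP_least)
      fix j :: int
      show "ball_mean \<alpha> (\<lambda>y. ennreal (h y)) z (2 powr j) \<le> max (?M1 z) (ennreal T)"
      proof (cases "(2::real) powr j \<le> r")
        case True
        have "ball_mean \<alpha> (\<lambda>y. ennreal (h y)) z (2 powr j) \<le> ball_mean \<alpha> (\<lambda>y. ennreal (h1 y)) z (2 powr j)"
        proof (rule ball_mean_mono)
          fix y assume "\<bar>y - z\<bar> < 2 powr j"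
          then have "\<bar>y - x\<bar> < 2 * r" using z True by linarith
          then show "ennreal (h y) \<le> ennreal (h1 y)" by (simp add: h1_def)
        qed
        also have "\<dots> \<le> ?M1 z" unfolding dyadic_maximal_def by (rule SUP_upper) simp
        finally show ?thesis by (simp add: max.coboundedI1)
      next
        case False
        have "ball_mean \<alpha> (\<lambda>y. ennreal (h y)) z (2 powr j) \<le> ennreal (E * u (2 powr j))"
          by (rule mean[OF h h0 u bound]) simp_all
        also have "\<dots> \<le> ennreal T"
          unfolding T_def using dec[rule_format, of r "2 powr j"] r False E by (intro ennreal_leI mult_left_mono) auto
        finally show ?thesis by (simp add: max.coboundedI2)
      qed
    qed
    have "ball_integral \<alpha> (\<lambda>z. layer_power p (?M z)) x r
        \<le> (\<integral>\<^sup>+z. layer_power p (?M1 z) + ennreal (T powr p) * indicator (ball x r) z \<partial>?\<nu>)"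
    proof (rule nn_integral_mono)
      fix z
      show "(if \<bar>z - x\<bar> < r then layer_power p (?M z) else 0)
          \<le> layer_power p (?M1 z) + ennreal (T powr p) * indicator (ball x r) z"
      proof (cases "\<bar>z - x\<bar> < r")
        case True
        then have zb: "z \<in> ball x r" by (auto simp: dist_real_def abs_minus_commute)
        have "layer_power p (?M z) \<le> layer_power p (max (?M1 z) (ennreal T))"
          by (rule layer_power_mono[OF M[OF True]])
        also have "\<dots> \<le> layer_power p (?M1 z) + layer_power p (ennreal T)"
          by (cases "?M1 z \<le> ennreal T") (auto simp: max_def add_increasing add_increasing2)
        also have "layer_power p (ennreal T) = ennreal (T powr p)"
          using p T by (intro layer_power_ennreal) auto
        finally show ?thesis using True zb by simp
      qed simp
    qed
    also have "\<dots> = (\<integral>\<^sup>+z. layer_power p (?M1 z) \<partial>?\<nu>) + (\<integral>\<^sup>+z. ennreal (T powr p) * indicator (ball x r) z \<partial>?\<nu>)"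
      by (rule nn_integral_add) measurable
    also have "(\<integral>\<^sup>+z. ennreal (T powr p) * indicator (ball x r) z \<partial>?\<nu>) = ennreal (T powr p) * emeasure ?\<nu> (ball x r)"
      by (rule nn_integral_cmult_indicator) simp
    also have "(\<integral>\<^sup>+z. layer_power p (?M1 z) \<partial>?\<nu>) + ennreal (T powr p) * emeasure ?\<nu> (ball x r)
        \<le> ennreal C3 * ennreal (D * dunkl_vol \<alpha> x (2 * r) * u (2 * r) powr p)
          + ennreal (T powr p) * ennreal (C1 * dunkl_vol \<alpha> x r)"
    proof (intro add_mono mult_left_mono C1 r)
      have "(\<integral>\<^sup>+z. layer_power p (?M1 z) \<partial>?\<nu>) \<le> ennreal C3 * (\<integral>\<^sup>+y. ennreal (h1 y powr p) \<partial>?\<nu>)"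
        by (rule C3) (auto simp: h1_def h0)
      also have "(\<integral>\<^sup>+y. ennreal (h1 y powr p) \<partial>?\<nu>) = ball_integral \<alpha> (\<lambda>y. ennreal (h y powr p)) x (2 * r)"
        by (intro nn_integral_cong) (auto simp: h1_def)
      also have "ennreal C3 * \<dots> \<le> ennreal C3 * ennreal (D * dunkl_vol \<alpha> x (2 * r) * u (2 * r) powr p)"
        using bound r unfolding morrey_bound_def by (intro mult_left_mono) auto
      finally show "(\<integral>\<^sup>+z. layer_power p (?M1 z) \<partial>?\<nu>)
          \<le> ennreal C3 * ennreal (D * dunkl_vol \<alpha> x (2 * r) * u (2 * r) powr p)" .
    qed simp
    also have "\<dots> = ennreal (C3 * (D * dunkl_vol \<alpha> x (2 * r) * u (2 * r) powr p) + T powr p * (C1 * dunkl_vol \<alpha> x r))"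
      using C3 D C1 V dunkl_vol_pos[of "2 * r" \<alpha> x] r by (simp flip: ennreal_mult ennreal_plus)
    also have "\<dots> \<le> ennreal (F * dunkl_vol \<alpha> x r * u r powr p)"
    proof (rule ennreal_leI)
      have 1: "dunkl_vol \<alpha> x (2 * r) \<le> 2 powr (2 * \<alpha> + 2) * dunkl_vol \<alpha> x r"
        by (rule dunkl_vol_scale[OF \<alpha> r]) simp
      have "u (2 * r) powr p \<le> (A * u r) powr p"
        using dec[rule_format, of r "2 * r"] r u[rule_format, of "2 * r"] p by (intro powr_mono2) auto
      also have "\<dots> = A powr p * u r powr p" by (rule powr_mult)
      finally have 2: "u (2 * r) powr p \<le> A powr p * u r powr p" .
      have "C3 * (D * dunkl_vol \<alpha> x (2 * r) * u (2 * r) powr p)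
          \<le> C3 * (D * (2 powr (2 * \<alpha> + 2) * dunkl_vol \<alpha> x r) * (A powr p * u r powr p))"
        using 1 2 C3 D V by (intro mult_left_mono mult_mono) auto
      moreover have "T powr p = (E * A) powr p * u r powr p"
        unfolding T_def by (simp only: mult.assoc[symmetric] powr_mult[of "E * A"])
      ultimately show "C3 * (D * dunkl_vol \<alpha> x (2 * r) * u (2 * r) powr p) + T powr p * (C1 * dunkl_vol \<alpha> x r)
          \<le> F * dunkl_vol \<alpha> x r * u r powr p"
        unfolding F_def by (simp add: algebra_simps)
    qed
    finally show ?thesis .
  qed
  then show ?thesis using that[OF F] by blast
qed

section \<open>Hedberg's pointwise estimate\<close>

abbreviation radial_potential :: "real \<Rightarrow> (real \<Rightarrow> ennreal) \<Rightarrow> (real \<Rightarrow> ennreal) \<Rightarrow> real \<Rightarrow> ennreal" where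
  "radial_potential \<alpha> w h x \<equiv> (\<integral>\<^sup>+t. (if 0 < t then w t * ball_mean \<alpha> h x t else 0) \<partial>lborel)"

lemma ball_mean_le_dyadic_maximal:
  assumes \<alpha>: "\<alpha> \<ge> -1/2" and r: "r > 0"
  shows "ball_mean \<alpha> h x r \<le> ennreal (2 powr (2 * \<alpha> + 2)) * dyadic_maximal \<alpha> h x"
proof -
  define j where "j = \<lceil>log 2 r\<rceil>"
  define R where "R = (2::real) powr j"
  have "r = 2 powr (log 2 r)" using r by simp
  also have "\<dots> \<le> R" unfolding R_def j_def by (intro powr_mono) auto
  finally have rR: "r \<le> R" .
  have "R \<le> 2 powr (log 2 r + 1)"
    unfolding R_def j_def by (intro powr_mono) linarith+
  also have "\<dots> = 2 * r" using r by (simp add: powr_add)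
  finally have R2: "R \<le> 2 * r" .
  have V: "dunkl_vol \<alpha> x r > 0" by (rule dunkl_vol_pos[OF r])
  have "dunkl_vol \<alpha> x R = dunkl_vol \<alpha> x ((R / r) * r)" using r by simp
  also have "\<dots> \<le> (R / r) powr (2 * \<alpha> + 2) * dunkl_vol \<alpha> x r"
    by (rule dunkl_vol_scale[OF \<alpha> r]) (use rR r in simp)
  also have "\<dots> \<le> 2 powr (2 * \<alpha> + 2) * dunkl_vol \<alpha> x r"
    using R2 rR r \<alpha> V by (intro mult_right_mono powr_mono2) (auto simp: field_simps)
  finally have vol: "dunkl_vol \<alpha> x R \<le> 2 powr (2 * \<alpha> + 2) * dunkl_vol \<alpha> x r" .
  have "ball_mean \<alpha> h x r
      \<le> ennreal (1 / dunkl_vol \<alpha> x r) * ball_integral \<alpha> h x R"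
    unfolding ball_mean_def using rR by (intro mult_left_mono nn_integral_mono) auto
  also have "\<dots> = ennreal (1 / dunkl_vol \<alpha> x r) * (ennreal (dunkl_vol \<alpha> x R) * ball_mean \<alpha> h x R)"
    using r rR by (subst ball_integral_eq_ball_mean) auto
  also have "\<dots> \<le> ennreal (1 / dunkl_vol \<alpha> x r) * (ennreal (2 powr (2 * \<alpha> + 2) * dunkl_vol \<alpha> x r) * dyadic_maximal \<alpha> h x)"
    by (intro mult_left_mono mult_mono ennreal_leI vol) (auto simp: dyadic_maximal_def R_def intro!: SUP_upper)
  also have "\<dots> = ennreal (2 powr (2 * \<alpha> + 2)) * dyadic_maximal \<alpha> h x"
    using V by (simp add: mult.assoc[symmetric] flip: ennreal_mult)
  finally show ?thesis .
qed

text \<open>The radii are split at \<open>r\<close> with \<open>\<phi>(r) = S / N\<close>. Below \<open>r\<close> the means are bounded by a multiple of \<open>S = N \<phi>(r)\<close>, above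
  \<open>r\<close> by a multiple of \<open>\<phi>(t) N\<close>, and the two pieces are those of the integral condition multiplied by \<open>N\<close>.\<close>

lemma hedberg_estimate:
  assumes \<alpha>: "\<alpha> \<ge> -1/2" and N: "N > 0" and S: "S \<ge> 0" and C0: "C0 > 0" and E: "E > 0"
    and [measurable]: "w \<in> borel_measurable borel" "h \<in> borel_measurable borel"
    and w\<phi>: "\<And>r. r > 0 \<Longrightarrow> (\<lambda>t. w t * ennreal (\<phi> t) * indicator {r<..} t) \<in> borel_measurable lebesgue"
    and \<phi>_pos: "\<forall>r>0. \<phi> r > 0" and surj: "\<And>t. t > 0 \<Longrightarrow> \<exists>r>0. \<phi> r = t"
    and cond: "\<And>r. r > 0 \<Longrightarrow>
      ennreal (\<phi> r) * (\<integral>\<^sup>+t\<in>{0<..<r}. w t \<partial>lebesgue) + (\<integral>\<^sup>+t\<in>{r<..}. w t * ennreal (\<phi> t) \<partial>lebesgue)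
        \<le> ennreal (C0 * \<phi> r powr s)"
    and mean: "\<And>r. r > 0 \<Longrightarrow> ball_mean \<alpha> h x r \<le> ennreal (E * (\<phi> r * N))"
    and max: "dyadic_maximal \<alpha> h x \<le> ennreal S"
  shows "radial_potential \<alpha> w h x
    \<le> ennreal ((2 powr (2 * \<alpha> + 2) + E) * C0 * (N * (S / N) powr s))"
proof -
  define B where "B = (2::real) powr (2 * \<alpha> + 2)"
  have B: "B > 0" by (simp add: B_def)
  have mean': "ball_mean \<alpha> h x t \<le> ennreal (B * S)" if "t > 0" for t
  proof -
    have "ball_mean \<alpha> h x t \<le> ennreal B * dyadic_maximal \<alpha> h x"
      unfolding B_def by (rule ball_mean_le_dyadic_maximal[OF \<alpha> that])
    also have "\<dots> \<le> ennreal B * ennreal S" by (intro mult_left_mono max) simp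
    finally show ?thesis using B S by (simp add: ennreal_mult)
  qed
  show ?thesis
  proof (cases "S = 0")
    case True
    then have "radial_potential \<alpha> w h x = (\<integral>\<^sup>+t. 0 \<partial>(lborel::real measure))"
      using mean' by (intro nn_integral_cong) auto
    then show ?thesis by simp
  next
    case False
    then have "S / N > 0" using S N by simp
    then obtain r where r: "r > 0" "\<phi> r = S / N" using surj by blast
    have SN: "S = N * \<phi> r" using r N by simp
    let ?W1 = "\<integral>\<^sup>+t\<in>{0<..<r}. w t \<partial>lebesgue" and ?W2 = "\<integral>\<^sup>+t\<in>{r<..}. w t * ennreal (\<phi> t) \<partial>lebesgue"
    define F1 where "F1 t = w t * indicator {0<..<r} t" for t
    define F2 where "F2 t = w t * ennreal (\<phi> t) * indicator {r<..} t" for t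
    have [measurable]: "F1 \<in> borel_measurable lebesgue"
      unfolding F1_def by (rule measurable_completion) simp
    have [measurable]: "F2 \<in> borel_measurable lebesgue"
      unfolding F2_def by (rule w\<phi>[OF r(1)])
    have "radial_potential \<alpha> w h x
        = (\<integral>\<^sup>+t. (if 0 < t then w t * ball_mean \<alpha> h x t else 0) \<partial>lebesgue)"
      by (simp add: nn_integral_completion)
    also have "\<dots> \<le> (\<integral>\<^sup>+t. ennreal (B * S) * F1 t
        + ennreal (E * N) * F2 t \<partial>lebesgue)"
    proof (rule nn_integral_mono_AE)
      have "AE t in lebesgue. t \<noteq> r" by (intro AE_completion AE_lborel_singleton)
      then show "AE t in lebesgue. (if 0 < t then w t * ball_mean \<alpha> h x t else 0)
          \<le> ennreal (B * S) * F1 t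
            + ennreal (E * N) * F2 t"
      proof eventually_elim
        case (elim t)
        consider "t \<le> 0" | "0 < t" "t < r" | "r < t" using elim by linarith
        then show ?case
        proof cases
          case 2
          then show ?thesis using mult_left_mono[OF mean'[of t], of "w t"] by (simp add: F1_def mult.commute add_increasing2)
        next
          case 3
          have "w t * ball_mean \<alpha> h x t \<le> w t * ennreal (E * N * \<phi> t)"
            using mean[of t] 3 r by (intro mult_left_mono) (auto simp: mult_ac)
          also have "\<dots> = ennreal (E * N) * (w t * ennreal (\<phi> t))"
            using E N \<phi>_pos 3 r by (subst ennreal_mult) (auto simp: mult_ac less_imp_le)
          finally show ?thesis using 3 r by (simp add: F2_def add_increasing)
        qed simp
      qed
    qed
    also have "\<dots> = (\<integral>\<^sup>+t. ennreal (B * S) * F1 t \<partial>lebesgue)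
        + (\<integral>\<^sup>+t. ennreal (E * N) * F2 t \<partial>lebesgue)"
      by (rule nn_integral_add) measurable
    also have "(\<integral>\<^sup>+t. ennreal (B * S) * F1 t \<partial>lebesgue) = ennreal (B * S) * ?W1"
      unfolding F1_def[symmetric] by (rule nn_integral_cmult) measurable
    also have "(\<integral>\<^sup>+t. ennreal (E * N) * F2 t \<partial>lebesgue) = ennreal (E * N) * ?W2"
      unfolding F2_def[symmetric] by (rule nn_integral_cmult) measurable
    also have "ennreal (B * S) * ?W1 + ennreal (E * N) * ?W2
        \<le> ennreal ((B + E) * N) * (ennreal (\<phi> r) * ?W1) + ennreal ((B + E) * N) * ?W2"
    proof (intro add_mono mult_right_mono)
      have \<phi>r: "\<phi> r > 0" using \<phi>_pos r(1) by blast
      then have "B * (N * \<phi> r) \<le> (B + E) * N * \<phi> r"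
        using E N by (simp add: algebra_simps)
      then have "ennreal (B * S) \<le> ennreal ((B + E) * N * \<phi> r)"
        unfolding SN by (rule ennreal_leI)
      also have "\<dots> = ennreal ((B + E) * N) * ennreal (\<phi> r)"
        using B E N \<phi>r by (intro ennreal_mult) auto
      finally have "ennreal (B * S) \<le> ennreal ((B + E) * N) * ennreal (\<phi> r)" .
      then show "ennreal (B * S) * ?W1 \<le> ennreal ((B + E) * N) * (ennreal (\<phi> r) * ?W1)"
        unfolding mult.assoc[symmetric] by (rule mult_right_mono) simp
      show "ennreal (E * N) \<le> ennreal ((B + E) * N)" using B N by (intro ennreal_leI mult_right_mono) auto
    qed simp
    also have "\<dots> = ennreal ((B + E) * N) * (ennreal (\<phi> r) * ?W1 + ?W2)" by (simp add: distrib_left)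
    also have "\<dots> \<le> ennreal ((B + E) * N) * ennreal (C0 * \<phi> r powr s)"
      by (intro mult_left_mono cond r) simp
    also have "\<dots> = ennreal ((B + E) * C0 * (N * (S / N) powr s))"
      using B E N C0 r by (simp add: mult_ac flip: ennreal_mult)
    finally show ?thesis by (simp add: B_def)
  qed
qed

section \<open>The potential of a doubling kernel\<close>

text \<open>On an exceptional null set the representative is set to zero, so that it lies below \<open>\<rho>\<close> everywhere on the
  half-line.\<close>

lemma borel_minorant:
  fixes \<rho> :: "real \<Rightarrow> real"
  assumes \<rho>: "\<rho> \<in> borel_measurable (lebesgue_on {0<..})" and pos: "\<And>t. t > 0 \<Longrightarrow> \<rho> t > 0"
  obtains \<rho>' where "\<rho>' \<in> borel_measurable borel" "\<And>t. 0 \<le> \<rho>' t" "\<And>t. t > 0 \<Longrightarrow> \<rho>' t \<le> \<rho> t"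
    "AE t in lborel. t > 0 \<longrightarrow> \<rho>' t = \<rho> t"
proof -
  define \<rho>0 where "\<rho>0 t = (if t \<in> {0<..} then \<rho> t else 0)" for t
  have "\<rho>0 \<in> borel_measurable lebesgue"
    unfolding \<rho>0_def using \<rho> by (subst borel_measurable_if) auto
  from completion_ex_borel_measurable_real[OF this]
  obtain \<rho>1 where \<rho>1: "\<rho>1 \<in> borel_measurable lborel" and ae: "AE t in lborel. \<rho>0 t = \<rho>1 t" by blast
  from ae obtain Z where Z: "{t\<in>space lborel. \<not> \<rho>0 t = \<rho>1 t} \<subseteq> Z" "emeasure lborel Z = 0" "Z \<in> sets lborel"
    by (rule AE_E)
  have [measurable]: "\<rho>1 \<in> borel_measurable borel" "Z \<in> sets borel" using \<rho>1 Z by simp_all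
  define \<rho>' where "\<rho>' t = (if t \<in> Z \<or> t \<le> 0 then 0 else \<rho>1 t)" for t
  have eq: "\<rho>' t = \<rho> t" if "t \<notin> Z" "t > 0" for t
  proof -
    have "\<rho>0 t = \<rho>1 t" using that Z(1) by auto
    then show ?thesis using that by (simp add: \<rho>'_def \<rho>0_def)
  qed
  have cases: "\<rho>' t = 0 \<or> t > 0 \<and> \<rho>' t = \<rho> t" for t
    using eq[of t] by (auto simp: \<rho>'_def)
  show ?thesis
  proof (rule that[of \<rho>'])
    show "\<rho>' \<in> borel_measurable borel" unfolding \<rho>'_def by measurable
    show "0 \<le> \<rho>' t" for t using cases[of t] pos[of t] by auto
    show "\<rho>' t \<le> \<rho> t" if "t > 0" for t using cases[of t] pos[of t] that by auto
    have "AE t in lborel. t \<notin> Z" using Z by (intro AE_not_in) (simp add: null_sets_def)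
    then show "AE t in lborel. t > 0 \<longrightarrow> \<rho>' t = \<rho> t" by eventually_elim (use eq in blast)
  qed
qed

text \<open>The kernel is a superposition of indicator functions of balls with weights \<open>\<rho>(t) / t\<^bsup>d+1\<^esup>\<close>. Translating these turns
  it into a superposition of ball kernels, each bounded by \<open>t\<^sup>d\<close> times means over balls around \<open>x\<close> and \<open>-x\<close>.\<close>

lemma potential_le:
  assumes \<alpha>: "\<alpha> \<ge> -1/2" and pos: "\<And>t. t > 0 \<Longrightarrow> \<rho> t > 0" and doub: "doubling \<rho>"
    and [measurable]: "\<rho>' \<in> borel_measurable borel" and \<rho>'0: "\<And>t. 0 \<le> \<rho>' t"
    and \<rho>'_le: "\<And>t. t > 0 \<Longrightarrow> \<rho>' t \<le> \<rho> t" and ae: "AE t in lborel. t > 0 \<longrightarrow> \<rho>' t = \<rho> t"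
  obtains C where "C > 0"
    "\<And>h x. h \<in> borel_measurable borel \<Longrightarrow>
      (\<integral>\<^sup>+y. h y * ennreal \<bar>dunkl_translation \<alpha> x (dunkl_kernel \<alpha> \<rho>') y\<bar> \<partial>dunkl_borel \<alpha>)
        \<le> ennreal C * (radial_potential \<alpha> (\<lambda>t. ennreal (\<rho>' t / t)) h x
            + radial_potential \<alpha> (\<lambda>t. ennreal (\<rho>' t / t)) h (- x))"
proof -
  let ?\<nu> = "dunkl_borel \<alpha>"
  interpret N: sigma_finite_measure ?\<nu> by (rule sigma_finite_dunkl_borel)
  interpret P: pair_sigma_finite lborel ?\<nu> by standard
  define d where "d = dunkl_dim \<alpha>"
  have d: "d > 0" using \<alpha> by (simp add: d_def dunkl_dim_def)
  obtain B where B: "B > 0" "\<And>g r x. g \<in> borel_measurable borel \<Longrightarrow> r > 0 \<Longrightarrow>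
       (\<integral>\<^sup>+y. g y * ball_kernel \<alpha> r x y \<partial>?\<nu>)
         \<le> ennreal (B * r powr dunkl_dim \<alpha>) * (ball_mean \<alpha> g x r + ball_mean \<alpha> g (- x) r)"
    using nn_integral_ball_kernel_le[OF \<alpha>] by blast
  obtain c where c: "c > 0" "\<And>r s. r > 0 \<Longrightarrow> s > 0 \<Longrightarrow> 1/2 \<le> r / s \<Longrightarrow> r / s \<le> 2 \<Longrightarrow> \<rho> r / \<rho> s \<le> c"
    using doub unfolding doubling_def by blast
  define L where "L = c * 2 powr (d + 1)"
  have L: "L > 0" using c by (simp add: L_def)
  define k where "k = dunkl_kernel \<alpha> \<rho>'"
  have [measurable]: "k \<in> borel_measurable borel" unfolding k_def dunkl_kernel_def by measurable
  have k0: "0 \<le> k z" and k_even: "k (- z) = k z" for z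
    using \<rho>'0 by (simp_all add: k_def dunkl_kernel_def)
  define w where "w t = (if 0 < t then ennreal (L * \<rho>' t / t powr (d + 1)) else 0)" for t
  have [measurable]: "w \<in> borel_measurable borel" unfolding w_def by measurable
  have [measurable]: "(\<lambda>(t, y). ball_kernel \<alpha> t x y) \<in> borel_measurable (borel \<Otimes>\<^sub>M borel)" for x
    unfolding split_beta by (rule ball_kernel_measurable[OF \<alpha>]) measurable
  \<comment> \<open>By doubling, the kernel at \<open>z\<close> is dominated by its average over the radii in \<open>(\<bar>z\<bar>, 2 \<bar>z\<bar>)\<close>.\<close>
  have kw: "ennreal (k z) \<le> (\<integral>\<^sup>+t. w t * (if \<bar>z\<bar> < t then 1 else 0) \<partial>lborel)" for z
  proof (cases "z = 0")
    case True
    then show ?thesis by (simp add: k_def dunkl_kernel_def)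
  next
    case False
    define A where "A = \<bar>z\<bar>"
    have A: "A > 0" using False by (simp add: A_def)
    have "k z \<le> \<rho> A / A powr (d + 1) * A"
    proof -
      have "\<rho> A / A powr (d + 1) * A = \<rho> A / A powr d" using A by (simp add: powr_add)
      then show ?thesis using \<rho>'_le[OF A] A
        by (simp add: k_def dunkl_kernel_def A_def[symmetric] d_def[symmetric] divide_right_mono)
    qed
    then have "ennreal (k z) \<le> ennreal (\<rho> A / A powr (d + 1) * A)" by (rule ennreal_leI)
    also have "\<dots> = ennreal (\<rho> A / A powr (d + 1)) * emeasure lborel {A<..<2 * A}"
      using A pos[OF A] by (subst ennreal_mult) auto
    also have "\<dots> = (\<integral>\<^sup>+t. ennreal (\<rho> A / A powr (d + 1)) * indicator {A<..<2 * A} t \<partial>lborel)"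
      by (rule nn_integral_cmult_indicator[symmetric]) simp
    also have "\<dots> \<le> (\<integral>\<^sup>+t. w t * (if \<bar>z\<bar> < t then 1 else 0) \<partial>lborel)"
    proof (rule nn_integral_mono_AE)
      show "AE t in lborel. ennreal (\<rho> A / A powr (d + 1)) * indicator {A<..<2 * A} t \<le> w t * (if \<bar>z\<bar> < t then 1 else 0)"
        using ae
      proof eventually_elim
        case (elim t)
        show ?case
        proof (cases "A < t \<and> t < 2 * A")
          case True
          then have t: "t > 0" "\<rho>' t = \<rho> t" using A elim by auto
          have "\<rho> A / \<rho> t \<le> c" using True A t by (intro c(2)) (auto simp: field_simps)
          then have "\<rho> A \<le> c * \<rho> t" using pos[OF t(1)] by (simp add: field_simps)
          moreover have "t powr (d + 1) \<le> (2 * A) powr (d + 1)" using True t d by (intro powr_mono2) auto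
          then have "t powr (d + 1) \<le> 2 powr (d + 1) * A powr (d + 1)" by (simp only: powr_mult)
          ultimately have "\<rho> A * t powr (d + 1) \<le> (c * \<rho> t) * (2 powr (d + 1) * A powr (d + 1))"
            using pos[OF A] pos[OF t(1)] c(1) by (intro mult_mono) auto
          then have "\<rho> A / A powr (d + 1) \<le> L * \<rho>' t / t powr (d + 1)"
            using A t unfolding L_def by (simp add: field_simps)
          then show ?thesis using True t by (simp add: w_def A_def ennreal_leI)
        qed simp
      qed
    qed
    finally show ?thesis .
  qed
  have "(\<integral>\<^sup>+y. h y * ennreal \<bar>dunkl_translation \<alpha> x k y\<bar> \<partial>?\<nu>)
        \<le> ennreal (L * B) * (radial_potential \<alpha> (\<lambda>t. ennreal (\<rho>' t / t)) h x
            + radial_potential \<alpha> (\<lambda>t. ennreal (\<rho>' t / t)) h (- x))"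
    if [measurable]: "h \<in> borel_measurable borel" for h x
  proof -
    have "(\<integral>\<^sup>+y. h y * ennreal \<bar>dunkl_translation \<alpha> x k y\<bar> \<partial>?\<nu>)
        \<le> (\<integral>\<^sup>+y. h y * (\<integral>\<^sup>+t. w t * ball_kernel \<alpha> t x y \<partial>lborel) \<partial>?\<nu>)"
      by (intro nn_integral_mono mult_left_mono translation_le_ball_kernels \<alpha> k0 k_even kw) simp_all
    also have "\<dots> = (\<integral>\<^sup>+y. \<integral>\<^sup>+t. h y * (w t * ball_kernel \<alpha> t x y) \<partial>lborel \<partial>?\<nu>)"
      by (intro nn_integral_cong nn_integral_cmult[symmetric]) measurable
    also have "\<dots> = (\<integral>\<^sup>+t. \<integral>\<^sup>+y. h y * (w t * ball_kernel \<alpha> t x y) \<partial>?\<nu> \<partial>lborel)"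
      by (rule P.Fubini') measurable
    also have "\<dots> \<le> (\<integral>\<^sup>+t. ennreal (L * B) * ((if 0 < t then ennreal (\<rho>' t / t) * ball_mean \<alpha> h x t else 0)
          + (if 0 < t then ennreal (\<rho>' t / t) * ball_mean \<alpha> h (- x) t else 0)) \<partial>lborel)"
    proof (rule nn_integral_mono)
      fix t :: real
      show "(\<integral>\<^sup>+y. h y * (w t * ball_kernel \<alpha> t x y) \<partial>?\<nu>)
        \<le> ennreal (L * B) * ((if 0 < t then ennreal (\<rho>' t / t) * ball_mean \<alpha> h x t else 0)
          + (if 0 < t then ennreal (\<rho>' t / t) * ball_mean \<alpha> h (- x) t else 0))"
      proof (cases "t > 0")
        case True
        have [measurable]: "(\<lambda>y. ball_kernel \<alpha> t x y) \<in> borel_measurable borel"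
          by (rule ball_kernel_measurable[OF \<alpha>]) measurable
        have "(\<integral>\<^sup>+y. h y * (w t * ball_kernel \<alpha> t x y) \<partial>?\<nu>) = (\<integral>\<^sup>+y. w t * (h y * ball_kernel \<alpha> t x y) \<partial>?\<nu>)"
          by (simp only: mult_ac)
        also have "\<dots> = w t * (\<integral>\<^sup>+y. h y * ball_kernel \<alpha> t x y \<partial>?\<nu>)"
          by (rule nn_integral_cmult) measurable
        also have "\<dots> \<le> w t * (ennreal (B * t powr d) * (ball_mean \<alpha> h x t + ball_mean \<alpha> h (- x) t))"
          unfolding d_def by (intro mult_left_mono B(2) True) simp_all
        also have "\<dots> = (w t * ennreal (B * t powr d)) * (ball_mean \<alpha> h x t + ball_mean \<alpha> h (- x) t)"
          by (simp only: mult.assoc)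
        also have "w t * ennreal (B * t powr d) = ennreal (L * B) * ennreal (\<rho>' t / t)"
        proof -
          have "w t * ennreal (B * t powr d) = ennreal (L * \<rho>' t / t powr (d + 1) * (B * t powr d))"
            using True L B \<rho>'0[of t] by (simp add: w_def flip: ennreal_mult)
          also have "L * \<rho>' t / t powr (d + 1) * (B * t powr d) = L * B * (\<rho>' t / t)"
            using True by (simp add: powr_add)
          finally show ?thesis using True L B \<rho>'0[of t] by (simp flip: ennreal_mult)
        qed
        finally show ?thesis using True by (simp add: distrib_left mult.assoc)
      qed (simp add: w_def)
    qed
    also have "\<dots> = ennreal (L * B) * (\<integral>\<^sup>+t. (if 0 < t then ennreal (\<rho>' t / t) * ball_mean \<alpha> h x t else 0)
          + (if 0 < t then ennreal (\<rho>' t / t) * ball_mean \<alpha> h (- x) t else 0) \<partial>lborel)"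
      by (rule nn_integral_cmult) measurable
    also have "(\<integral>\<^sup>+t. (if 0 < t then ennreal (\<rho>' t / t) * ball_mean \<alpha> h x t else 0)
          + (if 0 < t then ennreal (\<rho>' t / t) * ball_mean \<alpha> h (- x) t else 0) \<partial>lborel)
        = radial_potential \<alpha> (\<lambda>t. ennreal (\<rho>' t / t)) h x
          + radial_potential \<alpha> (\<lambda>t. ennreal (\<rho>' t / t)) h (- x)"
      by (rule nn_integral_add) measurable
    finally show ?thesis .
  qed
  moreover have "L * B > 0" using L B by simp
  ultimately show ?thesis using that unfolding k_def by blast
qed

section \<open>Boundedness of the fractional integral\<close>

lemma complex_borel_representative:
  fixes f :: "real \<Rightarrow> complex"
  assumes \<alpha>: "\<alpha> \<ge> -1/2" and f: "f \<in> borel_measurable (dunkl_measure \<alpha>)"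
  obtains f' where "f' \<in> borel_measurable borel" "AE x in lborel. f x = f' x"
proof -
  let ?\<nu> = "dunkl_borel \<alpha>"
  have [measurable]: "f \<in> borel_measurable (completion ?\<nu>)"
    using f by (simp add: dunkl_measure_eq_completion[OF \<alpha>])
  have "(\<lambda>x. Re (f x)) \<in> borel_measurable (completion ?\<nu>)" "(\<lambda>x. Im (f x)) \<in> borel_measurable (completion ?\<nu>)"
    by measurable
  then obtain g k where g: "g \<in> borel_measurable ?\<nu>" "AE x in ?\<nu>. Re (f x) = g x"
    and k: "k \<in> borel_measurable ?\<nu>" "AE x in ?\<nu>. Im (f x) = k x"
    using completion_ex_borel_measurable_real by metis
  have [measurable]: "g \<in> borel_measurable borel" "k \<in> borel_measurable borel"
    using g(1) k(1) by (simp_all cong: measurable_cong_sets)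
  have "AE x in ?\<nu>. f x = Complex (g x) (k x)"
    using g(2) k(2) by eventually_elim (simp add: complex_eq_iff)
  then have "AE x in lborel. f x = Complex (g x) (k x)"
    by (simp add: AE_dunkl_borel_iff[OF \<alpha>])
  moreover have "(\<lambda>x. Complex (g x) (k x)) \<in> borel_measurable borel"
  proof -
    have "(\<lambda>x. complex_of_real (g x) + \<i> * complex_of_real (k x)) \<in> borel_measurable borel" by measurable
    then show ?thesis by (simp add: Complex_eq)
  qed
  ultimately show ?thesis using that by blast
qed

lemma AE_lborel_uminus:
  fixes P :: "real \<Rightarrow> bool"
  assumes "AE x in lborel. P x"
  shows "AE x in lborel. P (- x)"
proof -
  have "AE x in distr lborel borel uminus. P x" using assms by (subst lborel_distr_uminus)
  then show ?thesis by (rule AE_distrD[rotated]) simp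
qed

lemma nn_integral_dunkl_borel_uminus:
  assumes [measurable]: "u \<in> borel_measurable borel"
  shows "(\<integral>\<^sup>+y. u (- y) \<partial>dunkl_borel \<alpha>) = (\<integral>\<^sup>+y. u y \<partial>dunkl_borel \<alpha>)"
proof -
  define a where "a = dunkl_weight \<alpha>"
  let ?v = "\<lambda>y. ennreal (a * \<bar>y\<bar> powr (2 * \<alpha> + 1)) * u y"
  have "(\<integral>\<^sup>+y. u y \<partial>dunkl_borel \<alpha>) = (\<integral>\<^sup>+y. ?v y \<partial>lborel)"
    unfolding a_def by (rule nn_integral_dunkl_borel) simp
  also have "\<dots> = ennreal \<bar>-1\<bar> * (\<integral>\<^sup>+y. ?v (0 + -1 * y) \<partial>lborel)"
    by (rule nn_integral_real_affine) auto
  also have "\<dots> = (\<integral>\<^sup>+y. ennreal (a * \<bar>y\<bar> powr (2 * \<alpha> + 1)) * u (- y) \<partial>lborel)" by simp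
  also have "\<dots> = (\<integral>\<^sup>+y. u (- y) \<partial>dunkl_borel \<alpha>)"
    unfolding a_def by (rule nn_integral_dunkl_borel[symmetric]) simp
  finally show ?thesis ..
qed

lemma dunkl_frac_integrand_AE:
  fixes f f' :: "real \<Rightarrow> complex"
  assumes \<alpha>: "\<alpha> \<ge> -1/2" and ae_f: "AE y in lborel. f y = f' y"
    and ae_\<rho>: "AE t in lborel. t > 0 \<longrightarrow> \<rho>' t = \<rho> t"
  shows "AE y in completion (dunkl_borel \<alpha>).
    f' y * complex_of_real (dunkl_translation \<alpha> x (dunkl_kernel \<alpha> \<rho>') y) = dunkl_frac_integrand \<alpha> \<rho> f x y"
proof -
  have "AE z in lborel. z \<noteq> (0::real)" by (rule AE_lborel_singleton)
  with ae_\<rho> AE_lborel_uminus[OF ae_\<rho>] have "AE z in lborel. dunkl_kernel \<alpha> \<rho> z = dunkl_kernel \<alpha> \<rho>' z"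
    by eventually_elim (auto simp: dunkl_kernel_def abs_if)
  from dunkl_translation_cong_AE[OF this, of \<alpha> x] ae_f
  have "AE y in lborel. f' y * complex_of_real (dunkl_translation \<alpha> x (dunkl_kernel \<alpha> \<rho>') y) = dunkl_frac_integrand \<alpha> \<rho> f x y"
    by eventually_elim (simp add: dunkl_frac_integrand_def)
  then show ?thesis by (simp add: AE_completion_iff AE_dunkl_borel_iff[OF \<alpha>])
qed

lemma sum_powr_le:
  fixes a b q :: real
  assumes "0 \<le> a" "0 \<le> b" "q > 0"
  shows "(a + b) powr q \<le> 2 powr q * (a powr q + b powr q)"
proof -
  have "(a + b) powr q \<le> (2 * max a b) powr q" using assms by (intro powr_mono2) auto
  also have "\<dots> = 2 powr q * max a b powr q" by (rule powr_mult)
  also have "max a b powr q \<le> a powr q + b powr q" by (auto simp: max_def)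
  finally show ?thesis by simp
qed

theorem theorem6p1:
  fixes \<alpha> p q C0 :: real and \<rho> \<phi> :: "real \<Rightarrow> real"
  assumes "\<alpha> \<ge> -1/2" and "1 < p" and "p < q"
    and "\<rho> \<in> {0<..} \<rightarrow> {0<..}"
    and "\<rho> \<in> borel_measurable (lebesgue_on {0<..})"
    and "doubling \<rho>"
    and "(\<integral>\<^sup>+t\<in>{0<..<1}. ennreal (\<rho> t / t) \<partial>lebesgue) < \<infinity>"
    and "\<phi> \<in> {0<..} \<rightarrow> {0<..}"
    and "\<phi> \<in> borel_measurable (lebesgue_on {0<..})"
    and "almost_decreasing \<phi>"
    and "almost_increasing (\<lambda>r. r powr (dunkl_dim \<alpha> / p) * \<phi> r)"
    and "doubling \<phi>"
    and "\<phi> ` {0<..} = {0<..}"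
    and "C0 > 0"
    and "\<And>r. r > 0 \<Longrightarrow>
      ennreal (\<phi> r) * (\<integral>\<^sup>+t\<in>{0<..<r}. ennreal (\<rho> t / t) \<partial>lebesgue)
        + (\<integral>\<^sup>+t\<in>{r<..}. ennreal (\<rho> t * \<phi> t / t) \<partial>lebesgue)
      \<le> ennreal (C0 * \<phi> r powr (p / q))"
  shows "\<exists>C>0. \<forall>f \<in> morrey_space \<alpha> p \<phi>.
      (AE x in dunkl_measure \<alpha>. integrable (dunkl_measure \<alpha>) (dunkl_frac_integrand \<alpha> \<rho> f x)) \<and>
      dunkl_frac_integral \<alpha> \<rho> f \<in> morrey_space \<alpha> q (\<lambda>r. \<phi> r powr (p / q)) \<and>
      morrey_norm \<alpha> q (\<lambda>r. \<phi> r powr (p / q)) (dunkl_frac_integral \<alpha> \<rho> f)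
        \<le> ennreal C * morrey_norm \<alpha> p \<phi> f"
proof -
  note \<alpha> = assms(1) and p = assms(2) and pq = assms(3) and C0 = assms(14)
  have q: "q > 1" and p0: "p > 0" and q0: "q > 0" using p pq by auto
  let ?\<nu> = "dunkl_borel \<alpha>" and ?\<psi> = "\<lambda>r. \<phi> r powr (p / q)"
  interpret N: sigma_finite_measure ?\<nu> by (rule sigma_finite_dunkl_borel)
  have \<rho>_pos: "\<rho> t > 0" if "t > 0" for t using assms(4) that by auto
  have \<phi>_pos: "\<forall>r>0. \<phi> r > 0" using assms(8) by auto
  have \<psi>_pos: "\<forall>r>0. ?\<psi> r > 0" using \<phi>_pos by force
  have surj: "\<exists>r>0. \<phi> r = t" if "t > 0" for t
  proof -
    have "t \<in> \<phi> ` {0<..}" using assms(13) that by simp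
    then show ?thesis by auto
  qed
  obtain a where a: "a > 0" "\<forall>r s. 0 < r \<and> r \<le> s \<longrightarrow> a * \<phi> s \<le> \<phi> r"
    using assms(10) unfolding almost_decreasing_def by blast
  define A where "A = 1 / a"
  have A: "A > 0" using a by (simp add: A_def)
  have dec: "\<forall>r s. 0 < r \<longrightarrow> r \<le> s \<longrightarrow> \<phi> s \<le> A * \<phi> r"
    using a by (auto simp: A_def field_simps)
  obtain \<rho>' where \<rho>'[measurable]: "\<rho>' \<in> borel_measurable borel" and \<rho>'0: "\<And>t. 0 \<le> \<rho>' t"
    and \<rho>'_le: "\<And>t. t > 0 \<Longrightarrow> \<rho>' t \<le> \<rho> t" and \<rho>'_ae: "AE t in lborel. t > 0 \<longrightarrow> \<rho>' t = \<rho> t"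
    using borel_minorant[OF assms(5) \<rho>_pos] by blast
  define w where "w t = ennreal (\<rho>' t / t)" for t
  have [measurable]: "w \<in> borel_measurable borel" unfolding w_def by measurable
  have w\<phi>: "(\<lambda>t. w t * ennreal (\<phi> t) * indicator {r<..} t) \<in> borel_measurable lebesgue" if "r > 0" for r
  proof -
    define \<phi>0 where "\<phi>0 t = (if t \<in> {0<..} then \<phi> t else 0)" for t
    have [measurable]: "\<phi>0 \<in> borel_measurable lebesgue"
      unfolding \<phi>0_def using assms(9) by (subst borel_measurable_if) auto
    define v where "v t = w t * indicator {r<..} t" for t
    have [measurable]: "v \<in> borel_measurable lebesgue"
      unfolding v_def by (rule measurable_completion) simp
    have "(\<lambda>t. v t * ennreal (\<phi>0 t)) \<in> borel_measurable lebesgue" by measurable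
    moreover have "(\<lambda>t. w t * ennreal (\<phi> t) * indicator {r<..} t) = (\<lambda>t. v t * ennreal (\<phi>0 t))"
      using that by (auto simp: v_def \<phi>0_def indicator_def)
    ultimately show ?thesis by simp
  qed
  have cond: "ennreal (\<phi> r) * (\<integral>\<^sup>+t\<in>{0<..<r}. w t \<partial>lebesgue) + (\<integral>\<^sup>+t\<in>{r<..}. w t * ennreal (\<phi> t) \<partial>lebesgue)
      \<le> ennreal (C0 * \<phi> r powr (p / q))" if r: "r > 0" for r
  proof -
    have "(\<integral>\<^sup>+t\<in>{0<..<r}. w t \<partial>lebesgue) \<le> (\<integral>\<^sup>+t\<in>{0<..<r}. ennreal (\<rho> t / t) \<partial>lebesgue)"
      using \<rho>'_le by (intro nn_integral_mono) (auto simp: w_def indicator_def intro!: ennreal_leI divide_right_mono)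
    moreover have "(\<integral>\<^sup>+t\<in>{r<..}. w t * ennreal (\<phi> t) \<partial>lebesgue) \<le> (\<integral>\<^sup>+t\<in>{r<..}. ennreal (\<rho> t * \<phi> t / t) \<partial>lebesgue)"
    proof (rule nn_integral_mono)
      fix t
      show "w t * ennreal (\<phi> t) * indicator {r<..} t \<le> ennreal (\<rho> t * \<phi> t / t) * indicator {r<..} t"
      proof (cases "r < t")
        case True
        then have t: "t > 0" using r by simp
        have \<phi>t: "\<phi> t > 0" using \<phi>_pos t by blast
        have "w t * ennreal (\<phi> t) = ennreal (\<rho>' t / t * \<phi> t)"
          unfolding w_def using \<phi>t t \<rho>'0[of t] by (subst ennreal_mult) auto
        also have "\<dots> \<le> ennreal (\<rho> t / t * \<phi> t)"
          using \<rho>'_le[OF t] t \<phi>t by (intro ennreal_leI mult_right_mono divide_right_mono) auto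
        finally show ?thesis using True by simp
      qed simp
    qed
    ultimately show ?thesis
      using assms(15)[OF r] by (meson add_mono mult_left_mono order_trans zero_le)
  qed
  obtain D where D: "D > 0" and bound_of_norm:
    "\<And>\<phi> N (f :: real \<Rightarrow> complex) f'. f' \<in> borel_measurable borel \<Longrightarrow> AE z in lborel. f z = f' z \<Longrightarrow>
       (\<forall>K. compact K \<longrightarrow> set_integrable (dunkl_measure \<alpha>) K (\<lambda>x. norm (f x) powr p)) \<Longrightarrow>
       (\<forall>r>0. \<phi> r > 0) \<Longrightarrow> (\<forall>r s. 0 < r \<longrightarrow> r \<le> s \<longrightarrow> \<phi> s \<le> A * \<phi> r) \<Longrightarrow> N > 0 \<Longrightarrow>
       morrey_norm \<alpha> p \<phi> f \<le> ennreal N \<Longrightarrow>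
       morrey_bound \<alpha> p D (\<lambda>r. \<phi> r * N) (\<lambda>y. norm (f' y))"
    by (rule morrey_bound_of_norm[OF \<alpha> p0 A]) (rule that, assumption, blast)
  obtain E where E: "E > 0" and mean: "\<And>h u x r. h \<in> borel_measurable borel \<Longrightarrow>
       (\<forall>y. 0 \<le> h y) \<Longrightarrow> (\<forall>r>0. u r > 0) \<Longrightarrow> morrey_bound \<alpha> p D u h \<Longrightarrow> r > 0 \<Longrightarrow>
       ball_mean \<alpha> (\<lambda>y. ennreal (h y)) x r \<le> ennreal (E * u r)"
    by (rule morrey_bound_ball_mean_le[OF \<alpha> p D]) (rule that, assumption, blast)
  obtain F where F: "F > 0" and maximal: "\<And>h u x r. h \<in> borel_measurable borel \<Longrightarrow>
       (\<forall>y. 0 \<le> h y) \<Longrightarrow> (\<forall>r>0. u r > 0) \<Longrightarrow>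
       (\<forall>r s. 0 < r \<longrightarrow> r \<le> s \<longrightarrow> u s \<le> A * u r) \<Longrightarrow> morrey_bound \<alpha> p D u h \<Longrightarrow> r > 0 \<Longrightarrow>
       (ball_integral \<alpha> (\<lambda>z. layer_power p (dyadic_maximal \<alpha> (\<lambda>y. ennreal (h y)) z)) x r)
         \<le> ennreal (F * dunkl_vol \<alpha> x r * u r powr p)"
    by (rule maximal_morrey[OF \<alpha> p D A]) (rule that, assumption, blast)
  define k where "k = dunkl_kernel \<alpha> \<rho>'"
  have [measurable]: "k \<in> borel_measurable borel" unfolding k_def dunkl_kernel_def by measurable
  obtain P where P: "P > 0" and potential: "\<And>h x. h \<in> borel_measurable borel \<Longrightarrow>
      (\<integral>\<^sup>+y. h y * ennreal \<bar>dunkl_translation \<alpha> x k y\<bar> \<partial>?\<nu>)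
        \<le> ennreal P * (radial_potential \<alpha> w h x
            + radial_potential \<alpha> w h (- x))"
    using potential_le[OF \<alpha> \<rho>_pos assms(6) \<rho>' \<rho>'0 \<rho>'_le \<rho>'_ae] unfolding k_def w_def by blast
  define L where "L = P * ((2 powr (2 * \<alpha> + 2) + E) * C0)"
  have L: "L > 0" unfolding L_def using P E C0 by (intro mult_pos_pos add_pos_pos) auto
  define Q where "Q = 2 * F * (2 * L) powr q"
  have Q: "Q > 0" using F L by (simp add: Q_def)
  obtain C where C: "C > 0" and norm_of_bound: "\<And>\<psi> N (f :: real \<Rightarrow> complex). f \<in> borel_measurable borel \<Longrightarrow>
       (\<forall>r>0. \<psi> r > 0) \<Longrightarrow> N > 0 \<Longrightarrow> morrey_bound \<alpha> q Q (\<lambda>r. \<psi> r * N) (\<lambda>y. norm (f y)) \<Longrightarrow>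
       f \<in> morrey_space \<alpha> q \<psi> \<and> morrey_norm \<alpha> q \<psi> f \<le> ennreal (C * N)"
    by (rule morrey_norm_of_bound[OF \<alpha> q0 Q]) (rule that, assumption, blast)
  have main: "(AE x in dunkl_measure \<alpha>. integrable (dunkl_measure \<alpha>) (dunkl_frac_integrand \<alpha> \<rho> f x)) \<and>
      dunkl_frac_integral \<alpha> \<rho> f \<in> morrey_space \<alpha> q ?\<psi> \<and>
      morrey_norm \<alpha> q ?\<psi> (dunkl_frac_integral \<alpha> \<rho> f) \<le> ennreal (C * N)"
    if f: "f \<in> morrey_space \<alpha> p \<phi>" and N: "N > 0" and norm: "morrey_norm \<alpha> p \<phi> f \<le> ennreal N" for f N
  proof -
    obtain f' where f'[measurable]: "f' \<in> borel_measurable borel" and ae_f: "AE x in lborel. f x = f' x"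
      using complex_borel_representative[OF \<alpha>, of f] f unfolding morrey_space_def by blast
    define h where "h y = norm (f' y)" for y
    have [measurable]: "h \<in> borel_measurable borel" unfolding h_def by measurable
    have h0: "\<forall>y. 0 \<le> h y" by (simp add: h_def)
    let ?u = "\<lambda>r. \<phi> r * N" and ?M = "dyadic_maximal \<alpha> (\<lambda>y. ennreal (h y))"
    have bound: "morrey_bound \<alpha> p D ?u h"
      unfolding h_def by (rule bound_of_norm[OF f' ae_f _ \<phi>_pos dec N norm]) (use f in \<open>simp add: morrey_space_def\<close>)
    have u: "\<forall>r>0. ?u r > 0" using \<phi>_pos N by simp
    have u_dec: "\<forall>r s. 0 < r \<longrightarrow> r \<le> s \<longrightarrow> ?u s \<le> A * ?u r"
      using dec N by (simp add: mult.assoc[symmetric])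
    note max_bound = maximal[OF _ h0 u u_dec bound]
    have fin: "AE z in lborel. ?M z < \<infinity>"
    proof -
      have "AE z in ?\<nu>. (if \<bar>z - 0\<bar> < real (Suc n) then layer_power p (?M z) else 0) \<noteq> \<infinity>" for n
      proof (rule nn_integral_PInf_AE)
        have "ball_integral \<alpha> (\<lambda>z. layer_power p (?M z)) 0 (real (Suc n))
            \<le> ennreal (F * dunkl_vol \<alpha> 0 (real (Suc n)) * ?u (real (Suc n)) powr p)"
          by (rule max_bound) simp_all
        also have "\<dots> < \<infinity>" by simp
        finally show "ball_integral \<alpha> (\<lambda>z. layer_power p (?M z)) 0 (real (Suc n)) \<noteq> \<infinity>"
          by (simp add: less_top[symmetric])
      qed measurable
      then have "AE z in ?\<nu>. \<forall>n. (if \<bar>z - 0\<bar> < real (Suc n) then layer_power p (?M z) else 0) \<noteq> \<infinity>"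
        by (simp add: AE_all_countable)
      then have "AE z in ?\<nu>. ?M z < \<infinity>"
      proof eventually_elim
        case (elim z)
        obtain n :: nat where "\<bar>z\<bar> < real n" using reals_Archimedean2 by blast
        then have "\<bar>z - 0\<bar> < real (Suc n)" by simp
        with elim[rule_format, of n] have "layer_power p (?M z) < \<infinity>" by (simp add: less_top[symmetric])
        then show ?case by (rule layer_power_finite[rotated]) (use p in simp)
      qed
      then show ?thesis by (simp add: AE_dunkl_borel_iff[OF \<alpha>])
    qed
    define \<tau> where "\<tau> x y = f' y * complex_of_real (dunkl_translation \<alpha> x k y)" for x y
    have [measurable]: "(\<lambda>(x, y). \<tau> x y) \<in> borel_measurable (borel \<Otimes>\<^sub>M borel)"
      using dunkl_translation_measurable[OF \<alpha>, of k] unfolding \<tau>_def split_beta by measurable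
    have ae_\<tau>: "AE y in completion ?\<nu>. \<tau> x y = dunkl_frac_integrand \<alpha> \<rho> f x y" for x
      unfolding \<tau>_def k_def by (rule dunkl_frac_integrand_AE[OF \<alpha> ae_f \<rho>'_ae])
    define T where "T x = (LINT y|?\<nu>. \<tau> x y)" for x
    have [measurable]: "T \<in> borel_measurable borel" unfolding T_def by measurable
    have T_eq: "dunkl_frac_integral \<alpha> \<rho> f = T"
    proof
      fix x
      have [measurable]: "\<tau> x \<in> borel_measurable ?\<nu>" by measurable
      have "dunkl_frac_integral \<alpha> \<rho> f x = (LINT y|completion ?\<nu>. \<tau> x y)"
        unfolding dunkl_frac_integral_def dunkl_measure_eq_completion[OF \<alpha>]
        by (rule completion.integral_cong_AE_complete[OF ae_\<tau>, symmetric])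
      also have "\<dots> = T x" unfolding T_def by (rule integral_completion) simp
      finally show "dunkl_frac_integral \<alpha> \<rho> f x = T x" .
    qed
    \<comment> \<open>The potential is controlled by the maximal function at \<open>x\<close> and at the reflected point \<open>-x\<close>.\<close>
    have pointwise: "(\<integral>\<^sup>+y. ennreal (norm (\<tau> x y)) \<partial>?\<nu>)
        \<le> ennreal (L * N * ((enn2real (?M x) / N) powr (p / q) + (enn2real (?M (- x)) / N) powr (p / q)))"
      if "?M x < \<infinity>" "?M (- x) < \<infinity>" for x
    proof -
      let ?B = "(2 powr (2 * \<alpha> + 2) + E) * C0"
      have B: "?B > 0" using E C0 by (intro mult_pos_pos add_pos_pos) auto
      have hed: "radial_potential \<alpha> w (\<lambda>y. ennreal (h y)) z
          \<le> ennreal (?B * (N * (enn2real (?M z) / N) powr (p / q)))" if "?M z < \<infinity>" for z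
        using that
        by (intro hedberg_estimate[OF \<alpha> N _ C0 E _ _ w\<phi> \<phi>_pos surj cond] mean[OF _ h0 u bound]) simp_all
      have "(\<integral>\<^sup>+y. ennreal (norm (\<tau> x y)) \<partial>?\<nu>) = (\<integral>\<^sup>+y. ennreal (h y) * ennreal \<bar>dunkl_translation \<alpha> x k y\<bar> \<partial>?\<nu>)"
        by (simp add: \<tau>_def h_def norm_mult ennreal_mult)
      also have "\<dots> \<le> ennreal P * (radial_potential \<alpha> w (\<lambda>y. ennreal (h y)) x
            + radial_potential \<alpha> w (\<lambda>y. ennreal (h y)) (- x))"
        by (rule potential) simp
      also have "\<dots> \<le> ennreal P * (ennreal (?B * (N * (enn2real (?M x) / N) powr (p / q)))
            + ennreal (?B * (N * (enn2real (?M (- x)) / N) powr (p / q))))"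
        using that by (intro mult_left_mono add_mono hed) simp_all
      also have "\<dots> = ennreal (P * (?B * (N * (enn2real (?M x) / N) powr (p / q))
            + ?B * (N * (enn2real (?M (- x)) / N) powr (p / q))))"
        using P B N by (simp flip: ennreal_mult ennreal_plus)
      also have "P * (?B * (N * (enn2real (?M x) / N) powr (p / q)) + ?B * (N * (enn2real (?M (- x)) / N) powr (p / q)))
          = L * N * ((enn2real (?M x) / N) powr (p / q) + (enn2real (?M (- x)) / N) powr (p / q))"
        unfolding L_def by (simp only: algebra_simps)
      finally show ?thesis .
    qed
    have ae_fin: "AE x in lborel. ?M x < \<infinity> \<and> ?M (- x) < \<infinity>"
      using fin AE_lborel_uminus[OF fin] by eventually_elim simp
    have "AE x in lborel. integrable (dunkl_measure \<alpha>) (dunkl_frac_integrand \<alpha> \<rho> f x)"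
      using ae_fin
    proof eventually_elim
      case (elim x)
      have [measurable]: "\<tau> x \<in> borel_measurable ?\<nu>" by measurable
      have "(\<integral>\<^sup>+y. ennreal (norm (\<tau> x y)) \<partial>?\<nu>) < \<infinity>"
        using pointwise[of x] elim by (auto intro: order_le_less_trans)
      then have "integrable ?\<nu> (\<tau> x)" by (intro integrableI_bounded) simp_all
      then have int: "integrable (completion ?\<nu>) (\<tau> x)" by (simp add: integrable_completion)
      have "dunkl_frac_integrand \<alpha> \<rho> f x \<in> borel_measurable (completion ?\<nu>)"
        by (rule completion.measurable_AE_cong_complete[OF _ ae_\<tau>]) (use int in auto)
      then have "integrable (completion ?\<nu>) (dunkl_frac_integrand \<alpha> \<rho> f x)"
        using integrable_cong_AE[of "\<tau> x" "completion ?\<nu>" "dunkl_frac_integrand \<alpha> \<rho> f x"] int ae_\<tau>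
        by (simp add: borel_measurable_integrable)
      then show ?case by (simp add: dunkl_measure_eq_completion[OF \<alpha>])
    qed
    then have integrable: "AE x in dunkl_measure \<alpha>. integrable (dunkl_measure \<alpha>) (dunkl_frac_integrand \<alpha> \<rho> f x)"
      by (simp add: AE_dunkl_measure_iff[OF \<alpha>])
    define H where "H = (2 * L) powr q * N powr (q - p)"
    have H: "H > 0" using L N by (simp add: H_def)
    have T_powr: "AE x in ?\<nu>. ennreal (norm (T x) powr q) \<le> ennreal H * (layer_power p (?M x) + layer_power p (?M (- x)))"
    proof -
      have "AE x in ?\<nu>. ?M x < \<infinity> \<and> ?M (- x) < \<infinity>"
        using ae_fin by (simp add: AE_dunkl_borel_iff[OF \<alpha>])
      then show ?thesis
      proof eventually_elim
        case (elim x)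
        define S where "S = enn2real (?M x)"
        define S' where "S' = enn2real (?M (- x))"
        have S: "S \<ge> 0" "?M x = ennreal S" "S' \<ge> 0" "?M (- x) = ennreal S'"
          using elim by (simp_all add: S_def S'_def)
        let ?X = "(S / N) powr (p / q)" and ?X' = "(S' / N) powr (p / q)"
        have "ennreal (norm (T x)) \<le> ennreal (L * N * (?X + ?X'))"
        proof (cases "integrable ?\<nu> (\<tau> x)")
          case True
          have "ennreal (norm (T x)) \<le> (\<integral>\<^sup>+y. ennreal (norm (\<tau> x y)) \<partial>?\<nu>)"
            unfolding T_def by (rule integral_norm_bound_ennreal[OF True])
          also have "\<dots> \<le> ennreal (L * N * (?X + ?X'))"
            unfolding S_def S'_def using elim by (intro pointwise) auto
          finally show ?thesis .
        next
          case False
          then show ?thesis by (simp add: T_def not_integrable_integral_eq)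
        qed
        then have "norm (T x) \<le> L * N * (?X + ?X')"
          using L N by (subst (asm) ennreal_le_iff) auto
        then have "norm (T x) powr q \<le> (L * N * (?X + ?X')) powr q"
          using q by (intro powr_mono2) auto
        also have "\<dots> = (L * N) powr q * (?X + ?X') powr q" by (rule powr_mult)
        also have "\<dots> \<le> (L * N) powr q * (2 powr q * (?X powr q + ?X' powr q))"
          using q by (intro mult_left_mono sum_powr_le) auto
        also have "\<dots> = H * (S powr p + S' powr p)"
        proof -
          have *: "((R / N) powr (p / q)) powr q = R powr p / N powr p" for R
            using q by (simp add: powr_powr powr_divide)
          have "(L * N) powr q * (2 powr q * (R / N powr p + R' / N powr p)) = H * (R + R')" for R R'
            unfolding H_def powr_mult using N by (simp add: powr_diff field_simps)
          then show ?thesis unfolding * .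
        qed
        finally have "ennreal (norm (T x) powr q) \<le> ennreal (H * (S powr p + S' powr p))" by (rule ennreal_leI)
        also have "\<dots> = ennreal H * (layer_power p (?M x) + layer_power p (?M (- x)))"
          unfolding S(2,4) using S p H by (simp add: layer_power_ennreal ennreal_mult)
        finally show ?case .
      qed
    qed
    have "morrey_bound \<alpha> q Q (\<lambda>r. ?\<psi> r * N) (\<lambda>y. norm (T y))"
      unfolding morrey_bound_def
    proof (intro allI impI)
      fix x r :: real assume r: "r > 0"
      have V: "dunkl_vol \<alpha> x r > 0" by (rule dunkl_vol_pos[OF r])
      let ?G = "\<lambda>x z. (if \<bar>z - x\<bar> < r then layer_power p (?M z) else 0)"
      have "ball_integral \<alpha> (\<lambda>y. ennreal (norm (T y) powr q)) x r
          \<le> (\<integral>\<^sup>+y. ennreal H * (?G x y + ?G (- x) (- y)) \<partial>?\<nu>)"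
      proof (rule nn_integral_mono_AE)
        show "AE y in ?\<nu>. (if \<bar>y - x\<bar> < r then ennreal (norm (T y) powr q) else 0)
            \<le> ennreal H * (?G x y + ?G (- x) (- y))"
          using T_powr by eventually_elim (auto simp: abs_minus_commute)
      qed
      also have "\<dots> = ennreal H * (\<integral>\<^sup>+y. ?G x y + ?G (- x) (- y) \<partial>?\<nu>)"
        by (rule nn_integral_cmult) measurable
      also have "(\<integral>\<^sup>+y. ?G x y + ?G (- x) (- y) \<partial>?\<nu>) = (\<integral>\<^sup>+y. ?G x y \<partial>?\<nu>) + (\<integral>\<^sup>+y. ?G (- x) (- y) \<partial>?\<nu>)"
        by (rule nn_integral_add) measurable
      also have "(\<integral>\<^sup>+y. ?G (- x) (- y) \<partial>?\<nu>) = (\<integral>\<^sup>+y. ?G (- x) y \<partial>?\<nu>)"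
        by (rule nn_integral_dunkl_borel_uminus) measurable
      also have "ennreal H * ((\<integral>\<^sup>+y. ?G x y \<partial>?\<nu>) + (\<integral>\<^sup>+y. ?G (- x) y \<partial>?\<nu>))
          \<le> ennreal H * (ennreal (F * dunkl_vol \<alpha> x r * ?u r powr p) + ennreal (F * dunkl_vol \<alpha> (- x) r * ?u r powr p))"
        using r by (intro mult_left_mono add_mono max_bound) simp_all
      also have "\<dots> = ennreal (H * (F * dunkl_vol \<alpha> x r * ?u r powr p + F * dunkl_vol \<alpha> x r * ?u r powr p))"
        using H F V by (simp flip: ennreal_mult ennreal_plus)
      also have "H * (F * dunkl_vol \<alpha> x r * ?u r powr p + F * dunkl_vol \<alpha> x r * ?u r powr p)
          = Q * dunkl_vol \<alpha> x r * (?\<psi> r * N) powr q"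
      proof -
        have "(?\<psi> r * N) powr q = \<phi> r powr p * N powr q"
          unfolding powr_mult using q by (simp add: powr_powr)
        moreover have "N powr (q - p) * N powr p = N powr q" using N by (simp flip: powr_add)
        ultimately show ?thesis unfolding Q_def H_def powr_mult[of "\<phi> r"] by simp
      qed
      finally show "ball_integral \<alpha> (\<lambda>y. ennreal (norm (T y) powr q)) x r
          \<le> ennreal (Q * dunkl_vol \<alpha> x r * (?\<psi> r * N) powr q)" .
    qed
    from norm_of_bound[OF _ \<psi>_pos N this] show ?thesis using integrable unfolding T_eq by simp
  qed
  show ?thesis
  proof (intro exI[of _ C] conjI ballI C)
    fix f assume f: "f \<in> morrey_space \<alpha> p \<phi>"
    then obtain m where m: "m \<ge> 0" "morrey_norm \<alpha> p \<phi> f = ennreal m"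
      unfolding morrey_space_def by (cases "morrey_norm \<alpha> p \<phi> f") auto
    \<comment> \<open>The norm may vanish, so the estimate is applied to all larger bounds.\<close>
    have *: "(AE x in dunkl_measure \<alpha>. integrable (dunkl_measure \<alpha>) (dunkl_frac_integrand \<alpha> \<rho> f x)) \<and>
      dunkl_frac_integral \<alpha> \<rho> f \<in> morrey_space \<alpha> q ?\<psi> \<and>
      morrey_norm \<alpha> q ?\<psi> (dunkl_frac_integral \<alpha> \<rho> f) \<le> ennreal (C * (m + e))" if "e > 0" for e
      by (rule main[OF f]) (use m that in \<open>auto intro: ennreal_leI\<close>)
    show "AE x in dunkl_measure \<alpha>. integrable (dunkl_measure \<alpha>) (dunkl_frac_integrand \<alpha> \<rho> f x)"
      and "dunkl_frac_integral \<alpha> \<rho> f \<in> morrey_space \<alpha> q ?\<psi>"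
      using *[of 1] by simp_all
    show "morrey_norm \<alpha> q ?\<psi> (dunkl_frac_integral \<alpha> \<rho> f) \<le> ennreal C * morrey_norm \<alpha> p \<phi> f"
    proof (rule ennreal_le_epsilon)
      fix e :: real assume e: "e > 0"
      have "ennreal (C * (m + e / C)) = ennreal C * morrey_norm \<alpha> p \<phi> f + ennreal e"
        unfolding m(2) using C m e by (simp add: distrib_left flip: ennreal_mult ennreal_plus)
      then show "morrey_norm \<alpha> q ?\<psi> (dunkl_frac_integral \<alpha> \<rho> f) \<le> ennreal C * morrey_norm \<alpha> p \<phi> f + ennreal e"
        using *[of "e / C"] C e by simp
    qed
  qed
qed

end
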